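(* Let $n\ge1$ be an integer, $\mu\in\mathbb R$ with $\mu^2>\frac14$, and $-1<\ell<0$. Suppose that one of the following holds: (H1) $-1<\ell\le -1+\frac1n$ and $p>1$; (H2) $-1+\frac1n<\ell<0$ and $1<p<p_{\mathrm{Str}}(n,\ell)$. Then, for all $f,g\in C_c^\infty(\mathbb R^n)$ with $f,g\ge0$, $(f,g)\not\equiv(0,0)$, and every $\varepsilon>0$, there is no global weak solution (weak solution on $[0,\infty)$) of $$u_{tt}-(1+t)^{2\ell}\Delta u+\frac{\mu^2}{(1+t)^2}u=|u|^p,\qquad u(x,0)=\varepsilon f(x),\quad u_t(x,0)=\varepsilon g(x).$$
   Context: When $n-1+\frac{\ell}{1+\ell}>0$ (equivalently $\ell>-1+\frac1n$), $p_{\mathrm{Str}}(n,\ell)$ denotes the unique positive root $p$ of $$\Big(n-1+\frac{\ell}{1+\ell}\Big)p^2-\Big(n+1-\frac{3\ell}{1+\ell}\Big)p-2=0.$$ Set $A(t)=\int_0^t(1+s)^\ell\,ds=\frac{(1+t)^{\ell+1}-1}{\ell+1}$. $B_r$ is the ball of radius $r$ centred at $0$. Weak solution (finite-propagation). Let $T\in(0,\infty]$. A function $u$ is a weak solution on $[0,T)$ if: (i) $u\in C^1([0,T);L^1_{\rm loc}(\mathbb R^n))\cap L^p_{\rm loc}([0,T)\times\mathbb R^n)$; (ii) there exists $R_0>0$ such that $\operatorname{supp}f\cup\operatorname{supp}g\subset B_{R_0}$ and, for all $t\in[0,T)$, $\operatorname{supp}u(\cdot,t)\cup\operatorname{supp}u_t(\cdot,t)\subset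 B_{R_0+A(t)}$; (iii) for every $\phi\in C_c^\infty(\mathbb R^n\times[0,T))$, $$\int_0^T\!\!\int_{\mathbb R^n}u\Big(\phi_{tt}-(1+t)^{2\ell}\Delta\phi+\frac{\mu^2}{(1+t)^2}\phi\Big)dx\,dt=\int_0^T\!\!\int_{\mathbb R^n}|u|^p\phi\,dx\,dt+\varepsilon\int_{\mathbb R^n}\big(g(x)\phi(x,0)-f(x)\phi_t(x,0)\big)dx.$$ *)

theory Defs
  imports "HOL-Analysis.Analysis"
begin

text \<open>Space-time points are pairs \<open>(x, t)\<close> in \<open>(real ^ 'n) \<times> real\<close>.  A function on a set \<open>S\<close> is
  a function on the whole type whose values outside \<open>S\<close> are irrelevant.\<close>

subsection \<open>Smooth functions and test functions\<close>

text \<open>Derivatives are taken within \<open>S\<close>, so on \<open>S = UNIV \<times> {0..<T}\<close> the time derivatives at \<open>t = 0\<close>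
  are one-sided, i.e. smoothness on \<open>S\<close> is smoothness up to the boundary \<open>t = 0\<close>.  On this set, as on
  any open set, the derivative within \<open>S\<close> is unique.\<close>

definition partial_within ::
  "'a::euclidean_space set \<Rightarrow> 'a \<Rightarrow> ('a \<Rightarrow> real) \<Rightarrow> 'a \<Rightarrow> real" where
  "partial_within S v f z = frechet_derivative f (at z within S) v"

primrec Ck_on :: "nat \<Rightarrow> 'a::euclidean_space set \<Rightarrow> ('a \<Rightarrow> real) \<Rightarrow> bool" where
  "Ck_on 0 S f \<longleftrightarrow> continuous_on S f"
| "Ck_on (Suc k) S f \<longleftrightarrow>
     f differentiable_on S \<and> (\<forall>b\<in>Basis. Ck_on k S (partial_within S b f))"

definition smooth_on :: "'a::euclidean_space set \<Rightarrow> ('a \<Rightarrow> real) \<Rightarrow> bool" where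
  "smooth_on S f \<longleftrightarrow> (\<forall>k. Ck_on k S f)"

text \<open>\<open>C\<^sub>c\<^sup>\<infinity>(S)\<close>: the compact support has to lie inside \<open>S\<close>; for \<open>S = UNIV \<times> {0..<T}\<close> it may meet
  \<open>{t = 0}\<close>, but stays away from \<open>t = T\<close>.\<close>

definition test_function_on :: "'a::euclidean_space set \<Rightarrow> ('a \<Rightarrow> real) \<Rightarrow> bool" where
  "test_function_on S \<phi> \<longleftrightarrow>
     smooth_on S \<phi> \<and> (\<exists>K. compact K \<and> K \<subseteq> S \<and> (\<forall>z\<in>S - K. \<phi> z = 0))"

definition time_interval :: "ereal \<Rightarrow> real set" where
  "time_interval T = {t. 0 \<le> t \<and> ereal t < T}"

definition slab :: "ereal \<Rightarrow> ((real ^ 'n) \<times> real) set" where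
  "slab T = UNIV \<times> time_interval T"

definition time_deriv ::
  "ereal \<Rightarrow> ((real ^ 'n) \<times> real \<Rightarrow> real) \<Rightarrow> (real ^ 'n) \<times> real \<Rightarrow> real" where
  "time_deriv T \<phi> = partial_within (slab T) (0, 1) \<phi>"

definition space_laplacian ::
  "ereal \<Rightarrow> ((real ^ 'n) \<times> real \<Rightarrow> real) \<Rightarrow> (real ^ 'n) \<times> real \<Rightarrow> real" where
  "space_laplacian T \<phi> z =
     (\<Sum>b\<in>Basis. partial_within (slab T) (b, 0) (partial_within (slab T) (b, 0) \<phi>) z)"

subsection \<open>Function spaces\<close>

definition L1_loc :: "('a::euclidean_space \<Rightarrow> real) \<Rightarrow> bool" where
  "L1_loc h \<longleftrightarrow> (\<forall>K. compact K \<longrightarrow> set_integrable lebesgue K h)"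

definition Lp_loc_on :: "real \<Rightarrow> 'a::euclidean_space set \<Rightarrow> ('a \<Rightarrow> real) \<Rightarrow> bool" where
  "Lp_loc_on p S h \<longleftrightarrow>
     (\<forall>K. compact K \<and> K \<subseteq> S \<longrightarrow>
        set_borel_measurable lebesgue K h \<and> set_integrable lebesgue K (\<lambda>z. \<bar>h z\<bar> powr p))"

definition L1_dist_on ::
  "'a::euclidean_space set \<Rightarrow> ('a \<Rightarrow> real) \<Rightarrow> ('a \<Rightarrow> real) \<Rightarrow> real" where
  "L1_dist_on K h k = (LINT x:K|lebesgue. \<bar>h x - k x\<bar>)"

text \<open>\<open>t \<mapsto> u(\<cdot>, t)\<close> is a \<open>C\<^sup>1\<close> curve on \<open>I\<close> in the Frechet space \<open>L\<^sup>1\<^sub>l\<^sub>o\<^sub>c\<close> (one-sided derivatives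
  at end points of \<open>I\<close>) and \<open>t \<mapsto> ut(\<cdot>, t)\<close> is its derivative, which is thus determined only up to
  null sets for each \<open>t\<close>.\<close>

definition C1_L1_loc ::
  "real set \<Rightarrow> ((real ^ 'n) \<times> real \<Rightarrow> real) \<Rightarrow> ((real ^ 'n) \<times> real \<Rightarrow> real) \<Rightarrow> bool" where
  "C1_L1_loc I u ut \<longleftrightarrow>
     (\<forall>t\<in>I. L1_loc (\<lambda>x. u (x, t)) \<and> L1_loc (\<lambda>x. ut (x, t))) \<and>
     (\<forall>t\<in>I. \<forall>K. compact K \<longrightarrow>
        ((\<lambda>s. L1_dist_on K (\<lambda>x. (u (x, s) - u (x, t)) / (s - t)) (\<lambda>x. ut (x, t))) \<longlongrightarrow> 0)
          (at t within I) \<and>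
        ((\<lambda>s. L1_dist_on K (\<lambda>x. ut (x, s)) (\<lambda>x. ut (x, t))) \<longlongrightarrow> 0) (at t within I))"

text \<open>For a continuous function this is the closure of the set where it does not vanish.\<close>

definition ess_support :: "('a::euclidean_space \<Rightarrow> real) \<Rightarrow> 'a set" where
  "ess_support h = {x. \<forall>r>0. \<not> (AE y in lebesgue. y \<in> ball x r \<longrightarrow> h y = 0)}"

subsection \<open>Critical exponent and propagation speed\<close>

definition p_Str :: "nat \<Rightarrow> real \<Rightarrow> real" where
  "p_Str n l = (THE p. p > 0 \<and>
     (real n - 1 + l / (1 + l)) * p\<^sup>2 - (real n + 1 - 3 * l / (1 + l)) * p - 2 = 0)"

lemma p_Str_ex1:
  assumes "real n - 1 + l / (1 + l) > 0"
  shows "\<exists>!p::real. p > 0 \<and>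
     (real n - 1 + l / (1 + l)) * p\<^sup>2 - (real n + 1 - 3 * l / (1 + l)) * p - 2 = 0"
proof -
  define a where "a = real n - 1 + l / (1 + l)"
  define b where "b = real n + 1 - 3 * l / (1 + l)"
  have a: "a > 0" using assms by (simp add: a_def)
  define d where "d = sqrt (b\<^sup>2 + 8 * a)"
  have d2: "d\<^sup>2 = b\<^sup>2 + 8 * a" using a by (simp add: d_def)
  have "\<bar>b\<bar> < d" unfolding d_def using a by (intro real_less_rsqrt) simp
  then have pos: "(b + d) / (2 * a) > 0" using a by (intro divide_pos_pos) auto
  have "a * ((b + d) / (2 * a))\<^sup>2 - b * ((b + d) / (2 * a)) - 2 = (d\<^sup>2 - b\<^sup>2 - 8 * a) / (4 * a)"
    using a by (simp add: field_simps power2_eq_square)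
  then have root: "a * ((b + d) / (2 * a))\<^sup>2 - b * ((b + d) / (2 * a)) - 2 = 0"
    by (simp add: d2)
  have uniq: "p = q"
    if "p > 0" "a * p\<^sup>2 - b * p - 2 = 0" "q > 0" "a * q\<^sup>2 - b * q - 2 = 0" for p q :: real
  proof -
    have "(p - q) * (a * p * q + 2) = q * (a * p\<^sup>2 - b * p - 2) - p * (a * q\<^sup>2 - b * q - 2)"
      by (simp add: algebra_simps power2_eq_square)
    then have "(p - q) * (a * p * q + 2) = 0" using that by simp
    moreover have "a * p * q + 2 > 0" using a that by (simp add: add_pos_pos)
    ultimately show ?thesis by simp
  qed
  show ?thesis unfolding a_def[symmetric] b_def[symmetric]
    using pos root uniq by blast
qed

definition A_int :: "real \<Rightarrow> real \<Rightarrow> real" where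
  "A_int l t = integral {0..t} (\<lambda>s. (1 + s) powr l)"

subsection \<open>Weak solutions\<close>

text \<open>\<open>u\<close> is a weak solution on \<open>[0, T)\<close> of
  \<open>u\<^sub>t\<^sub>t - (1 + t)\<^sup>2\<^sup>l \<Delta>u + \<mu>\<^sup>2 / (1 + t)\<^sup>2 u = |u|\<^sup>p\<close> with data \<open>(\<epsilon> f, \<epsilon> g)\<close>.\<close>

definition weak_solution ::
  "real \<Rightarrow> real \<Rightarrow> real \<Rightarrow> real \<Rightarrow> (real ^ 'n \<Rightarrow> real) \<Rightarrow> (real ^ 'n \<Rightarrow> real) \<Rightarrow>
   ereal \<Rightarrow> ((real ^ 'n) \<times> real \<Rightarrow> real) \<Rightarrow> bool" where
  "weak_solution l \<mu> p \<epsilon> f g T u \<longleftrightarrow>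
     (\<exists>ut. C1_L1_loc (time_interval T) u ut \<and>
       (\<exists>R0>0. ess_support f \<union> ess_support g \<subseteq> ball 0 R0 \<and>
         (\<forall>t\<in>time_interval T.
            ess_support (\<lambda>x. u (x, t)) \<union> ess_support (\<lambda>x. ut (x, t)) \<subseteq> ball 0 (R0 + A_int l t)))) \<and>
     Lp_loc_on p (slab T) u \<and>
     (\<forall>\<phi>. test_function_on (slab T) \<phi> \<longrightarrow>
        (LINT t:time_interval T|lebesgue. LINT x|lebesgue.
           u (x, t) * (time_deriv T (time_deriv T \<phi>) (x, t)
             - (1 + t) powr (2 * l) * space_laplacian T \<phi> (x, t)
             + \<mu>\<^sup>2 / (1 + t)\<^sup>2 * \<phi> (x, t)))
        = (LINT t:time_interval T|lebesgue. LINT x|lebesgue. \<bar>u (x, t)\<bar> powr p * \<phi> (x, t))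
          + \<epsilon> * (LINT x|lebesgue. g x * \<phi> (x, 0) - f x * time_deriv T \<phi> (x, 0)))"

end

theory Submission
  imports Defs "HOL-Probability.Sinc_Integral" "HOL-Real_Asymp.Real_Asymp"
begin

text \<open>Let \<open>m = l + 1\<close> and let \<open>p'\<close> be the exponent conjugate to \<open>p\<close>.  Testing a global solution with a
  bump in time at scale \<open>T\<close> gives \<open>\<integral>\<integral>|u|\<^sup>p \<le> C T\<^sup>1\<^sup>+\<^sup>n\<^sup>m\<^sup>-\<^sup>2\<^sup>p\<^sup>'\<close> over \<open>T \<le> t \<le> 2T\<close>; the mass term scales like
  \<open>\<partial>\<^sub>t\<^sup>2\<close>, so its size and sign are irrelevant.  For the opposite bound take the positive decaying solution
  \<open>b(t) v(x)\<close> of the linear equation, where \<open>\<Delta>v = \<kappa>\<^sup>2 v\<close> is radial and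
  \<open>b(t) = (1 + t)\<^sup>1\<^sup>/\<^sup>2 K\<^sub>i\<^sub>\<nu>(\<kappa> (1 + t)\<^sup>m / m)\<close> with \<open>m\<^sup>2 \<nu>\<^sup>2 = \<mu>\<^sup>2 - 1/4\<close>.  It is positive on all of \<open>t \<ge> 0\<close>, although
  \<open>K\<^sub>i\<^sub>\<nu>\<close> oscillates near \<open>0\<close>, once \<open>\<kappa>\<close> is large.  Cutting \<open>b\<close> off by \<open>\<eta>(t/T)\<close>, the data produce a positive
  constant that is at most \<open>\<integral>\<integral>|u| v |2b'\<eta>' + b\<eta>''|\<close>, an integral over \<open>T \<le> t \<le> 2T\<close> only.  With Young's
  inequality and \<open>v(x) \<le> C (1 + |x|)\<^sup>-\<^sup>(\<^sup>n\<^sup>-\<^sup>1\<^sup>)\<^sup>/\<^sup>2 e\<^sup>\<kappa>\<^sup>|\<^sup>x\<^sup>|\<close> the two bounds contradict each other as \<open>T \<rightarrow> \<infinity>\<close> exactly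
  when \<open>p\<close> lies below the positive root of the Strauss polynomial, or when that polynomial has none.\<close>

text \<open>Two exponentials have to cancel: on the cone |x| < R + A(t) the growth exp(kappa |x|) of
  v and the decay exp(-kappa A(t)) of b leave only a bounded factor, so the contradiction is decided
  by powers of T. Hence the rates must be sharp, including the factors (1 + |x|)^(-(n-1)/2) and (1 +
  t)^(-l/2). Since mu^2 > 1/4 makes the order of the Macdonald function imaginary, positivity of b
  is not automatic. The eigenvalue kappa^2 is a free parameter: enlarging it pushes the argument of
  the Macdonald function past every zero already at t = 0. It also makes b convex, which forces
  b'(0) < 0; with b(0) > 0 this gives both data the right sign. Neither bound is contradictory
  alone. Young's inequality leaves a free weight delta in the lower bound; with delta = T^s both of
  its terms tend to 0 for some s as soon as omega (p - 1) + y < 0, where y and omega are the powers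
  of T in the upper bound and in the remainder of the lower one. Multiplied by 2 (p - 1), that sum
  is (l + 1) times the Strauss polynomial at p.\<close>

subsection \<open>Calculus of smooth functions\<close>

text \<open>A sufficient condition for derivatives within \<open>S\<close> to be unique.\<close>

definition fat :: "'a::euclidean_space set \<Rightarrow> bool" where
  "fat S \<longleftrightarrow> (\<forall>z\<in>S. \<forall>i\<in>Basis. \<forall>e>0. \<exists>d. 0 < \<bar>d\<bar> \<and> \<bar>d\<bar> < e \<and> z + d *\<^sub>R i \<in> S)"

lemma fatI:
  assumes "\<And>z i d. z \<in> S \<Longrightarrow> i \<in> Basis \<Longrightarrow> d > 0 \<Longrightarrow> z + d *\<^sub>R i \<in> S"
  shows "fat S"
  unfolding fat_def
proof (intro ballI allI impI)
  fix z i :: 'a and e :: real assume "z \<in> S" "i \<in> Basis" "e > 0"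
  then show "\<exists>d. 0 < \<bar>d\<bar> \<and> \<bar>d\<bar> < e \<and> z + d *\<^sub>R i \<in> S"
    by (intro exI[where x="e/2"]) (auto intro: assms)
qed

lemma fat_UNIV: "fat UNIV"
  by (rule fatI) simp

lemma fat_atLeast: "fat {a::real..}"
  by (rule fatI) auto

lemma fat_greaterThan: "fat {a::real<..}"
  by (rule fatI) auto

lemma slab_infinity: "slab \<infinity> = UNIV \<times> {0..}"
  unfolding slab_def time_interval_def by auto

lemma fat_slab: "fat (slab \<infinity> :: ((real ^ 'n) \<times> real) set)"
proof (rule fatI)
  fix z i :: "(real ^ 'n) \<times> real" and d :: real
  assume "z \<in> slab \<infinity>" "i \<in> Basis" "d > 0"
  moreover from this have "0 \<le> snd i" by (auto simp: Basis_prod_def)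
  ultimately show "z + d *\<^sub>R i \<in> slab \<infinity>" by (auto simp: slab_infinity mem_Times_iff)
qed

lemma partial_within_eq:
  assumes "fat S" "z \<in> S" "(f has_derivative f') (at z within S)"
  shows "partial_within S v f z = f' v"
proof -
  have "(f has_derivative frechet_derivative f (at z within S)) (at z within S)"
    using assms(3) frechet_derivative_works differentiable_def by blast
  then have "frechet_derivative f (at z within S) = f'"
    using assms by (intro frechet_derivative_unique_within[OF _ assms(3)]) (auto simp: fat_def)
  then show ?thesis by (simp add: partial_within_def)
qed

text \<open>\<open>frechet_derivative\<close> chooses among all derivatives within \<open>S\<close>,
  and this set of candidates depends only on the values on \<open>S\<close>.\<close>

lemma partial_within_cong:
  assumes "\<And>z. z \<in> S \<Longrightarrow> f z = g z" "z \<in> S"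
  shows "partial_within S v f z = partial_within S v g z"
proof -
  have "(f has_derivative D) (at z within S) \<longleftrightarrow> (g has_derivative D) (at z within S)" for D
    using assms has_derivative_transform[of z S f g] has_derivative_transform[of z S g f] by auto
  then show ?thesis by (simp add: partial_within_def frechet_derivative_def)
qed

lemma Ck_on_cong:
  assumes "\<And>z. z \<in> S \<Longrightarrow> f z = g z"
  shows "Ck_on k S f \<longleftrightarrow> Ck_on k S g"
  using assms
proof (induction k arbitrary: f g)
  case 0
  then show ?case by (simp cong: continuous_on_cong)
next
  case (Suc k)
  have "f differentiable_on S \<longleftrightarrow> g differentiable_on S"
    using Suc.prems by (auto simp: differentiable_on_def intro: differentiable_transform_within[OF _ zero_less_one])
  moreover have "Ck_on k S (partial_within S b f) \<longleftrightarrow> Ck_on k S (partial_within S b g)" for b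
    using Suc.prems by (intro Suc.IH partial_within_cong)
  ultimately show ?case by simp
qed

lemma Ck_on_SucD: "Ck_on (Suc k) S f \<Longrightarrow> Ck_on k S f"
proof (induction k arbitrary: f)
  case 0
  then show ?case by (simp add: differentiable_imp_continuous_on)
next
  case (Suc k)
  from Suc.prems have "f differentiable_on S"
    and "\<forall>b\<in>Basis. Ck_on (Suc k) S (partial_within S b f)" by simp_all
  then show ?case using Suc.IH by simp
qed

text \<open>Lets a proof supply explicit derivatives \<open>D\<close>: on a fat set they must
  coincide with the chosen ones.\<close>

lemma Ck_on_SucI:
  assumes "fat S" "\<And>z. z \<in> S \<Longrightarrow> (f has_derivative D z) (at z within S)"
    and "\<And>b. b \<in> Basis \<Longrightarrow> Ck_on k S (\<lambda>z. D z b)"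
  shows "Ck_on (Suc k) S f"
proof -
  have "Ck_on k S (partial_within S b f)" if "b \<in> Basis" for b
    using Ck_on_cong[of S "partial_within S b f" "\<lambda>z. D z b" k]
      partial_within_eq[OF assms(1) _ assms(2)] assms(3)[OF that] by auto
  moreover have "f differentiable_on S"
    using assms(2) differentiable_def differentiable_on_def by blast
  ultimately show ?thesis by simp
qed

lemma Ck_on_has_derivative:
  assumes "fat S" "Ck_on (Suc k) S f" "z \<in> S"
  shows "(f has_derivative (\<lambda>v. partial_within S v f z)) (at z within S)"
  using assms frechet_derivative_works by (auto simp: partial_within_def differentiable_on_def)

lemma Ck_on_const: "fat S \<Longrightarrow> Ck_on k S (\<lambda>_. c)"
proof (induction k arbitrary: c)
  case (Suc k)
  then show ?case by (intro Ck_on_SucI[where D="\<lambda>_ _. 0"]) auto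
qed simp

lemma Ck_on_bounded_linear:
  assumes "fat S" "bounded_linear f"
  shows "Ck_on k S f"
proof (cases k)
  case 0
  then show ?thesis using assms by (simp add: linear_continuous_on)
next
  case (Suc j)
  show ?thesis unfolding Suc
    by (rule Ck_on_SucI[where D="\<lambda>_. f"])
      (auto simp: assms Ck_on_const bounded_linear_imp_has_derivative)
qed

lemma Ck_on_add:
  assumes "fat S" "Ck_on k S f" "Ck_on k S g"
  shows "Ck_on k S (\<lambda>z. f z + g z)"
  using assms(2,3)
proof (induction k arbitrary: f g)
  case 0
  then show ?case by (auto intro: continuous_intros)
next
  case (Suc k)
  show ?case
  proof (rule Ck_on_SucI[OF assms(1)])
    fix z assume "z \<in> S"
    then show "((\<lambda>z. f z + g z) has_derivative
        (\<lambda>v. partial_within S v f z + partial_within S v g z)) (at z within S)"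
      using Suc.prems by (intro has_derivative_add Ck_on_has_derivative[OF assms(1)])
  next
    fix b :: 'a assume "b \<in> Basis"
    then show "Ck_on k S (\<lambda>z. partial_within S b f z + partial_within S b g z)"
      using Suc by simp
  qed
qed

lemma Ck_on_mult:
  assumes "fat S" "Ck_on k S f" "Ck_on k S g"
  shows "Ck_on k S (\<lambda>z. f z * g z)"
  using assms(2,3)
proof (induction k arbitrary: f g)
  case 0
  then show ?case by (auto intro: continuous_intros)
next
  case (Suc k)
  show ?case
  proof (rule Ck_on_SucI[OF assms(1)])
    fix z assume "z \<in> S"
    then show "((\<lambda>z. f z * g z) has_derivative
        (\<lambda>v. f z * partial_within S v g z + partial_within S v f z * g z)) (at z within S)"
      using Suc.prems by (intro has_derivative_mult Ck_on_has_derivative[OF assms(1)])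
  next
    fix b :: 'a assume b: "b \<in> Basis"
    have "Ck_on k S f" "Ck_on k S g" by (rule Suc.prems[THEN Ck_on_SucD])+
    then show "Ck_on k S (\<lambda>z. f z * partial_within S b g z + partial_within S b f z * g z)"
      using b Suc.prems by (intro Ck_on_add[OF assms(1)] Suc.IH) auto
  qed
qed

text \<open>Induction on \<open>k\<close> with \<open>G\<close> generalized: the chain rule replaces
  \<open>G\<close> by its derivative, while \<open>f\<close> stays and merely loses one
  order.\<close>

lemma Ck_on_compose:
  fixes G :: "real \<Rightarrow> real"
  assumes "fat S" "fat I" "f ` S \<subseteq> I" "Ck_on k I G" "Ck_on k S f"
  shows "Ck_on k S (\<lambda>z. G (f z))"
  using assms(3-5)
proof (induction k arbitrary: G)
  case 0
  then show ?case using continuous_on_compose2[of I G S f] by simp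
next
  case (Suc k)
  show ?case
  proof (rule Ck_on_SucI[OF assms(1)])
    fix z assume z: "z \<in> S"
    have "(G has_derivative (\<lambda>v. partial_within I v G (f z))) (at (f z) within f ` S)"
      using z Suc.prems(1)
      by (intro has_derivative_subset[OF Ck_on_has_derivative[OF assms(2) Suc.prems(2)]]) auto
    from diff_chain_within[OF Ck_on_has_derivative[OF assms(1) Suc.prems(3) z] this]
    have *: "((\<lambda>z. G (f z)) has_derivative (\<lambda>v. partial_within I (partial_within S v f z) G (f z)))
        (at z within S)" by (simp add: o_def)
    \<comment> \<open>The only basis vector of the reals is 1, so the next class is known just for
      the derivative of \<open>G\<close> in direction 1; linearity reduces every direction to
      it.\<close>
    have lin: "partial_within I v G (f z) = v * partial_within I 1 G (f z)" for v
    proof -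
      have "linear (\<lambda>v. partial_within I v G (f z))"
        using z Suc.prems(1)
        by (intro has_derivative_linear[OF Ck_on_has_derivative[OF assms(2) Suc.prems(2)]]) auto
      then have "partial_within I (v *\<^sub>R 1) G (f z) = v *\<^sub>R partial_within I 1 G (f z)"
        by (rule linear_scale)
      then show ?thesis by simp
    qed
    show "((\<lambda>z. G (f z)) has_derivative (\<lambda>v. partial_within S v f z * partial_within I 1 G (f z)))
        (at z within S)" by (rule has_derivative_eq_rhs[OF *]) (rule ext, rule lin)
  next
    fix b :: 'a assume b: "b \<in> Basis"
    have "Ck_on k I (partial_within I 1 G)" using Suc.prems(2) by simp
    from Suc.IH[OF Suc.prems(1) this Suc.prems(3)[THEN Ck_on_SucD]]
    have "Ck_on k S (\<lambda>z. partial_within I 1 G (f z))" .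
    then show "Ck_on k S (\<lambda>z. partial_within S b f z * partial_within I 1 G (f z))"
      using b Suc.prems by (intro Ck_on_mult[OF assms(1)]) auto
  qed
qed

lemma smooth_on_const: "fat S \<Longrightarrow> smooth_on S (\<lambda>_. c)"
  by (simp add: smooth_on_def Ck_on_const)

lemma smooth_on_bounded_linear: "fat S \<Longrightarrow> bounded_linear f \<Longrightarrow> smooth_on S f"
  by (simp add: smooth_on_def Ck_on_bounded_linear)

lemma smooth_on_add: "fat S \<Longrightarrow> smooth_on S f \<Longrightarrow> smooth_on S g \<Longrightarrow> smooth_on S (\<lambda>z. f z + g z)"
  by (simp add: smooth_on_def Ck_on_add)

lemma smooth_on_mult: "fat S \<Longrightarrow> smooth_on S f \<Longrightarrow> smooth_on S g \<Longrightarrow> smooth_on S (\<lambda>z. f z * g z)"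
  by (simp add: smooth_on_def Ck_on_mult)

lemma smooth_on_power: "fat S \<Longrightarrow> smooth_on S f \<Longrightarrow> smooth_on S (\<lambda>z. f z ^ k)"
  by (induction k) (auto intro: smooth_on_const smooth_on_mult)

lemma smooth_on_sum:
  "fat S \<Longrightarrow> (\<And>i. i \<in> A \<Longrightarrow> smooth_on S (f i)) \<Longrightarrow> smooth_on S (\<lambda>z. \<Sum>i\<in>A. f i z)"
  by (induction A rule: infinite_finite_induct) (auto intro: smooth_on_const smooth_on_add)

lemma smooth_on_compose:
  fixes G :: "real \<Rightarrow> real"
  shows "fat S \<Longrightarrow> fat I \<Longrightarrow> smooth_on I G \<Longrightarrow> smooth_on S f \<Longrightarrow> f ` S \<subseteq> I
    \<Longrightarrow> smooth_on S (\<lambda>z. G (f z))"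
  by (simp add: smooth_on_def Ck_on_compose)

lemma smooth_on_affine: "smooth_on UNIV (\<lambda>x::real. a + c * x)"
  by (intro smooth_on_add smooth_on_const smooth_on_bounded_linear bounded_linear_mult_right fat_UNIV)

lemma smooth_on_imp_differentiable_on: "smooth_on S f \<Longrightarrow> f differentiable_on S"
  unfolding smooth_on_def by (drule spec[of _ "Suc 0"]) simp

lemma smooth_on_imp_continuous_on: "smooth_on S f \<Longrightarrow> continuous_on S f"
  unfolding smooth_on_def by (drule spec[of _ 0]) simp

lemma smooth_on_antiderivative:
  fixes G g :: "real \<Rightarrow> real"
  assumes "fat I" "\<And>x. x \<in> I \<Longrightarrow> (G has_real_derivative g x) (at x within I)" "smooth_on I g"
  shows "smooth_on I G"
  unfolding smooth_on_def
proof
  fix k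
  have "Ck_on (Suc k) I G"
    using assms by (intro Ck_on_SucI[where D="\<lambda>x v. g x * v"])
      (auto simp: has_field_derivative_def smooth_on_def)
  then show "Ck_on k I G" by (rule Ck_on_SucD)
qed

lemma smooth_on_derivative:
  fixes G g :: "real \<Rightarrow> real"
  assumes "fat I" "\<And>x. x \<in> I \<Longrightarrow> (G has_real_derivative g x) (at x within I)" "smooth_on I G"
  shows "smooth_on I g"
  unfolding smooth_on_def
proof
  fix k
  have "Ck_on (Suc k) I G" using assms by (simp add: smooth_on_def del: Ck_on.simps)
  then have "Ck_on k I (partial_within I 1 G)" by simp
  moreover have "partial_within I 1 G x = g x" if "x \<in> I" for x
    using partial_within_eq[OF assms(1) that] assms(2)[OF that]
    by (auto simp: has_field_derivative_def)
  ultimately show "Ck_on k I g" using Ck_on_cong by blast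
qed

text \<open>The induction on the order treats all members at once, since the derivative of one is
  the next. Powers, flat functions, the radial power series and the Macdonald functions all come
  with such a sequence.\<close>

lemma smooth_on_derivative_chain:
  fixes G :: "nat \<Rightarrow> real \<Rightarrow> real"
  assumes "fat I" "\<And>j x. x \<in> I \<Longrightarrow> (G j has_real_derivative G (Suc j) x) (at x within I)"
  shows "smooth_on I (G j)"
proof -
  have "Ck_on k I (G j)" for k j
  proof (induction k arbitrary: j)
    case 0
    then show ?case using assms(2) by (auto intro!: DERIV_continuous_on)
  next
    case (Suc k)
    then show ?case
      using assms by (intro Ck_on_SucI[where D="\<lambda>x v. G (Suc j) x * v"])
        (auto simp: has_field_derivative_def)
  qed
  then show ?thesis by (simp add: smooth_on_def)
qed

lemma smooth_on_powr: "smooth_on {0::real<..} (\<lambda>t. t powr r)"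
proof -
  \<comment> \<open>Falling factorials: the j-th derivative of t^r is \<open>c j\<close> times t^(r
    - j).\<close>
  define c where "c j = (\<Prod>i<j. r - real i)" for j :: nat
  have "smooth_on {0<..} (\<lambda>t::real. c 0 * t powr (r - real 0))"
    by (rule smooth_on_derivative_chain[where G="\<lambda>j t. c j * t powr (r - real j)" and j=0])
      (auto intro!: derivative_eq_intros fat_greaterThan simp: c_def algebra_simps)
  then show ?thesis by (simp add: c_def)
qed

subsection \<open>Radial test functions\<close>

text \<open>The profile takes the squared norm as argument, so that a smooth \<open>\<psi>\<close>
  gives a function that is smooth at x = 0 as well.\<close>

definition radial :: "(real \<Rightarrow> real) \<Rightarrow> (real \<Rightarrow> real) \<Rightarrow> (real ^ 'n) \<times> real \<Rightarrow> real" where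
  "radial \<alpha> \<psi> z = \<alpha> (snd z) * \<psi> (fst z \<bullet> fst z)"

lemma smooth_on_inner_self: 
  assumes "fat S"
  shows "smooth_on S (\<lambda>z::(real ^ 'n) \<times> real. fst z \<bullet> fst z)"
proof -
  have "smooth_on S (\<lambda>z::(real ^ 'n) \<times> real. \<Sum>b\<in>Basis. (fst z \<bullet> b) * (fst z \<bullet> b))"
    by (intro smooth_on_sum smooth_on_mult assms smooth_on_bounded_linear
        bounded_linear_compose[OF bounded_linear_inner_left bounded_linear_fst])
  then show ?thesis by (subst euclidean_inner)
qed

lemma radial_test_function:
  assumes \<alpha>: "smooth_on {0..} \<alpha>" "\<And>t. t \<ge> T \<Longrightarrow> \<alpha> t = 0"
    and \<psi>: "smooth_on UNIV \<psi>" "\<And>r. r \<ge> R \<Longrightarrow> \<psi> r = 0"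
  shows "test_function_on (slab \<infinity>) (radial \<alpha> \<psi> :: (real ^ 'n) \<times> real \<Rightarrow> real)"
  unfolding test_function_on_def
proof
  have "smooth_on (slab \<infinity>) (\<lambda>z::(real ^ 'n) \<times> real. \<alpha> (snd z) * \<psi> (fst z \<bullet> fst z))"
    using \<alpha>(1) \<psi>(1)
    by (intro smooth_on_mult fat_slab smooth_on_compose[of "slab \<infinity>" "{0..}" \<alpha>]
        smooth_on_compose[of "slab \<infinity>" UNIV \<psi>])
      (auto simp: slab_infinity fat_atLeast fat_UNIV bounded_linear_snd fat_slab[unfolded slab_infinity]
        intro!: smooth_on_inner_self smooth_on_bounded_linear)
  then show "smooth_on (slab \<infinity>) (radial \<alpha> \<psi> :: (real ^ 'n) \<times> real \<Rightarrow> real)"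
    by (simp add: radial_def[abs_def])
  \<comment> \<open>\<open>\<psi>\<close> vanishes where |x|^2 >= \<open>R\<close>, hence the square
    root; the absolute value covers negative \<open>R\<close>.\<close>
  define K where "K = cball (0::real^'n) (sqrt \<bar>R\<bar>) \<times> {0..T}"
  have "radial \<alpha> \<psi> z = 0" if "z \<in> slab \<infinity> - K" for z :: "(real ^ 'n) \<times> real"
  proof (cases "snd z \<le> T")
    case True
    with that have "norm (fst z) > sqrt \<bar>R\<bar>"
      by (auto simp: slab_infinity K_def mem_Times_iff)
    then have "(norm (fst z))\<^sup>2 \<ge> \<bar>R\<bar>"
      by (metis abs_ge_zero less_eq_real_def norm_ge_zero not_less real_sqrt_less_iff real_sqrt_unique)
    then show ?thesis using \<psi>(2) by (simp add: radial_def dot_square_norm)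
  qed (simp add: radial_def \<alpha>(2))
  moreover have "compact K" "K \<subseteq> slab \<infinity>"
    by (auto simp: K_def slab_infinity compact_Times)
  ultimately show "\<exists>K. compact K \<and> K \<subseteq> slab \<infinity> \<and>
      (\<forall>z\<in>slab \<infinity> - K. radial \<alpha> \<psi> (z::(real ^ 'n) \<times> real) = 0)" by blast
qed

lemma radial_has_derivative:
  fixes z :: "(real ^ 'n) \<times> real"
  assumes "z \<in> slab \<infinity>" "(\<alpha> has_real_derivative \<alpha>') (at (snd z) within {0..})"
    and "(\<psi> has_real_derivative \<psi>') (at (fst z \<bullet> fst z))"
  shows "(radial \<alpha> \<psi> has_derivative
    (\<lambda>v. snd v * \<alpha>' * \<psi> (fst z \<bullet> fst z) + 2 * (fst z \<bullet> fst v) * \<psi>' * \<alpha> (snd z))) (at z within slab \<infinity>)"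
proof -
  have 1: "((\<lambda>z. \<alpha> (snd z)) has_derivative (\<lambda>v. \<alpha>' * snd v)) (at z within slab \<infinity>)"
  proof -
    have "(\<alpha> has_derivative (\<lambda>v. \<alpha>' * v)) (at (snd z) within snd ` slab \<infinity>)"
      using assms(2) by (simp add: has_field_derivative_def slab_infinity)
    from diff_chain_within[OF has_derivative_snd[OF has_derivative_ident] this] show ?thesis
      by (simp add: o_def)
  qed
  have 2: "((\<lambda>z. \<psi> (fst z \<bullet> fst z)) has_derivative (\<lambda>v. \<psi>' * (2 * (fst z \<bullet> fst v)))) (at z within slab \<infinity>)"
  proof -
    have *: "(\<psi> has_derivative (\<lambda>v. \<psi>' * v)) (at (fst z \<bullet> fst z) within (\<lambda>z. fst z \<bullet> fst z) ` slab \<infinity>)"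
      using assms(3) by (auto simp: has_field_derivative_def intro: has_derivative_at_withinI)
    have "((\<lambda>z. fst z \<bullet> fst z) has_derivative (\<lambda>v. 2 * (fst z \<bullet> fst v))) (at z within slab \<infinity>)"
      by (auto intro!: derivative_eq_intros simp: inner_commute)
    from diff_chain_within[OF this *] show ?thesis by (simp add: o_def)
  qed
  have "((\<lambda>z. \<alpha> (snd z) * \<psi> (fst z \<bullet> fst z)) has_derivative
    (\<lambda>v. snd v * \<alpha>' * \<psi> (fst z \<bullet> fst z) + 2 * (fst z \<bullet> fst v) * \<psi>' * \<alpha> (snd z))) (at z within slab \<infinity>)"
    by (rule has_derivative_eq_rhs[OF has_derivative_mult[OF 1 2]]) (simp add: algebra_simps fun_eq_iff)
  then show ?thesis by (simp add: radial_def[abs_def])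
qed

context
  fixes \<alpha> \<alpha>1 \<psi> \<psi>1 \<psi>2 :: "real \<Rightarrow> real"
  assumes \<alpha>1: "\<And>t. t \<ge> 0 \<Longrightarrow> (\<alpha> has_real_derivative \<alpha>1 t) (at t within {0..})"
    and \<psi>1: "\<And>r. (\<psi> has_real_derivative \<psi>1 r) (at r)"
begin

lemma time_deriv_radial:
  assumes "z \<in> slab \<infinity>"
  shows "time_deriv \<infinity> (radial \<alpha> \<psi>) z = radial \<alpha>1 \<psi> z"
proof -
  have "snd z \<ge> 0" using assms by (auto simp: slab_infinity)
  from partial_within_eq[OF fat_slab assms radial_has_derivative[OF assms \<alpha>1[OF this] \<psi>1], of "(0,1)"]
  show ?thesis by (simp add: time_deriv_def radial_def)
qed

text \<open>With r = |x|^2 the second derivative along a unit vector b is 2 psi'(r) + 4 (x . b)^2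
  psi''(r); summing over an orthonormal basis turns the squares into r.\<close>

lemma space_laplacian_radial:
  assumes \<psi>2: "\<And>r. (\<psi>1 has_real_derivative \<psi>2 r) (at r)"
    and "z \<in> slab \<infinity>"
  shows "space_laplacian \<infinity> (radial \<alpha> \<psi> :: (real ^ 'n) \<times> real \<Rightarrow> real) z
    = radial \<alpha> (\<lambda>r. 4 * r * \<psi>2 r + 2 * real CARD('n) * \<psi>1 r) z"
proof -
  have z0: "snd z \<ge> 0" using assms by (auto simp: slab_infinity)
  have first: "partial_within (slab \<infinity>) (b, 0) (radial \<alpha> \<psi>) y = 2 * (fst y \<bullet> b) * radial \<alpha> \<psi>1 y"
    if "y \<in> slab \<infinity>" for b and y :: "(real ^ 'n) \<times> real"
  proof -
    have "snd y \<ge> 0" using that by (auto simp: slab_infinity)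
    from partial_within_eq[OF fat_slab that radial_has_derivative[OF that \<alpha>1[OF this] \<psi>1], of "(b,0)"]
    show ?thesis by (simp add: radial_def)
  qed
  have "partial_within (slab \<infinity>) (b, 0) (partial_within (slab \<infinity>) (b, 0) (radial \<alpha> \<psi>)) z
      = 2 * (b \<bullet> b) * radial \<alpha> \<psi>1 z + 4 * (fst z \<bullet> b)\<^sup>2 * radial \<alpha> \<psi>2 z" for b
  proof -
    have "partial_within (slab \<infinity>) (b, 0) (partial_within (slab \<infinity>) (b, 0) (radial \<alpha> \<psi>)) z
      = partial_within (slab \<infinity>) (b, 0) (\<lambda>y. 2 * (fst y \<bullet> b) * radial \<alpha> \<psi>1 y) z"
      by (intro partial_within_cong first assms)
    also have "\<dots> = 2 * (b \<bullet> b) * radial \<alpha> \<psi>1 z + 2 * (fst z \<bullet> b) * (2 * (fst z \<bullet> b) * radial \<alpha> \<psi>2 z)"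
    proof -
      have "((\<lambda>y. 2 * (fst y \<bullet> b)) has_derivative (\<lambda>v. 2 * (fst v \<bullet> b))) (at z within slab \<infinity>)"
        by (auto intro!: derivative_eq_intros)
      from has_derivative_mult[OF this radial_has_derivative[OF assms(2) \<alpha>1[OF z0] \<psi>2]]
      show ?thesis by (subst partial_within_eq[OF fat_slab assms(2)], assumption)
        (simp add: radial_def algebra_simps)
    qed
    finally show ?thesis by (simp add: power2_eq_square)
  qed
  then have "space_laplacian \<infinity> (radial \<alpha> \<psi>) z
      = (\<Sum>b\<in>Basis. 2 * radial \<alpha> \<psi>1 z + 4 * (fst z \<bullet> b)\<^sup>2 * radial \<alpha> \<psi>2 z)"
    by (simp add: space_laplacian_def cong: sum.cong)
  also have "\<dots> = 2 * real DIM(real^'n) * radial \<alpha> \<psi>1 z + 4 * (\<Sum>b\<in>Basis. (fst z \<bullet> b)\<^sup>2) * radial \<alpha> \<psi>2 z"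
    by (simp add: sum.distrib sum_distrib_left sum_distrib_right)
  also have "(\<Sum>b\<in>Basis. (fst z \<bullet> b)\<^sup>2) = fst z \<bullet> fst z"
    by (subst (2) euclidean_inner) (simp add: power2_eq_square)
  finally show ?thesis by (simp add: radial_def[of \<alpha> _ z] algebra_simps)
qed

end

subsection \<open>A smooth step function\<close>

text \<open>For a polynomial q the derivative of q(1/x) exp(-1/x) is x^(-2) (q - q')(1/x) exp(-1/x).
  The recursion iterates this, so \<open>flat j\<close> is the j-th derivative of the classical flat
  function exp(-1/x).\<close>

primrec flat_poly :: "nat \<Rightarrow> real poly" where
  "flat_poly 0 = 1"
| "flat_poly (Suc j) = monom 1 2 * (flat_poly j - pderiv (flat_poly j))"

definition flat :: "nat \<Rightarrow> real \<Rightarrow> real" where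
  "flat j x = (if x > 0 then poly (flat_poly j) (1 / x) * exp (- 1 / x) else 0)"

lemma tendsto_poly_exp_0:
  fixes q :: "real poly"
  shows "((\<lambda>y. poly q y * exp (- y)) \<longlongrightarrow> 0) at_top"
proof -
  have "((\<lambda>y. \<Sum>i\<le>degree q. coeff q i * (y ^ i / exp y)) \<longlongrightarrow> (\<Sum>i\<le>degree q. coeff q i * 0)) at_top"
    by (intro tendsto_intros tendsto_power_div_exp_0)
  then show ?thesis
    by (simp add: poly_altdef sum_distrib_right exp_minus divide_inverse mult.assoc)
qed

lemma flat_has_derivative: "(flat j has_real_derivative flat (Suc j) x) (at x)"
proof -
  consider "x > 0" | "x < 0" | "x = 0" by linarith
  then show ?thesis
  proof cases
    case 1
    have D: "((\<lambda>x. poly (flat_poly j) (1 / x) * exp (- 1 / x)) has_real_derivative flat (Suc j) x) (at x)"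
      using 1 by (auto intro!: derivative_eq_intros DERIV_chain2[OF poly_DERIV]
          simp: flat_def poly_monom field_simps power2_eq_square)
    have "eventually (\<lambda>y. y > 0) (nhds x)"
      using 1 by (intro order_tendstoD(1)[OF filterlim_ident])
    then have "eventually (\<lambda>y. flat j y = poly (flat_poly j) (1 / y) * exp (- 1 / y)) (nhds x)"
      by eventually_elim (simp add: flat_def)
    from DERIV_cong_ev[OF refl this refl] D show ?thesis by blast
  next
    case 2
    have "eventually (\<lambda>y. y < 0) (nhds x)"
      using 2 by (intro order_tendstoD(2)[OF filterlim_ident])
    then have "eventually (\<lambda>y. flat j y = 0) (nhds x)"
      by eventually_elim (simp add: flat_def)
    from DERIV_cong_ev[OF refl this refl] show ?thesis using 2 by (simp add: flat_def[of "Suc j"])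
  next
    case 3
    have "((\<lambda>h. flat j h / h) \<longlongrightarrow> 0) (at_left 0)"
      by (intro tendsto_eventually) (auto simp: flat_def eventually_at_filter)
    moreover have "((\<lambda>h. flat j h / h) \<longlongrightarrow> 0) (at_right 0)"
    proof -
      \<comment> \<open>With y = 1/h the difference quotient at 0 is y q(y) exp(-y) for q =
        \<open>flat_poly j\<close>.\<close>
      have "((\<lambda>h. poly (monom 1 1 * flat_poly j) (inverse h) * exp (- inverse h)) \<longlongrightarrow> 0) (at_right 0)"
        by (rule filterlim_compose[OF tendsto_poly_exp_0 filterlim_inverse_at_top_right])
      then show ?thesis
        by (rule Lim_transform_eventually)
          (auto simp: eventually_at_filter flat_def poly_monom field_simps)
    qed
    ultimately have "((\<lambda>h. flat j h / h) \<longlongrightarrow> 0) (at 0)"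
      by (simp add: filterlim_split_at)
    then show ?thesis using 3 by (simp add: DERIV_def flat_def)
  qed
qed

lemma smooth_on_flat: "smooth_on UNIV (flat j)"
  by (rule smooth_on_derivative_chain[where G=flat]) (auto intro: fat_UNIV flat_has_derivative)

definition bump :: "real \<Rightarrow> real" where
  "bump x = flat 0 x * flat 0 (1 - x)"

lemma bump_nonneg: "bump x \<ge> 0"
  by (simp add: bump_def flat_def)

lemma bump_eq_0: "x \<le> 0 \<or> x \<ge> 1 \<Longrightarrow> bump x = 0"
  by (auto simp: bump_def flat_def)

lemma smooth_on_bump: "smooth_on UNIV bump"
  unfolding bump_def[abs_def]
  using smooth_on_compose[OF fat_UNIV fat_UNIV smooth_on_flat smooth_on_affine[of 1 "-1"], of 0]
  by (auto intro!: smooth_on_mult fat_UNIV smooth_on_flat)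

lemma bump_integral_pos: "integral {0..1} bump > 0"
proof -
  have cont: "continuous_on A bump" for A
    using smooth_on_imp_continuous_on[OF smooth_on_bump] continuous_on_subset by blast
  have "integral {0..1} bump \<ge> 0"
    by (intro integral_nonneg integrable_continuous_interval cont) (auto simp: bump_nonneg)
  moreover have "integral {0..1} bump \<noteq> 0"
  proof
    assume "integral {0..1} bump = 0"
    then have "\<forall>x\<in>{0..1}. bump x = 0"
      by (subst (asm) integral_eq_0_iff) (auto simp: cont bump_nonneg)
    then have "bump (1/2) = 0" by (auto dest: bspec[of _ _ "1/2"])
    then show False by (simp add: bump_def flat_def)
  qed
  ultimately show ?thesis by simp
qed

definition smooth_step :: "real \<Rightarrow> real" where
  "smooth_step x = (if x \<le> 0 then 0 else integral {0..x} bump / integral {0..1} bump)"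

lemma smooth_step_has_derivative:
  "(smooth_step has_real_derivative bump x / integral {0..1} bump) (at x)"
proof -
  \<comment> \<open>Since \<open>bump\<close> vanishes on the negative axis, the integral may start
    anywhere to the left of 0. Starting it also to the left of x gives one integral formula valid on
    both sides of x.\<close>
  define c where "c = min (x - 1) (- 1)"
  have cont: "continuous_on A bump" for A
    using smooth_on_imp_continuous_on[OF smooth_on_bump] continuous_on_subset by blast
  have eq: "smooth_step y = integral {c..y} bump / integral {0..1} bump" if "y > c" for y
  proof (cases "y \<le> 0")
    case True
    then have "integral {c..y} bump = integral {c..y} (\<lambda>_. 0)"
      by (intro integral_cong) (auto simp: bump_eq_0)
    then show ?thesis using True by (simp add: smooth_step_def)
  next
    case False
    have "integral {c..0} bump = integral {c..0} (\<lambda>_. 0)"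
      by (intro integral_cong) (auto simp: bump_eq_0)
    moreover have "integral {c..0} bump + integral {0..y} bump = integral {c..y} bump"
      using False by (intro Henstock_Kurzweil_Integration.integral_combine
          integrable_continuous_interval cont) (auto simp: c_def)
    ultimately show ?thesis using False by (simp add: smooth_step_def)
  qed
  have xc: "x \<in> interior {c..x+1}" by (auto simp: c_def)
  have "((\<lambda>y. integral {c..y} bump) has_real_derivative bump x) (at x within {c..x+1})"
    by (intro integral_has_real_derivative cont) (auto simp: c_def)
  then have "((\<lambda>y. integral {c..y} bump) has_real_derivative bump x) (at x)"
    unfolding at_within_interior[OF xc] .
  then have D: "((\<lambda>y. integral {c..y} bump / integral {0..1} bump) has_real_derivative
      bump x / integral {0..1} bump) (at x)"
    by (rule DERIV_cdivide)
  have "eventually (\<lambda>y. y > c) (nhds x)"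
    by (intro order_tendstoD(1)[OF filterlim_ident]) (auto simp: c_def)
  then have "eventually (\<lambda>y. smooth_step y = integral {c..y} bump / integral {0..1} bump) (nhds x)"
    by eventually_elim (rule eq)
  from DERIV_cong_ev[OF refl this refl] D show ?thesis by blast
qed

lemma smooth_on_smooth_step: "smooth_on UNIV smooth_step"
proof (rule smooth_on_antiderivative[OF fat_UNIV smooth_step_has_derivative])
  show "smooth_on UNIV (\<lambda>x. bump x / integral {0..1} bump)"
    using smooth_on_mult[OF fat_UNIV smooth_on_bump smooth_on_const[OF fat_UNIV]]
    by (simp add: divide_inverse)
qed

lemma smooth_step_eq_0: "x \<le> 0 \<Longrightarrow> smooth_step x = 0"
  by (simp add: smooth_step_def)

lemma smooth_step_mono: "x \<le> y \<Longrightarrow> smooth_step x \<le> smooth_step y"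
  by (rule DERIV_nonneg_imp_nondecreasing[of x y smooth_step])
    (use smooth_step_has_derivative divide_nonneg_pos[OF bump_nonneg bump_integral_pos] in blast)+

lemma smooth_step_nonneg: "smooth_step x \<ge> 0"
  using smooth_step_mono[of "min x 0" x] by (simp add: smooth_step_eq_0)

lemma smooth_step_eq_1: 
  assumes "x \<ge> 1" shows "smooth_step x = 1"
proof -
  have "smooth_step x = smooth_step 1"
  proof (cases "x = 1")
    case False
    then have "1 < x" using assms by simp
    then show ?thesis
    proof (rule DERIV_isconst_end)
      show "continuous_on {1..x} smooth_step"
        by (intro DERIV_continuous_on[OF has_field_derivative_at_within[OF smooth_step_has_derivative]])
      show "(smooth_step has_real_derivative 0) (at y)" if "1 < y" for y
        using smooth_step_has_derivative[of y] that by (simp add: bump_eq_0)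
    qed
  qed simp
  also have "\<dots> = 1" using bump_integral_pos by (simp add: smooth_step_def)
  finally show ?thesis .
qed

lemma smooth_step_le_1: "smooth_step x \<le> 1"
  using smooth_step_mono[of x "max x 1"] by (simp add: smooth_step_eq_1)

subsection \<open>Radial eigenfunctions of the Laplacian\<close>

text \<open>The recursion comes from comparing coefficients in 4 x F'' + 2 n F' = kappa^2 F, which
  is the eigenvalue equation for F(|x|^2).\<close>

primrec eig_coeff :: "nat \<Rightarrow> real \<Rightarrow> nat \<Rightarrow> real" where
  "eig_coeff n \<kappa> 0 = 1"
| "eig_coeff n \<kappa> (Suc k) = \<kappa>\<^sup>2 / (2 * (real k + 1) * (2 * real k + real n)) * eig_coeff n \<kappa> k"

text \<open>\<open>eig n \<kappa> 0 (\<bar>x\<bar>\<^sup>2)\<close> is the entire radial solution of \<open>\<Delta>v = \<kappa>\<^sup>2 v\<close> on \<open>\<real>\<^sup>n\<close> with \<open>v(0) = 1\<close>;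
  the index \<open>j\<close> counts derivatives.\<close>

definition eig :: "nat \<Rightarrow> real \<Rightarrow> nat \<Rightarrow> real \<Rightarrow> real" where
  "eig n \<kappa> j x = (\<Sum>k. (diffs ^^ j) (eig_coeff n \<kappa>) k * x ^ k)"

lemma eig_coeff_nonneg: "eig_coeff n \<kappa> k \<ge> 0"
  by (induction k) auto

text \<open>The denominators of the recursion are at least k + 1, so the series is dominated by that
  of exp(kappa^2 x) and converges everywhere.\<close>

lemma eig_coeff_le:
  assumes "n \<ge> 1"
  shows "eig_coeff n \<kappa> k \<le> (\<kappa>\<^sup>2) ^ k / fact k"
proof (induction k)
  case (Suc k)
  have "\<kappa>\<^sup>2 / (2 * (real k + 1) * (2 * real k + real n)) \<le> \<kappa>\<^sup>2 / ((real k + 1) * 1)"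
    using assms by (intro divide_left_mono mult_mono) auto
  then have "eig_coeff n \<kappa> (Suc k) \<le> \<kappa>\<^sup>2 / ((real k + 1) * 1) * ((\<kappa>\<^sup>2) ^ k / fact k)"
    unfolding eig_coeff.simps by (intro mult_mono Suc) (auto simp: eig_coeff_nonneg)
  then show ?case by (simp add: field_simps)
qed simp

lemma summable_eig_coeff:
  assumes "n \<ge> 1"
  shows "summable (\<lambda>k. eig_coeff n \<kappa> k * x ^ k)"
proof (rule summable_comparison_test)
  show "summable (\<lambda>k. (\<kappa>\<^sup>2 * \<bar>x\<bar>) ^ k / fact k)"
    using summable_exp[of "\<kappa>\<^sup>2 * \<bar>x\<bar>"] by (simp add: field_simps)
  have "\<bar>eig_coeff n \<kappa> k * x ^ k\<bar> \<le> (\<kappa>\<^sup>2 * \<bar>x\<bar>) ^ k / fact k" for k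
    using mult_right_mono[OF eig_coeff_le[OF assms, of \<kappa> k], of "\<bar>x\<bar> ^ k"] eig_coeff_nonneg[of n \<kappa> k]
    by (simp add: abs_mult power_abs power_mult_distrib)
  then show "\<exists>N. \<forall>k\<ge>N. norm (eig_coeff n \<kappa> k * x ^ k) \<le> (\<kappa>\<^sup>2 * \<bar>x\<bar>) ^ k / fact k"
    by auto
qed

context
  fixes n :: nat and \<kappa> :: real
  assumes n: "n \<ge> 1"
begin

lemma summable_eig: "summable (\<lambda>k. (diffs ^^ j) (eig_coeff n \<kappa>) k * x ^ k)"
proof (induction j arbitrary: x)
  case 0
  then show ?case using summable_eig_coeff[OF n] by simp
next
  case (Suc j)
  then show ?case using termdiff_converges_all[of "(diffs ^^ j) (eig_coeff n \<kappa>)" x] by simp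
qed

lemma eig_has_derivative: "(eig n \<kappa> j has_real_derivative eig n \<kappa> (Suc j) x) (at x)"
  unfolding eig_def[abs_def]
  using termdiffs_strong_converges_everywhere[OF summable_eig[of j]] by simp

lemma smooth_on_eig: "smooth_on UNIV (eig n \<kappa> j)"
  by (rule smooth_on_derivative_chain[where G="eig n \<kappa>"]) (auto intro: fat_UNIV eig_has_derivative)

lemma diffs_nonneg: "(diffs ^^ j) (eig_coeff n \<kappa>) k \<ge> 0"
  by (induction j arbitrary: k) (auto simp: diffs_def eig_coeff_nonneg)

lemma eig_nonneg: "x \<ge> 0 \<Longrightarrow> eig n \<kappa> j x \<ge> 0"
  unfolding eig_def by (intro suminf_nonneg summable_eig) (simp add: diffs_nonneg)

lemma eig_mono: "0 \<le> x \<Longrightarrow> x \<le> y \<Longrightarrow> eig n \<kappa> j x \<le> eig n \<kappa> j y"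
  unfolding eig_def
  by (intro suminf_le summable_eig mult_left_mono power_mono diffs_nonneg)

lemma eig_0_ge_1:
  assumes "x \<ge> 0" shows "eig n \<kappa> 0 x \<ge> 1"
  using eig_mono[of 0 x 0] assms by (simp add: eig_def)

lemma eig_ode: "4 * x * eig n \<kappa> 2 x + 2 * real n * eig n \<kappa> 1 x = \<kappa>\<^sup>2 * eig n \<kappa> 0 x"
proof -
  define c where "c = eig_coeff n \<kappa>"
  have s1: "(\<lambda>k. diffs c k * x ^ k) sums eig n \<kappa> 1 x"
    using summable_sums[OF summable_eig[of 1 x]] by (simp add: eig_def c_def)
  have "(\<lambda>k. diffs (diffs c) k * x ^ k) sums eig n \<kappa> 2 x"
    using summable_sums[OF summable_eig[of 2 x]] by (simp add: eig_def c_def numeral_2_eq_2)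
  from sums_mult[OF this, of x]
  have "(\<lambda>k. real (Suc k) * diffs c (Suc k) * x ^ Suc k) sums (x * eig n \<kappa> 2 x)"
    by (simp add: diffs_def mult_ac)
  \<comment> \<open>The index shift produces no boundary term, because the term k = 0 is
    zero.\<close>
  then have s2: "(\<lambda>k. real k * diffs c k * x ^ k) sums (x * eig n \<kappa> 2 x)"
    by (subst (asm) sums_Suc_iff) simp
  have "(\<lambda>k. 4 * (real k * diffs c k * x ^ k) + 2 * real n * (diffs c k * x ^ k)) sums
     (4 * (x * eig n \<kappa> 2 x) + 2 * real n * eig n \<kappa> 1 x)"
    by (intro sums_add sums_mult s1 s2)
  moreover have "4 * (real k * diffs c k * x ^ k) + 2 * real n * (diffs c k * x ^ k)
      = \<kappa>\<^sup>2 * (c k * x ^ k)" for k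
  proof -
    have "(2 * real k + real n) \<noteq> 0" using n by linarith
    then have "2 * (real k + 1) * (2 * real k + real n) * c (Suc k) = \<kappa>\<^sup>2 * c k"
      by (simp add: c_def)
    then have "(4 * real k + 2 * real n) * diffs c k = \<kappa>\<^sup>2 * c k"
      by (simp add: diffs_def algebra_simps)
    then have "(4 * real k + 2 * real n) * diffs c k * x ^ k = \<kappa>\<^sup>2 * c k * x ^ k" by simp
    then show ?thesis by (simp add: algebra_simps)
  qed
  ultimately have "(\<lambda>k. \<kappa>\<^sup>2 * (c k * x ^ k)) sums
     (4 * (x * eig n \<kappa> 2 x) + 2 * real n * eig n \<kappa> 1 x)" by simp
  moreover have "(\<lambda>k. \<kappa>\<^sup>2 * (c k * x ^ k)) sums (\<kappa>\<^sup>2 * eig n \<kappa> 0 x)"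
    using summable_sums[OF summable_eig[of 0 x]] by (intro sums_mult) (simp add: eig_def c_def)
  ultimately show ?thesis using sums_unique2 by (fastforce simp: mult.assoc)
qed

text \<open>With \<open>k = (n - 1) / 2\<close> the function \<open>y(r) = r\<^sup>k v(r)\<close> satisfies
  \<open>y'' = (\<kappa>\<^sup>2 + k (k - 1) / r\<^sup>2) y\<close>, so \<open>M = y' + \<kappa>y\<close> has \<open>M' \<le> (\<kappa> + a / r\<^sup>2) M\<close>, which integrates
  to \<open>M \<le> C e\<^sup>\<kappa>\<^sup>r\<close>.\<close>

lemma eig_growth:
  assumes "\<kappa> > 0"
  obtains C where "C > 0"
    "\<And>r. r \<ge> 0 \<Longrightarrow> eig n \<kappa> 0 (r\<^sup>2) \<le> C * (1 + r) powr (- (real n - 1) / 2) * exp (\<kappa> * r)"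
proof -
  define k where "k = (real n - 1) / 2"
  have k0: "k \<ge> 0" using n by (simp add: k_def)
  define g where "g r = eig n \<kappa> 0 (r\<^sup>2)" for r
  define g1 where "g1 r = 2 * r * eig n \<kappa> 1 (r\<^sup>2)" for r
  define g2 where "g2 r = 2 * eig n \<kappa> 1 (r\<^sup>2) + 4 * r\<^sup>2 * eig n \<kappa> 2 (r\<^sup>2)" for r
  have sq: "((\<lambda>r. r\<^sup>2) has_real_derivative 2 * r) (at r)" for r :: real
    by (auto intro!: derivative_eq_intros)
  have Deig: "((\<lambda>r. eig n \<kappa> j (r\<^sup>2)) has_real_derivative eig n \<kappa> (Suc j) (r\<^sup>2) * (2 * r)) (at r)" for j r
    by (rule DERIV_chain2[OF eig_has_derivative sq])
  have Dg: "(g has_real_derivative g1 r) (at r)" for r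
    using Deig[of 0 r] by (simp add: g_def[abs_def] g1_def mult_ac)
  have Dg1: "(g1 has_real_derivative g2 r) (at r)" for r
  proof -
    have "((\<lambda>r. 2 * r * eig n \<kappa> 1 (r\<^sup>2)) has_real_derivative
        2 * eig n \<kappa> 1 (r\<^sup>2) + eig n \<kappa> (Suc 1) (r\<^sup>2) * (2 * r) * (2 * r)) (at r)"
      by (rule DERIV_mult[THEN DERIV_cong], rule DERIV_cmult_Id, rule Deig) simp
    then show ?thesis
      by (simp add: g1_def[abs_def] g2_def numeral_2_eq_2 power2_eq_square algebra_simps)
  qed
  have g_nonneg: "g r \<ge> 0" "r \<ge> 0 \<Longrightarrow> g1 r \<ge> 0" for r
    by (auto simp: g_def g1_def intro!: eig_nonneg mult_nonneg_nonneg)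
  have ode: "g2 r + 2 * k / r * g1 r = \<kappa>\<^sup>2 * g r" if "r > 0" for r
  proof -
    have "2 * k / r * g1 r = 2 * (real n - 1) * eig n \<kappa> 1 (r\<^sup>2)"
      using that by (simp add: g1_def k_def)
    then show ?thesis using eig_ode[of "r\<^sup>2"] by (simp add: g_def g2_def algebra_simps)
  qed
  \<comment> \<open>Since kappa y <= M, this \<open>a\<close> makes |k (k - 1)| y / r^2 at most a M
    / r^2. The factor exp(a / r - kappa r) in \<open>N\<close> is the integrating factor of the
    resulting inequality, so \<open>N\<close> is nonincreasing.\<close>
  define a where "a = \<bar>k * (k - 1)\<bar> / \<kappa>"
  define M where "M r = r powr k * (g1 r + k / r * g r + \<kappa> * g r)" for r
  define N where "N r = M r * exp (a / r - \<kappa> * r)" for r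
  have M_ge: "M r \<ge> \<kappa> * (r powr k * g r)" if "r > 0" for r
  proof -
    have "r powr k * (\<kappa> * g r) \<le> M r"
      unfolding M_def using that g_nonneg k0 by (intro mult_left_mono) auto
    then show ?thesis by (simp add: mult_ac)
  qed
  have DN: "\<exists>D. (N has_real_derivative D) (at r) \<and> D \<le> 0" if "r > 0" for r
  proof (intro exI conjI)
    have DM: "(M has_real_derivative \<kappa> * M r + k * (k - 1) / r\<^sup>2 * (r powr k * g r)) (at r)"
    proof -
      have "(M has_real_derivative k * r powr (k - 1) * (g1 r + k / r * g r + \<kappa> * g r)
          + r powr k * (g2 r + (k / r * g1 r - k / r\<^sup>2 * g r) + \<kappa> * g1 r)) (at r)"
        unfolding M_def[abs_def] using that
        by (auto intro!: derivative_eq_intros Dg Dg1 simp: power2_eq_square field_simps)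
      also have "k * r powr (k - 1) * (g1 r + k / r * g r + \<kappa> * g r)
          + r powr k * (g2 r + (k / r * g1 r - k / r\<^sup>2 * g r) + \<kappa> * g1 r)
        = r powr k * ((g2 r + 2 * k / r * g1 r) + k * (k - 1) / r\<^sup>2 * g r + \<kappa> * (g1 r + k / r * g r))"
        using that by (simp add: powr_diff field_simps power2_eq_square)
      also have "\<dots> = \<kappa> * M r + k * (k - 1) / r\<^sup>2 * (r powr k * g r)"
        unfolding ode[OF that] M_def by (simp add: algebra_simps power2_eq_square)
      finally show ?thesis .
    qed
    show "(N has_real_derivative
      (k * (k - 1) * (r powr k * g r) - a * M r) / r\<^sup>2 * exp (a / r - \<kappa> * r)) (at r)"
      unfolding N_def[abs_def] using that
      by (auto intro!: derivative_eq_intros DM simp: power2_eq_square field_simps)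
    have "k * (k - 1) * (r powr k * g r) \<le> \<bar>k * (k - 1)\<bar> * (r powr k * g r)"
      using g_nonneg by (intro mult_right_mono) auto
    also have "\<dots> = a * (\<kappa> * (r powr k * g r))" using assms by (simp add: a_def)
    also have "\<dots> \<le> a * M r" using M_ge[OF that] assms by (intro mult_left_mono) (auto simp: a_def)
    finally show "(k * (k - 1) * (r powr k * g r) - a * M r) / r\<^sup>2 * exp (a / r - \<kappa> * r) \<le> 0"
      by (intro mult_nonpos_nonneg divide_nonpos_nonneg) auto
  qed
  have a0: "a \<ge> 0" using assms by (simp add: a_def)
  have bound: "r powr k * g r \<le> N 1 / \<kappa> * exp (\<kappa> * r)" if "r \<ge> 1" for r
  proof -
    have "N r \<le> N 1" by (rule DERIV_nonpos_imp_nonincreasing[OF that]) (use DN in auto)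
    have "\<kappa> * (r powr k * g r) \<le> M r" using M_ge that by simp
    also have "M r = N r * exp (\<kappa> * r - a / r)" by (simp add: N_def mult_exp_exp)
    also have "\<dots> \<le> N 1 * exp (\<kappa> * r)"
    proof (intro mult_mono \<open>N r \<le> N 1\<close>)
      have "0 \<le> \<kappa> * (1 powr k * g 1)" using assms g_nonneg by simp
      also have "\<dots> \<le> M 1" by (rule M_ge) simp
      finally show "N 1 \<ge> 0" by (simp add: N_def)
    qed (use a0 that in auto)
    finally show ?thesis using assms by (simp add: field_simps)
  qed
  have g1pos: "g 1 \<ge> 1" using eig_0_ge_1[of 1] by (simp add: g_def)
  have N1: "N 1 / \<kappa> \<ge> 0"
  proof -
    have "0 \<le> \<kappa> * (1 powr k * g 1)" using assms g_nonneg by simp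
    also have "\<dots> \<le> M 1" by (rule M_ge) simp
    finally show ?thesis using assms by (simp add: N_def)
  qed
  \<comment> \<open>The factor 2^k pays for 1 + r <= 2 r when r >= 1, where the bound by N(1)
    applies; the summand g(1) covers r < 1 by monotonicity.\<close>
  define C where "C = 2 powr k * (N 1 / \<kappa> + g 1)"
  show thesis
  proof (rule that)
    show "C > 0" unfolding C_def using N1 g1pos by (intro mult_pos_pos add_nonneg_pos) auto
    fix r :: real assume r: "r \<ge> 0"
    have e: "exp (\<kappa> * r) \<ge> 1" using assms r by simp
    have "(1 + r) powr k * g r \<le> C * exp (\<kappa> * r)"
    proof (cases "r \<ge> 1")
      case True
      have "(1 + r) powr k \<le> (2 * r) powr k" using True k0 by (intro powr_mono2) auto
      then have "(1 + r) powr k * g r \<le> 2 powr k * (r powr k * g r)"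
        using g_nonneg r mult_right_mono[of "(1 + r) powr k" "(2 * r) powr k" "g r"] by (simp add: powr_mult)
      also have "\<dots> \<le> 2 powr k * (N 1 / \<kappa> * exp (\<kappa> * r))"
        using bound[OF True] by (intro mult_left_mono) auto
      also have "\<dots> \<le> C * exp (\<kappa> * r)"
        unfolding C_def using g1pos by (simp add: algebra_simps)
      finally show ?thesis .
    next
      case False
      have "(1 + r) powr k * g r \<le> 2 powr k * g 1"
        using False k0 g_nonneg r
        by (intro mult_mono powr_mono2) (auto simp: g_def intro!: eig_mono power_le_one)
      also have "\<dots> \<le> C * 1" unfolding C_def mult_1_right using N1 by (intro mult_left_mono) auto
      also have "\<dots> \<le> C * exp (\<kappa> * r)"
        using e N1 g1pos by (intro mult_left_mono) (auto simp: C_def)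
      finally show ?thesis .
    qed
    then have gle: "g r \<le> C * exp (\<kappa> * r) / (1 + r) powr k"
      using r by (subst pos_le_divide_eq) (auto simp: mult.commute)
    then show "eig n \<kappa> 0 (r\<^sup>2) \<le> C * (1 + r) powr (- (real n - 1) / 2) * exp (\<kappa> * r)"
    proof -
      have "(1 + r) powr (- (real n - 1) / 2) = inverse ((1 + r) powr k)"
        unfolding k_def powr_minus[symmetric] minus_divide_left ..
      then have "C * (1 + r) powr (- (real n - 1) / 2) * exp (\<kappa> * r)
          = C * exp (\<kappa> * r) / (1 + r) powr k" by (simp only: divide_inverse mult_ac)
      with gle show ?thesis unfolding g_def by (simp only:)
    qed
  qed
qed

end

subsection \<open>A Macdonald function of imaginary order\<close>

lemma integral_has_real_derivative_lborel:
  fixes f f' :: "real \<Rightarrow> 'a::euclidean_space \<Rightarrow> real"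
  assumes z: "a < z"
    and int: "\<And>y. a < y \<Longrightarrow> integrable lborel (f y)"
    and D: "\<And>y s. a < y \<Longrightarrow> ((\<lambda>y. f y s) has_real_derivative f' y s) (at y)"
    and bound: "\<And>y s. a < y \<Longrightarrow> \<bar>f' y s\<bar> \<le> g s"
    and g: "integrable lborel g"
    and meas: "f' z \<in> borel_measurable lborel"
  shows "((\<lambda>y. LINT s|lborel. f y s) has_real_derivative (LINT s|lborel. f' z s)) (at z)"
  unfolding has_field_derivative_iff tendsto_at_iff_sequentially comp_def
proof (intro allI impI)
  fix X :: "nat \<Rightarrow> real" assume X: "\<forall>i. X i \<in> UNIV - {z}" and lim: "X \<longlonglongrightarrow> z"
  \<comment> \<open>Only a tail of the sequence lies above \<open>a\<close>, where the majorant is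
    available; dominated convergence is applied along this tail and the offset is removed at the
    end.\<close>
  obtain N where N: "\<And>i. i \<ge> N \<Longrightarrow> a < X i"
    using order_tendstoD(1)[OF lim z] by (auto simp: eventually_sequentially)
  define q where "q i s = (f (X (i + N)) s - f z s) / (X (i + N) - z)" for i s
  have "(\<lambda>i. LINT s|lborel. q i s) \<longlonglongrightarrow> (LINT s|lborel. f' z s)"
  proof (rule integral_dominated_convergence[OF meas _ g])
    show "q i \<in> borel_measurable lborel" for i
      unfolding q_def[abs_def]
      by (intro borel_measurable_divide borel_measurable_diff borel_measurable_const
          borel_measurable_integrable int N z) simp
    have lim': "(\<lambda>i. X (i + N)) \<longlonglongrightarrow> z" using lim by (simp add: LIMSEQ_ignore_initial_segment)
    have "(\<lambda>i. q i s) \<longlonglongrightarrow> f' z s" for s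
      using D[OF z, of s] X lim'
      unfolding q_def has_field_derivative_iff tendsto_at_iff_sequentially comp_def
      by (auto dest!: spec[of _ "\<lambda>i. X (i + N)"])
    then show "AE s in lborel. (\<lambda>i. q i s) \<longlonglongrightarrow> f' z s" by simp
    have "\<bar>q i s\<bar> \<le> g s" for i s
    proof -
      define y where "y = X (i + N)"
      have y: "a < y" "y \<noteq> z" using N[of "i + N"] X by (auto simp: y_def)
      have "norm (f y s - f z s) \<le> g s * norm (y - z)"
        by (rule field_differentiable_bound[of "{a<..}" "\<lambda>y. f y s" "\<lambda>y. f' y s"])
          (auto intro!: has_field_derivative_at_within D bound y z)
      then show ?thesis using y by (simp add: q_def y_def[symmetric] pos_divide_le_eq)
    qed
    then show "AE s in lborel. norm (q i s) \<le> g s" for i by simp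
  qed
  then have "(\<lambda>i. ((LINT s|lborel. f (X (i + N)) s) - (LINT s|lborel. f z s)) / (X (i + N) - z))
      \<longlonglongrightarrow> (LINT s|lborel. f' z s)"
    using int N z by (simp add: q_def Bochner_Integration.integral_diff)
  then show "(\<lambda>i. ((LINT s|lborel. f (X i) s) - (LINT s|lborel. f z s)) / (X i - z))
      \<longlonglongrightarrow> (LINT s|lborel. f' z s)"
    by (rule LIMSEQ_offset)
qed

text \<open>The form in which integration by parts is used below: \<open>F\<close> is the boundary
  term, \<open>f\<close> the complete integrand.\<close>

lemma integral_derivative_eq_0:
  fixes F f :: "real \<Rightarrow> real"
  assumes "\<And>x. (F has_real_derivative f x) (at x)" "\<And>x. isCont f x" "integrable lborel f"
    and "(F \<longlongrightarrow> 0) at_top" "(F \<longlongrightarrow> 0) at_bot"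
  shows "(LINT x|lborel. f x) = 0"
proof -
  have "(LBINT x=-\<infinity>..\<infinity>. f x) = 0 - 0"
    using assms
    by (intro interval_integral_FTC_integrable)
      (auto simp: has_real_derivative_iff_has_vector_derivative ereal_tendsto_simps set_integrable_def)
  then show ?thesis by (simp add: interval_lebesgue_integral_def set_lebesgue_integral_def)
qed

lemma abs_le_abs_sinh: "\<bar>x\<bar> \<le> \<bar>sinh (x::real)\<bar>"
  using real_le_abs_sinh[of x] by (simp add: sinh_field_def exp_minus)

lemma cosh_ge_quadratic: "cosh (s::real) \<ge> 1 + s\<^sup>2 / 2"
proof -
  have "cosh s = cosh (2 * (s/2))" by simp
  also have "\<dots> = 1 + 2 * (sinh (s/2))\<^sup>2" by (subst cosh_double) (simp add: cosh_square_eq)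
  also have "\<dots> \<ge> 1 + 2 * (s/2)\<^sup>2"
    using abs_le_abs_sinh[of "s/2"] unfolding abs_le_square_iff by simp
  finally show ?thesis by (simp add: power_divide)
qed

lemma cos_ge_quadratic: "cos (x::real) \<ge> 1 - x\<^sup>2 / 2"
proof -
  have "cos x = cos (2 * (x/2))" by simp
  also have "\<dots> = 1 - 2 * (sin (x/2))\<^sup>2" by (subst cos_double_sin) simp
  also have "\<dots> \<ge> 1 - 2 * (x/2)\<^sup>2"
    using abs_sin_x_le_abs_x[of "x/2"] unfolding abs_le_square_iff by simp
  finally show ?thesis by (simp add: power_divide)
qed

lemma power_le_exp:
  assumes "x \<ge> 0" "c > 0"
  shows "x ^ j \<le> fact j / c ^ j * exp (c * (x::real))"
proof -
  have "(c * x) ^ j / fact j \<le> exp (c * x)"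
    using sum_le_suminf[of "\<lambda>n. (c * x) ^ n /\<^sub>R fact n" "{j}"] assms summable_exp[of "c * x"]
    by (simp add: exp_def divide_inverse mult.commute)
  then show ?thesis using assms by (simp add: power_mult_distrib field_simps)
qed

lemma exp_minus_le_inverse:
  fixes x y :: real
  assumes "0 \<le> y" "y \<le> x"
  shows "exp (- x) \<le> 1 / (1 + y)"
proof -
  have "1 + y \<le> exp x" using assms exp_ge_add_one_self[of x] by linarith
  then have "1 / exp x \<le> 1 / (1 + y)" using assms by (intro divide_left_mono mult_pos_pos) auto
  then show ?thesis by (simp add: exp_minus inverse_eq_divide)
qed

lemma integrable_inverse_1_plus_square_lborel: "integrable lborel (\<lambda>x::real. 1 / (1 + x\<^sup>2))"
  using integrable_inverse_1_plus_square by (simp add: set_integrable_def divide_inverse)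

text \<open>Half of the exponent absorbs the power of cosh. The other half, with cosh s >= 1 +
  s^2/2, is of Gaussian type and is relaxed to a rational function, whose integral is a rescaled
  integral of 1/(1 + s^2).\<close>

lemma cosh_power_exp_le:
  fixes s z :: real
  assumes z: "z > 0"
  shows "cosh s ^ j * exp (- (z * cosh s)) \<le> fact j / (z/2) ^ j * exp (- z/2) * (1 / (1 + z * s\<^sup>2 / 4))"
proof -
  have "cosh s ^ j * exp (- (z * cosh s)) \<le> fact j / (z/2) ^ j * exp (z/2 * cosh s) * exp (- (z * cosh s))"
    using z by (intro mult_right_mono power_le_exp) auto
  also have "\<dots> = fact j / (z/2) ^ j * exp (- (z/2 * cosh s))"
    by (simp add: mult_exp_exp mult.assoc field_simps)
  also have "\<dots> \<le> fact j / (z/2) ^ j * (exp (- z/2) * exp (- (z * s\<^sup>2 / 4)))"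
  proof -
    have "z/2 * (1 + s\<^sup>2/2) \<le> z/2 * cosh s" using z cosh_ge_quadratic by (intro mult_left_mono) auto
    then show ?thesis using z
      by (intro mult_left_mono) (auto simp: mult_exp_exp algebra_simps)
  qed
  also have "\<dots> \<le> fact j / (z/2) ^ j * (exp (- z/2) * (1 / (1 + z * s\<^sup>2 / 4)))"
    using z by (intro mult_left_mono exp_minus_le_inverse) auto
  finally show ?thesis by (simp only: mult.assoc)
qed

lemma
  assumes z: "(z::real) > 0"
  shows integrable_quadratic: "integrable lborel (\<lambda>s. 1 / (1 + z * s\<^sup>2 / 4))"
    and integral_quadratic: "(LINT s|lborel. 1 / (1 + z * s\<^sup>2 / 4))
      = 2 / sqrt z * (LINT s|lborel. 1 / (1 + s\<^sup>2))"
proof -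
  have eq: "1 / (1 + (0 + sqrt z / 2 * s)\<^sup>2) = 1 / (1 + z * s\<^sup>2 / 4)" for s
    using z by (simp add: power_mult_distrib power_divide)
  show "integrable lborel (\<lambda>s. 1 / (1 + z * s\<^sup>2 / 4))"
    using lborel_integrable_real_affine[OF integrable_inverse_1_plus_square_lborel, of "sqrt z / 2" 0] z
    unfolding eq by simp
  show "(LINT s|lborel. 1 / (1 + z * s\<^sup>2 / 4)) = 2 / sqrt z * (LINT s|lborel. 1 / (1 + s\<^sup>2))"
    using lborel_integral_real_affine[of "sqrt z / 2" "\<lambda>s. 1 / (1 + s\<^sup>2)" 0] z
    unfolding eq by (simp add: field_simps)
qed

lemma integrable_cosh_power_exp:
  assumes z: "z > 0"
  shows "integrable lborel (\<lambda>s::real. cosh s ^ j * exp (- (z * cosh s)))"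
proof (rule Bochner_Integration.integrable_bound)
  show "integrable lborel (\<lambda>s. fact j / (z/2) ^ j * exp (- z/2) * (1 / (1 + z * s\<^sup>2 / 4)))"
    using integrable_quadratic[OF z] by (intro integrable_mult_right)
  show "AE s in lborel. norm (cosh s ^ j * exp (- (z * cosh s)))
      \<le> norm (fact j / (z/2) ^ j * exp (- z/2) * (1 / (1 + z * s\<^sup>2 / 4)))"
  proof (rule AE_I2)
    fix s :: real
    have "norm (cosh s ^ j * exp (- (z * cosh s))) = cosh s ^ j * exp (- (z * cosh s))" by simp
    also have "\<dots> \<le> fact j / (z/2) ^ j * exp (- z/2) * (1 / (1 + z * s\<^sup>2 / 4))"
      by (rule cosh_power_exp_le[OF z])
    finally show "norm (cosh s ^ j * exp (- (z * cosh s)))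
      \<le> norm (fact j / (z/2) ^ j * exp (- z/2) * (1 / (1 + z * s\<^sup>2 / 4)))"
      unfolding real_norm_def by (rule order_trans[OF _ abs_ge_self])
  qed
  show "(\<lambda>s::real. cosh s ^ j * exp (- (z * cosh s))) \<in> borel_measurable lborel"
    unfolding measurable_lborel2 by (intro borel_measurable_continuous_onI continuous_intros)
qed

lemma integrable_dominated_cosh:
  fixes h :: "real \<Rightarrow> real"
  assumes z: "z > 0" and cont: "continuous_on UNIV h" and le: "\<And>s. \<bar>h s\<bar> \<le> K * cosh s ^ j"
  shows "integrable lborel (\<lambda>s. h s * exp (- (z * cosh s)))"
proof (rule Bochner_Integration.integrable_bound)
  show "integrable lborel (\<lambda>s. K * (cosh s ^ j * exp (- (z * cosh s))))"
    using integrable_cosh_power_exp[OF z] by (intro integrable_mult_right)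
  show "AE s in lborel. norm (h s * exp (- (z * cosh s))) \<le> norm (K * (cosh s ^ j * exp (- (z * cosh s))))"
  proof (rule AE_I2)
    fix s
    have "\<bar>h s\<bar> * exp (- (z * cosh s)) \<le> K * cosh s ^ j * exp (- (z * cosh s))"
      by (intro mult_right_mono le) auto
    also have "\<dots> \<le> \<bar>K * cosh s ^ j * exp (- (z * cosh s))\<bar>" by simp
    finally show "norm (h s * exp (- (z * cosh s))) \<le> norm (K * (cosh s ^ j * exp (- (z * cosh s))))"
      by (simp add: abs_mult mult.assoc)
  qed
  show "(\<lambda>s. h s * exp (- (z * cosh s))) \<in> borel_measurable lborel"
    unfolding measurable_lborel2 by (intro borel_measurable_continuous_onI continuous_intros cont)
qed

lemma tendsto_dominated_cosh:
  fixes h :: "real \<Rightarrow> real"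
  assumes z: "z > 0" and le: "\<And>s. \<bar>h s\<bar> \<le> K * cosh s ^ j"
  shows "((\<lambda>s. h s * exp (- (z * cosh s))) \<longlongrightarrow> 0) at_top"
    and "((\<lambda>s. h s * exp (- (z * cosh s))) \<longlongrightarrow> 0) at_bot"
proof -
  have K: "((\<lambda>y. K * (y ^ j * exp (- (z * y)))) \<longlongrightarrow> 0) at_top"
  proof -
    have "((\<lambda>y. (z * y) ^ j / exp (z * y)) \<longlongrightarrow> 0) at_top"
      using z by (intro filterlim_compose[OF tendsto_power_div_exp_0]
          filterlim_tendsto_pos_mult_at_top[OF tendsto_const] filterlim_ident)
    then have "((\<lambda>y. K / z ^ j * ((z * y) ^ j / exp (z * y))) \<longlongrightarrow> K / z ^ j * 0) at_top"
      by (intro tendsto_intros)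
    moreover have "K / z ^ j * ((z * y) ^ j / exp (z * y)) = K * (y ^ j * exp (- (z * y)))" for y
      using z by (simp add: exp_minus power_mult_distrib field_simps)
    ultimately show ?thesis by simp
  qed
  have "norm (h s * exp (- (z * cosh s))) \<le> K * (cosh s ^ j * exp (- (z * cosh s)))" for s
    using mult_right_mono[OF le[of s], of "exp (- (z * cosh s))"] by (simp add: abs_mult mult.assoc)
  note bnd = always_eventually[OF allI[OF this]]
  show "((\<lambda>s. h s * exp (- (z * cosh s))) \<longlongrightarrow> 0) at_top"
    by (rule Lim_null_comparison[OF bnd filterlim_compose[OF K cosh_real_at_top]])
  show "((\<lambda>s. h s * exp (- (z * cosh s))) \<longlongrightarrow> 0) at_bot"
    by (rule Lim_null_comparison[OF bnd filterlim_compose[OF K cosh_real_at_bot]])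
qed

text \<open>\<open>macdonald \<nu> 0 z\<close> is \<open>2 K\<^sub>i\<^sub>\<nu>(z)\<close> and \<open>macdonald \<nu> j\<close> its \<open>j\<close>-th derivative.\<close>

definition macdonald :: "real \<Rightarrow> nat \<Rightarrow> real \<Rightarrow> real" where
  "macdonald \<nu> j z = (LINT s|lborel. ((- cosh s) ^ j * cos (\<nu> * s)) * exp (- (z * cosh s)))"

lemma abs_cosh_cos_le: "\<bar>(- cosh s) ^ j * cos (\<nu> * s)\<bar> \<le> 1 * cosh (s::real) ^ j"
  by (simp add: abs_mult power_abs mult_left_le)

lemma macdonald_integrable:
  "z > 0 \<Longrightarrow> integrable lborel (\<lambda>s::real. ((- cosh s) ^ j * cos (\<nu> * s)) * exp (- (z * cosh s)))"
  by (rule integrable_dominated_cosh[of z "\<lambda>s. (- cosh s) ^ j * cos (\<nu> * s)" 1 j])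
    (use abs_cosh_cos_le in \<open>auto intro!: continuous_intros\<close>)

lemma macdonald_has_derivative:
  assumes z: "z > 0"
  shows "(macdonald \<nu> j has_real_derivative macdonald \<nu> (Suc j) z) (at z)"
  unfolding macdonald_def[abs_def]
\<comment> \<open>Parameters above z/2 share one integrable majorant.\<close>
proof (rule integral_has_real_derivative_lborel[where a = "z/2"])
  show "z/2 < z" using z by simp
  show "integrable lborel (\<lambda>s. ((- cosh s) ^ j * cos (\<nu> * s)) * exp (- (y * cosh s)))" if "z/2 < y" for y
    using macdonald_integrable z that by simp
  show "((\<lambda>y. ((- cosh s) ^ j * cos (\<nu> * s)) * exp (- (y * cosh s))) has_real_derivative
      ((- cosh s) ^ Suc j * cos (\<nu> * s)) * exp (- (y * cosh s))) (at y)" for y s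
    by (auto intro!: derivative_eq_intros)
  show "integrable lborel (\<lambda>s. cosh s ^ Suc j * exp (- (z/2 * cosh s)))"
    using integrable_cosh_power_exp[of "z/2" "Suc j"] z by simp
  show "\<bar>((- cosh s) ^ Suc j * cos (\<nu> * s)) * exp (- (y * cosh s))\<bar> \<le> cosh s ^ Suc j * exp (- (z/2 * cosh s))"
    if "z/2 < y" for y s
  proof -
    have "\<bar>(- cosh s) ^ Suc j * cos (\<nu> * s)\<bar> * exp (- (y * cosh s)) \<le> cosh s ^ Suc j * exp (- (z/2 * cosh s))"
      using that abs_cosh_cos_le[of s "Suc j" \<nu>] by (intro mult_mono) auto
    then show ?thesis by (simp add: abs_mult)
  qed
  show "(\<lambda>s. ((- cosh s) ^ Suc j * cos (\<nu> * s)) * exp (- (z * cosh s))) \<in> borel_measurable lborel"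
    by (rule borel_measurable_integrable[OF macdonald_integrable[OF z]])
qed

lemma smooth_on_macdonald: "smooth_on {0<..} (macdonald \<nu> j)"
  by (rule smooth_on_derivative_chain[where G="macdonald \<nu>"])
    (auto intro: fat_greaterThan has_field_derivative_at_within macdonald_has_derivative)

text \<open>With c(s) = cos(nu s) and E(s) = exp(-z cosh s), the difference of the two sides has the
  integrand E'' c - E c''. This is the derivative of the Wronskian E' c - E c', which vanishes at
  both ends; \<open>h s * E s\<close> is that Wronskian.\<close>

lemma macdonald_ode:
  assumes z: "z > 0"
  shows "z\<^sup>2 * macdonald \<nu> 2 z + z * macdonald \<nu> 1 z = (z\<^sup>2 - \<nu>\<^sup>2) * macdonald \<nu> 0 z"
proof -
  define E where "E s = exp (- (z * cosh s))" for s :: real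
  define h where "h s = - z * sinh s * cos (\<nu> * s) + \<nu> * sin (\<nu> * s)" for s :: real
  have h_le: "\<bar>h s\<bar> \<le> (z + \<bar>\<nu>\<bar>) * cosh s ^ 1" for s
  proof -
    have "\<bar>sinh s\<bar> \<le> cosh s" by (metis cosh_real_abs sinh_real_abs sinh_le_cosh_real)
    then have "\<bar>z * sinh s * cos (\<nu> * s)\<bar> \<le> z * cosh s * 1"
      using z by (simp only: abs_mult) (intro mult_mono, auto)
    moreover have "\<bar>\<nu> * sin (\<nu> * s)\<bar> \<le> \<bar>\<nu>\<bar> * cosh s"
      using order_trans[OF abs_sin_le_one cosh_real_ge_1] by (simp only: abs_mult) (intro mult_mono, auto)
    ultimately show ?thesis by (simp add: h_def algebra_simps)
  qed
  define G where "G s = z\<^sup>2 * (((- cosh s) ^ 2 * cos (\<nu> * s)) * E s)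
     + z * (((- cosh s) ^ 1 * cos (\<nu> * s)) * E s)
     - (z\<^sup>2 - \<nu>\<^sup>2) * (((- cosh s) ^ 0 * cos (\<nu> * s)) * E s)" for s
  note int = macdonald_integrable[OF z, folded E_def]
  have "(LINT s|lborel. G s) = 0"
  proof (rule integral_derivative_eq_0[where F="\<lambda>s. h s * E s"])
    show "((\<lambda>s. h s * E s) has_real_derivative G s) (at s)" for s
    proof -
      have "((\<lambda>s. h s * E s) has_real_derivative
         (- z * cosh s * cos (\<nu> * s) + z * \<nu> * sinh s * sin (\<nu> * s) + \<nu>\<^sup>2 * cos (\<nu> * s)) * E s
         + h s * (- z * sinh s) * E s) (at s)"
        unfolding h_def[abs_def] E_def[abs_def]
        by (auto intro!: derivative_eq_intros simp: power2_eq_square algebra_simps)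
      also have "(- z * cosh s * cos (\<nu> * s) + z * \<nu> * sinh s * sin (\<nu> * s) + \<nu>\<^sup>2 * cos (\<nu> * s)) * E s
         + h s * (- z * sinh s) * E s = (z\<^sup>2 * (sinh s)\<^sup>2 - z * cosh s + \<nu>\<^sup>2) * cos (\<nu> * s) * E s"
        by (simp add: h_def algebra_simps power2_eq_square)
      also have "\<dots> = G s"
        unfolding sinh_square_eq G_def by (simp add: algebra_simps)
      finally show ?thesis .
    qed
    show "isCont G s" for s
      unfolding G_def[abs_def] E_def[abs_def] by (intro continuous_intros)
    show "integrable lborel G"
      unfolding G_def[abs_def] by (intro Bochner_Integration.integrable_add
          Bochner_Integration.integrable_diff integrable_mult_right int)
    show "((\<lambda>s. h s * E s) \<longlongrightarrow> 0) at_top" "((\<lambda>s. h s * E s) \<longlongrightarrow> 0) at_bot"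
      unfolding E_def by (rule tendsto_dominated_cosh[OF z h_le])+
  qed
  moreover have "(LINT s|lborel. G s) = z\<^sup>2 * macdonald \<nu> 2 z + z * macdonald \<nu> 1 z - (z\<^sup>2 - \<nu>\<^sup>2) * macdonald \<nu> 0 z"
    unfolding G_def macdonald_def E_def[symmetric]
    by (simp only: Bochner_Integration.integral_diff Bochner_Integration.integral_add
        Bochner_Integration.integral_mult_right Bochner_Integration.integrable_add integrable_mult_right int)
  ultimately show ?thesis by simp
qed

text \<open>The full factor exp(-z) matters, as it must later balance the growth of v;
  \<open>cosh_power_exp_le\<close> gives only exp(-z/2). Writing cosh s = 1 + y separates exp(-z)
  exactly. Half of exp(-z y) absorbs the factor cosh s, the rest decays in s at scale
  z^(-1/2).\<close>

lemma macdonald_bound: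
  obtains C where "C > 0"
    "\<And>\<nu> j z. j \<le> 1 \<Longrightarrow> z \<ge> 1 \<Longrightarrow> \<bar>macdonald \<nu> j z\<bar> \<le> C / sqrt z * exp (- z)"
proof
  define Q where "Q = (LINT s|lborel. 1 / (1 + s\<^sup>2 :: real))"
  have Q: "Q \<ge> 0" unfolding Q_def by (intro Bochner_Integration.integral_nonneg) (auto intro: add_nonneg_nonneg)
  \<comment> \<open>The 6 is 3 from the pointwise majorant times 2 from rescaling s by sqrt z / 2;
    the added 1 gives positivity from Q >= 0 alone.\<close>
  show "6 * Q + 1 > 0" using Q by simp
  fix \<nu> z :: real and j :: nat assume j: "j \<le> 1" and z: "z \<ge> 1"
  have le: "\<bar>((- cosh s) ^ j * cos (\<nu> * s)) * exp (- (z * cosh s))\<bar> \<le> 3 * exp (- z) * (1 / (1 + z * s\<^sup>2 / 4))" for s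
  proof -
    define y where "y = cosh s - 1"
    have y: "y \<ge> s\<^sup>2 / 2" using cosh_ge_quadratic[of s] by (simp add: y_def)
    have y0: "y \<ge> 0" using cosh_real_ge_1 by (simp add: y_def)
    have "\<bar>(- cosh s) ^ j * cos (\<nu> * s)\<bar> \<le> cosh s ^ j" using abs_cosh_cos_le[of s j \<nu>] by simp
    also have "\<dots> \<le> cosh s" using j cosh_real_ge_1[of s] by (cases j) auto
    also have "cosh s \<le> 3 * exp (z * y / 2)"
    proof -
      have "1 + y / 2 \<le> exp (y / 2)" by simp
      also have "\<dots> \<le> exp (z * y / 2)" using y0 z by (auto simp: mult_left_le mult_le_cancel_right1)
      finally have "1 + y / 2 \<le> exp (z * y / 2)" .
      moreover have "1 + y \<le> 2 * (1 + y / 2)" using y0 by simp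
      moreover have "cosh s = 1 + y" by (simp add: y_def)
      moreover have "exp (z * y / 2) \<ge> 0" by simp
      ultimately show ?thesis by linarith
    qed
    finally have "\<bar>((- cosh s) ^ j * cos (\<nu> * s)) * exp (- (z * cosh s))\<bar>
        \<le> 3 * exp (z * y / 2) * exp (- (z * (1 + y)))"
      by (subst abs_mult) (auto intro!: mult_right_mono simp: y_def)
    also have "\<dots> = 3 * exp (- z) * exp (- (z * y / 2))"
      by (simp add: mult_exp_exp algebra_simps)
    also have "exp (- (z * y / 2)) \<le> 1 / (1 + z * s\<^sup>2 / 4)"
      using mult_left_mono[OF y, of z] z by (intro exp_minus_le_inverse) auto
    finally show ?thesis by simp
  qed
  have z0: "z > 0" using z by simp
  have "\<bar>macdonald \<nu> j z\<bar> \<le> (LINT s|lborel. 3 * exp (- z) * (1 / (1 + z * s\<^sup>2 / 4)))"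
    unfolding macdonald_def
    by (rule order_trans[OF integral_abs_bound], rule integral_mono)
      (use le in \<open>auto intro!: integrable_mult_right integrable_abs macdonald_integrable[OF z0]
        integrable_quadratic[OF z0] simp del: times_divide_eq_right\<close>)
  also have "\<dots> = 3 * exp (- z) * (2 / sqrt z * Q)"
    using integral_quadratic[OF z0] by (simp only: Bochner_Integration.integral_mult_right_zero Q_def)
  also have "\<dots> = 6 * Q / sqrt z * exp (- z)" by simp
  also have "\<dots> \<le> (6 * Q + 1) / sqrt z * exp (- z)"
    using z by (intro mult_right_mono divide_right_mono) auto
  finally show "\<bar>macdonald \<nu> j z\<bar> \<le> (6 * Q + 1) / sqrt z * exp (- z)" .
qed

text \<open>Let W be the integral of E(s) = exp(-z cosh s). Integrating s E by parts shows that z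
  times the integral of s sinh s E is W, and s^2 <= s sinh s, so the second moment of E is at most
  W/z. With cos(nu s) >= 1 - nu^2 s^2/2 the integral is at least W (1 - nu^2/(2 z)).\<close>

lemma macdonald_pos:
  assumes z: "z > 0" "\<nu>\<^sup>2 < 2 * z"
  shows "macdonald \<nu> 0 z > 0"
proof -
  define E where "E s = exp (- (z * cosh s))" for s :: real
  have cosh1: "\<bar>sinh s\<bar> \<le> cosh s" for s :: real by (metis cosh_real_abs sinh_real_abs sinh_le_cosh_real)
  have s_le: "\<bar>s\<bar> \<le> 1 * cosh s ^ 1" for s :: real
    using abs_le_abs_sinh[of s] cosh1[of s] by simp
  have ss_le: "\<bar>s * sinh s\<bar> \<le> 1 * cosh s ^ 2" for s :: real
    using mult_mono[of "\<bar>s\<bar>" "cosh s" "\<bar>sinh s\<bar>" "cosh s"] s_le[of s] cosh1[of s]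
    by (simp add: abs_mult power2_eq_square)
  have sq_le: "\<bar>s\<^sup>2\<bar> \<le> 1 * cosh s ^ 2" for s :: real
    using s_le[of s] by (simp add: abs_le_square_iff[symmetric])
  have i0: "integrable lborel (\<lambda>s. 1 * E s)"
    unfolding E_def by (rule integrable_dominated_cosh[OF z(1), of _ 1 0]) auto
  have i1: "integrable lborel (\<lambda>s. s * sinh s * E s)"
    unfolding E_def by (rule integrable_dominated_cosh[OF z(1) _ ss_le]) (auto intro!: continuous_intros)
  have i2: "integrable lborel (\<lambda>s. s\<^sup>2 * E s)"
    unfolding E_def by (rule integrable_dominated_cosh[OF z(1) _ sq_le]) (auto intro!: continuous_intros)
  define W where "W = (LINT s|lborel. E s)"
  have W: "W > 0"
  proof -
    have "W \<noteq> 0"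
    proof
      assume "W = 0"
      moreover have "integrable lborel E" using i0 by simp
      moreover have "AE s in lborel. 0 \<le> E s" by (simp add: E_def)
      ultimately have "AE s in lborel. E s = 0"
        using integral_nonneg_eq_0_iff_AE[of lborel E] by (simp add: W_def)
      then have "AE s::real in lborel. False" by (simp add: E_def)
      then show False by (simp add: AE_iff_null null_sets_def)
    qed
    moreover have "W \<ge> 0" unfolding W_def E_def by (intro Bochner_Integration.integral_nonneg) auto
    ultimately show ?thesis by simp
  qed
  have "(LINT s|lborel. z * (s * sinh s * E s) - 1 * E s) = 0"
  proof (rule integral_derivative_eq_0[where F="\<lambda>s. - s * E s"])
    show "((\<lambda>s. - s * E s) has_real_derivative z * (s * sinh s * E s) - 1 * E s) (at s)" for s
      unfolding E_def[abs_def] by (auto intro!: derivative_eq_intros)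
    show "isCont (\<lambda>s. z * (s * sinh s * E s) - 1 * E s) s" for s
      unfolding E_def[abs_def] by (intro continuous_intros)
    show "integrable lborel (\<lambda>s. z * (s * sinh s * E s) - 1 * E s)"
      by (intro Bochner_Integration.integrable_diff integrable_mult_right i0 i1)
    have "\<bar>- s\<bar> \<le> 1 * cosh s ^ 1" for s :: real using s_le[of s] by simp
    then show "((\<lambda>s. - s * E s) \<longlongrightarrow> 0) at_top" "((\<lambda>s. - s * E s) \<longlongrightarrow> 0) at_bot"
      unfolding E_def by (rule tendsto_dominated_cosh[OF z(1)])+
  qed
  then have parts: "z * (LINT s|lborel. s * sinh s * E s) = W"
    using i0 i1 by (simp add: W_def)
  have "(LINT s|lborel. s\<^sup>2 * E s) \<le> (LINT s|lborel. s * sinh s * E s)"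
  proof (rule integral_mono[OF i2 i1])
    fix s :: real
    have "s\<^sup>2 \<le> s * sinh s"
    proof -
      have "\<bar>s\<bar> * \<bar>s\<bar> \<le> \<bar>s\<bar> * \<bar>sinh s\<bar>" by (intro mult_left_mono abs_le_abs_sinh) simp
      moreover have "s * sinh s \<ge> 0" by (cases "s \<ge> 0") (auto intro: mult_nonpos_nonpos)
      ultimately show ?thesis by (simp add: abs_mult[symmetric] power2_eq_square)
    qed
    then show "s\<^sup>2 * E s \<le> s * sinh s * E s" by (intro mult_right_mono) (auto simp: E_def)
  qed
  then have "z * (LINT s|lborel. s\<^sup>2 * E s) \<le> W"
    using z parts by (metis mult_left_mono less_eq_real_def)
  then have S: "(LINT s|lborel. s\<^sup>2 * E s) \<le> W / z" using z by (simp add: field_simps)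
  have "W - \<nu>\<^sup>2 / 2 * (W / z) \<le> W - \<nu>\<^sup>2 / 2 * (LINT s|lborel. s\<^sup>2 * E s)"
    using S by (intro diff_left_mono mult_left_mono) auto
  also have "\<dots> = (LINT s|lborel. 1 * E s - \<nu>\<^sup>2 / 2 * (s\<^sup>2 * E s))"
    using i0 i2 by (simp add: W_def)
  also have "\<dots> \<le> macdonald \<nu> 0 z"
    unfolding macdonald_def
  proof (rule integral_mono)
    show "integrable lborel (\<lambda>s. 1 * E s - \<nu>\<^sup>2 / 2 * (s\<^sup>2 * E s))"
      by (intro Bochner_Integration.integrable_diff integrable_mult_right i0 i2)
    show "integrable lborel (\<lambda>s. ((- cosh s) ^ 0 * cos (\<nu> * s)) * exp (- (z * cosh s)))"
      by (rule macdonald_integrable[OF z(1)])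
    fix s
    have "(1 - \<nu>\<^sup>2 / 2 * s\<^sup>2) * E s \<le> cos (\<nu> * s) * E s"
      using cos_ge_quadratic[of "\<nu> * s"] by (intro mult_right_mono) (auto simp: E_def power_mult_distrib)
    then show "1 * E s - \<nu>\<^sup>2 / 2 * (s\<^sup>2 * E s) \<le> ((- cosh s) ^ 0 * cos (\<nu> * s)) * exp (- (z * cosh s))"
      by (simp add: E_def algebra_simps)
  qed
  finally have "W * (1 - \<nu>\<^sup>2 / (2 * z)) \<le> macdonald \<nu> 0 z" by (simp add: algebra_simps)
  moreover have "W * (1 - \<nu>\<^sup>2 / (2 * z)) > 0" using W z by (intro mult_pos_pos) auto
  ultimately show ?thesis by simp
qed

subsection \<open>The decaying solution of the time equation\<close>

lemma A_int_eq:
  assumes "-1 < l" "t \<ge> 0"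
  shows "A_int l t = ((1 + t) powr (l + 1) - 1) / (l + 1)"
proof -
  have "((\<lambda>s. (1 + s) powr l) has_integral
      (1 + t) powr (l + 1) / (l + 1) - (1 + 0) powr (l + 1) / (l + 1)) {0..t}"
    using assms by (intro fundamental_theorem_of_calculus)
      (auto intro!: derivative_eq_intros simp: has_real_derivative_iff_has_vector_derivative[symmetric])
  then show ?thesis unfolding A_int_def by (simp add: integral_unique diff_divide_distrib)
qed

lemma A_int_nonneg: "-1 < l \<Longrightarrow> t \<ge> 0 \<Longrightarrow> A_int l t \<ge> 0"
  by (simp add: A_int_eq ge_one_powr_ge_zero)

text \<open>The exponential rate is that of exp(-Z), because Z = kappa/m + kappa A(t). The Macdonald
  decay Z^(-1/2) combined with (1 + t)^(1/2) gives (1 + t)^(-l/2); a derivative costs a factor of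
  order Z' = kappa (1 + t)^l, hence (1 + t)^(l/2).\<close>

lemma time_factor_exists:
  fixes l \<mu> :: real
  assumes \<mu>: "\<mu>\<^sup>2 > 1 / 4" and l: "-1 < l" "l < 0"
  obtains \<kappa> C b b1 where "\<kappa> > 0" "C > 0" "smooth_on {0..} b"
    "\<And>t. t \<ge> 0 \<Longrightarrow> (b has_real_derivative b1 t) (at t within {0..})"
    "\<And>t. t \<ge> 0 \<Longrightarrow>
      (b1 has_real_derivative (\<kappa>\<^sup>2 * (1 + t) powr (2 * l) - \<mu>\<^sup>2 / (1 + t)\<^sup>2) * b t) (at t within {0..})"
    "\<And>t. t \<ge> 0 \<Longrightarrow> b t > 0" "b1 0 < 0"
    "\<And>t. t \<ge> 0 \<Longrightarrow> b t \<le> C * (1 + t) powr (- l / 2) * exp (- \<kappa> * A_int l t)"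
    "\<And>t. t \<ge> 0 \<Longrightarrow> \<bar>b1 t\<bar> \<le> C * (1 + t) powr (l / 2) * exp (- \<kappa> * A_int l t)"
proof -
  define m where "m = l + 1"
  have m: "0 < m" "m < 1" using l by (auto simp: m_def)
  define \<nu> where "\<nu> = sqrt (\<mu>\<^sup>2 - 1/4) / m"
  have \<nu>: "m\<^sup>2 * \<nu>\<^sup>2 = \<mu>\<^sup>2 - 1/4" using \<mu> m by (simp add: \<nu>_def power_divide)
  \<comment> \<open>The summand |mu| makes the coefficient kappa^2 (1 + t)^(2l) - mu^2/(1 + t)^2
    nonnegative, so that b is convex. The other one gives Z >= nu^2 + 1, which serves both
    positivity and the bounds for arguments at least 1.\<close>
  define \<kappa> where "\<kappa> = \<bar>\<mu>\<bar> + m * (\<nu>\<^sup>2 + 1)"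
  have "m * (\<nu>\<^sup>2 + 1) > 0" using m by (intro mult_pos_pos add_nonneg_pos) auto
  then have \<kappa>0: "\<kappa> > 0" by (simp add: \<kappa>_def)
  have \<kappa>\<mu>: "\<bar>\<mu>\<bar> \<le> \<kappa>" using m by (simp add: \<kappa>_def)
  have \<kappa>m: "\<nu>\<^sup>2 + 1 \<le> \<kappa> / m" using m by (simp add: \<kappa>_def field_simps)
  define Z where "Z t = \<kappa> / m * (1 + t) powr m" for t
  define K where "K j t = macdonald \<nu> j (Z t)" for j t
  define b where "b t = (1 + t) powr (1/2) * K 0 t" for t
  define b1 where "b1 t = (1 + t) powr (-1/2) * (K 0 t / 2 + m * Z t * K 1 t)" for t
  have Zge: "Z t \<ge> \<nu>\<^sup>2 + 1" if "t \<ge> 0" for t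
  proof -
    have "\<nu>\<^sup>2 + 1 \<le> \<kappa> / m * 1" using \<kappa>m by simp
    also have "\<dots> \<le> Z t" unfolding Z_def using that m \<kappa>0
      by (intro mult_left_mono) (auto intro: ge_one_powr_ge_zero)
    finally show ?thesis .
  qed
  have Zpos: "Z t > 0" if "t > -1" for t
    unfolding Z_def using that m \<kappa>0 by (intro mult_pos_pos divide_pos_pos) auto
  have DZ: "(Z has_real_derivative m * Z t / (1 + t)) (at t)" if "t > -1" for t
  proof -
    have "(Z has_real_derivative \<kappa> / m * (m * (1 + t) powr (m - 1))) (at t)"
      unfolding Z_def[abs_def] using that by (auto intro!: derivative_eq_intros)
    moreover have "(1 + t) powr (m - 1) = (1 + t) powr m / (1 + t)"
      using that by (simp add: powr_diff)
    ultimately show ?thesis using m by (simp add: Z_def)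
  qed
  have DK: "(K j has_real_derivative K (Suc j) t * (m * Z t / (1 + t))) (at t)" if "t > -1" for j t
    unfolding K_def[abs_def] using that
    by (intro DERIV_chain2[OF macdonald_has_derivative DZ] Zpos) auto
  have Db: "(b has_real_derivative b1 t) (at t)" if t: "t > -1" for t
  proof -
    have p: "(1 + t) powr (1/2) = (1 + t) * (1 + t) powr (-1/2)"
      using t powr_add[of "1 + t" 1 "-1/2"] by simp
    have "(b has_real_derivative 1/2 * (1 + t) powr (-1/2) * K 0 t
        + K 1 t * (m * Z t / (1 + t)) * (1 + t) powr (1/2)) (at t)"
      unfolding b_def[abs_def] using t DK[OF t, of 0]
      by (auto intro!: derivative_eq_intros)
    also have "1/2 * (1 + t) powr (-1/2) * K 0 t
        + K 1 t * (m * Z t / (1 + t)) * (1 + t) powr (1/2) = b1 t"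
    proof -
      have "K 1 t * (m * Z t / (1 + t)) * ((1 + t) * (1 + t) powr (-1/2))
          = K 1 t * (m * Z t) * (1 + t) powr (-1/2)" using t by simp
      then show ?thesis unfolding p b1_def by (simp add: distrib_left mult_ac)
    qed
    finally show ?thesis .
  qed
  have Db1: "(b1 has_real_derivative (\<kappa>\<^sup>2 * (1 + t) powr (2 * l) - \<mu>\<^sup>2 / (1 + t)\<^sup>2) * b t) (at t)"
    if t: "t > -1" for t
  proof -
    \<comment> \<open>All terms of b'' carry (1 + t)^(-3/2). Once it is factored out, the Macdonald
      equation applies to the bracket, and m^2 nu^2 + 1/4 = mu^2 produces the mass term.\<close>
    define w where "w = (1 + t) powr (-3/2)"
    have p1: "(1 + t) powr (-1/2) = (1 + t) * w"
      using t powr_add[of "1 + t" 1 "-3/2"] by (simp add: w_def)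
    have p2: "(1 + t) powr (1/2) = (1 + t)\<^sup>2 * w"
      using t powr_add[of "1 + t" 2 "-3/2"] by (simp add: w_def)
    have "(b1 has_real_derivative (-1/2 * w) * (K 0 t / 2 + m * Z t * K 1 t)
       + (K 1 t * (m * Z t / (1 + t)) / 2 + (m * (m * Z t / (1 + t)) * K 1 t
          + K 2 t * (m * Z t / (1 + t)) * (m * Z t))) * (1 + t) powr (-1/2)) (at t)"
      unfolding b1_def[abs_def]
    proof (intro DERIV_mult DERIV_add DERIV_cdivide DERIV_cmult DZ t)
      show "((\<lambda>t. (1 + t) powr (-1/2)) has_real_derivative -1/2 * w) (at t)"
        unfolding w_def using t by (auto intro!: derivative_eq_intros)
      show "(K 0 has_real_derivative K 1 t * (m * Z t / (1 + t))) (at t)"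
        using DK[OF t, of 0] by simp
      show "(K 1 has_real_derivative K 2 t * (m * Z t / (1 + t))) (at t)"
        using DK[OF t, of 1] by (simp add: numeral_2_eq_2)
    qed
    also have "(-1/2 * w) * (K 0 t / 2 + m * Z t * K 1 t)
       + (K 1 t * (m * Z t / (1 + t)) / 2 + (m * (m * Z t / (1 + t)) * K 1 t
          + K 2 t * (m * Z t / (1 + t)) * (m * Z t))) * (1 + t) powr (-1/2)
      = w * (m\<^sup>2 * ((Z t)\<^sup>2 * K 2 t + Z t * K 1 t) - K 0 t / 4)"
    proof -
      have t1: "y / (1 + t) * (1 + t) = y" for y using t by simp
      have q: "(K 1 t * q / 2 + (m * q * K 1 t + K 2 t * q * (m * Z t))) * ((1 + t) * w)
        = (q * (1 + t)) * (K 1 t / 2 + m * K 1 t + K 2 t * (m * Z t)) * w" for q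
        by (simp add: algebra_simps)
      have "(K 1 t * (m * Z t / (1 + t)) / 2 + (m * (m * Z t / (1 + t)) * K 1 t
          + K 2 t * (m * Z t / (1 + t)) * (m * Z t))) * ((1 + t) * w)
        = (m * Z t / (1 + t) * (1 + t)) * (K 1 t / 2 + m * K 1 t + K 2 t * (m * Z t)) * w"
        by (rule q)
      also have "\<dots> = m * Z t * (K 1 t / 2 + m * K 1 t + K 2 t * (m * Z t)) * w"
        unfolding t1 ..
      finally show ?thesis unfolding p1 by (simp add: algebra_simps power2_eq_square)
    qed
    also have "(Z t)\<^sup>2 * K 2 t + Z t * K 1 t = ((Z t)\<^sup>2 - \<nu>\<^sup>2) * K 0 t"
      unfolding K_def by (rule macdonald_ode[OF Zpos[OF t]])
    also have "w * (m\<^sup>2 * (((Z t)\<^sup>2 - \<nu>\<^sup>2) * K 0 t) - K 0 t / 4)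
      = w * (m\<^sup>2 * (Z t)\<^sup>2 - m\<^sup>2 * \<nu>\<^sup>2 - 1/4) * K 0 t"
      by (simp add: algebra_simps)
    also have "\<dots> = w * (\<kappa>\<^sup>2 * ((1 + t) powr (2 * l) * (1 + t)\<^sup>2) - \<mu>\<^sup>2) * K 0 t"
    proof -
      have "m\<^sup>2 * (Z t)\<^sup>2 = \<kappa>\<^sup>2 * ((1 + t) powr m * (1 + t) powr m)"
        using m by (simp add: Z_def power_mult_distrib power_divide power2_eq_square)
      also have "(1 + t) powr m * (1 + t) powr m = (1 + t) powr (2 * l) * (1 + t)\<^sup>2"
        using t powr_add[of "1 + t" "2 * l" 2] by (simp add: powr_add[symmetric] m_def)
      finally show ?thesis unfolding \<nu> by simp
    qed
    also have "\<dots> = (\<kappa>\<^sup>2 * (1 + t) powr (2 * l) - \<mu>\<^sup>2 / (1 + t)\<^sup>2) * b t"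
      unfolding b_def p2 using t by (simp add: field_simps)
    finally show ?thesis .
  qed
  have bpos: "b t > 0" if "t \<ge> 0" for t
  proof -
    have "Z t > 0" "\<nu>\<^sup>2 < 2 * Z t" using Zge[OF that] zero_le_power2[of \<nu>] by linarith+
    then show ?thesis
      unfolding b_def K_def using that by (intro mult_pos_pos macdonald_pos) auto
  qed
  obtain C0 where C0: "C0 > 0"
    "\<And>\<nu> j z. j \<le> 1 \<Longrightarrow> z \<ge> 1 \<Longrightarrow> \<bar>macdonald \<nu> j z\<bar> \<le> C0 / sqrt z * exp (- z)"
    using macdonald_bound by blast
  define \<Theta> where "\<Theta> = \<kappa> / m"
  have \<Theta>: "\<Theta> \<ge> 1" using \<kappa>m zero_le_power2[of \<nu>] unfolding \<Theta>_def by linarith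
  define e where "e t = exp (- \<kappa> * A_int l t)" for t
  have A: "A_int l t = ((1 + t) powr m - 1) / m" if "t \<ge> 0" for t
    unfolding A_int_eq[OF l(1) that] m_def ..
  have expZ: "exp (- Z t) \<le> e t" if "t \<ge> 0" for t
  proof -
    have "Z t = \<Theta> + \<kappa> * A_int l t"
      unfolding A[OF that] using m by (simp add: Z_def \<Theta>_def field_simps)
    then show ?thesis using \<Theta> by (simp add: e_def)
  qed
  have sqrtZ: "sqrt (Z t) = sqrt \<Theta> * (1 + t) powr (m/2)" if "t \<ge> 0" for t
  proof -
    have "sqrt ((1 + t) powr m) = (1 + t) powr (m/2)"
      using that by (simp add: powr_half_sqrt[symmetric] powr_powr)
    then show ?thesis unfolding Z_def \<Theta>_def real_sqrt_mult by (simp only:)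
  qed
  have Z1: "Z t \<ge> 1" if "t \<ge> 0" for t
    using Zge[OF that] zero_le_power2[of \<nu>] by linarith
  have Kle: "\<bar>K j t\<bar> \<le> C0 / sqrt (Z t) * e t" if "t \<ge> 0" "j \<le> 1" for j t
  proof -
    have "\<bar>K j t\<bar> \<le> C0 / sqrt (Z t) * exp (- Z t)"
      unfolding K_def using that Z1 by (intro C0)
    also have "\<dots> \<le> C0 / sqrt (Z t) * e t"
      using that expZ C0(1) Z1[OF that(1)] by (intro mult_left_mono) auto
    finally show ?thesis .
  qed
  have e0: "e t \<ge> 0" for t by (simp add: e_def)
  define C where "C = C0 + (1 + m) * sqrt \<Theta> * C0"
  have CC: "C0 \<le> C" "(1 + m) * sqrt \<Theta> * C0 \<le> C"
    using C0(1) m \<Theta> by (auto simp: C_def intro!: mult_nonneg_nonneg)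
  have Cpos: "C > 0" using CC C0 by linarith
  have b_le: "b t \<le> C * (1 + t) powr (- l / 2) * e t" if t: "t \<ge> 0" for t
  proof -
    have "(1 + t) powr (m/2) \<le> sqrt (Z t)"
      unfolding sqrtZ[OF t] using \<Theta> t by (simp add: mult_le_cancel_right1)
    then have "C0 / sqrt (Z t) \<le> C0 / (1 + t) powr (m/2)"
      using t C0(1) Z1[OF t] by (intro divide_left_mono) auto
    then have "\<bar>K 0 t\<bar> \<le> C0 / (1 + t) powr (m/2) * e t"
      using Kle[OF t, of 0] mult_right_mono[OF _ e0] by (meson order_trans zero_le)
    then have "b t \<le> (1 + t) powr (1/2) * (C0 / (1 + t) powr (m/2) * e t)"
      unfolding b_def by (intro mult_left_mono) auto
    also have "\<dots> = C0 * ((1 + t) powr (1/2) / (1 + t) powr (m/2)) * e t" by simp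
    also have "(1 + t) powr (1/2) / (1 + t) powr (m/2) = (1 + t) powr (- l / 2)"
      using t by (simp add: powr_diff[symmetric] m_def field_simps)
    also have "C0 * (1 + t) powr (- l / 2) * e t \<le> C * (1 + t) powr (- l / 2) * e t"
      using CC e0 by (intro mult_right_mono) auto
    finally show ?thesis .
  qed
  have b1_le: "\<bar>b1 t\<bar> \<le> C * (1 + t) powr (l / 2) * e t" if t: "t \<ge> 0" for t
  proof -
    define Q where "Q = C0 / sqrt (Z t) * e t"
    have Q0: "Q \<ge> 0" using C0(1) Z1[OF t] e0 by (simp add: Q_def)
    have "\<bar>K 0 t / 2 + m * Z t * K 1 t\<bar> \<le> \<bar>K 0 t\<bar> / 2 + m * Z t * \<bar>K 1 t\<bar>"
      using abs_triangle_ineq[of "K 0 t / 2" "m * Z t * K 1 t"] m Z1[OF t] by (simp add: abs_mult)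
    also have "\<dots> \<le> Q / 2 + m * Z t * Q"
      using Kle[OF t] m Z1[OF t] by (intro add_mono divide_right_mono mult_left_mono) (auto simp: Q_def)
    also have "\<dots> \<le> Z t * Q + m * Z t * Q"
      using mult_right_mono[OF Z1[OF t] Q0] Q0 by simp
    also have "\<dots> = (1 + m) * C0 * (Z t / sqrt (Z t)) * e t" by (simp add: Q_def algebra_simps add_divide_distrib)
    also have "Z t / sqrt (Z t) = sqrt \<Theta> * (1 + t) powr (m/2)"
      using Z1[OF t] real_div_sqrt[of "Z t"] unfolding sqrtZ[OF t, symmetric] by simp
    finally have "\<bar>b1 t\<bar> \<le> (1 + t) powr (-1/2) * ((1 + m) * C0 * (sqrt \<Theta> * (1 + t) powr (m/2)) * e t)"
      unfolding b1_def abs_mult[of "(1 + t) powr (-1/2)"] by (simp add: mult_left_mono)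
    also have "\<dots> = ((1 + m) * sqrt \<Theta> * C0) * ((1 + t) powr (m/2) * (1 + t) powr (-1/2)) * e t" by simp
    also have "(1 + t) powr (m/2) * (1 + t) powr (-1/2) = (1 + t) powr (l / 2)"
      by (simp add: powr_add[symmetric] m_def field_simps)
    also have "((1 + m) * sqrt \<Theta> * C0) * (1 + t) powr (l / 2) * e t \<le> C * (1 + t) powr (l / 2) * e t"
      using CC e0 by (intro mult_right_mono) auto
    finally show ?thesis .
  qed
  \<comment> \<open>If b'(0) >= 0, then convexity keeps b' nonnegative and b(t) >= b(0) > 0 for all
    t, contradicting the decay of b.\<close>
  have b1_neg: "b1 0 < 0"
  proof (rule ccontr)
    assume "\<not> b1 0 < 0"
    have b1_nonneg: "b1 t \<ge> 0" if "t \<ge> 0" for t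
    proof -
      have "b1 0 \<le> b1 t"
      proof (rule DERIV_nonneg_imp_nondecreasing[OF that])
        fix s :: real assume s: "0 \<le> s" "s \<le> t"
        have "\<mu>\<^sup>2 / (1 + s)\<^sup>2 \<le> \<kappa>\<^sup>2 * (1 + s) powr (2 * l)"
        proof -
          have "\<mu>\<^sup>2 / (1 + s)\<^sup>2 = \<mu>\<^sup>2 * (1 + s) powr (- 2)"
            using s by (simp add: powr_minus divide_inverse)
          also have "\<dots> \<le> \<kappa>\<^sup>2 * (1 + s) powr (2 * l)"
            using s l \<kappa>\<mu> \<kappa>0 by (intro mult_mono powr_mono) (auto simp: abs_le_square_iff[symmetric])
          finally show ?thesis .
        qed
        then have "(\<kappa>\<^sup>2 * (1 + s) powr (2 * l) - \<mu>\<^sup>2 / (1 + s)\<^sup>2) * b s \<ge> 0"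
          using bpos[OF s(1)] by (intro mult_nonneg_nonneg) auto
        with Db1[of s] s show "\<exists>y. (b1 has_real_derivative y) (at s) \<and> 0 \<le> y" by auto
      qed
      with \<open>\<not> b1 0 < 0\<close> show ?thesis by simp
    qed
    have mono: "b 0 \<le> b t" if "t \<ge> 0" for t
    proof (rule DERIV_nonneg_imp_nondecreasing[OF that])
      fix s :: real assume "0 \<le> s" "s \<le> t"
      with Db[of s] b1_nonneg[of s] show "\<exists>y. (b has_real_derivative y) (at s) \<and> 0 \<le> y" by auto
    qed
    have "((\<lambda>t. C * (1 + t) powr (- l / 2) * exp (- \<kappa> * (((1 + t) powr m - 1) / m))) \<longlongrightarrow> 0) at_top"
      using m \<kappa>0 l Cpos by real_asymp
    then have "eventually (\<lambda>t. C * (1 + t) powr (- l / 2) * exp (- \<kappa> * (((1 + t) powr m - 1) / m)) < b 0) at_top"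
      using bpos[of 0] by (intro order_tendstoD) auto
    from eventually_happens'[OF _ eventually_conj[OF this eventually_ge_at_top[of 0]]]
    obtain t where "t \<ge> 0" "C * (1 + t) powr (- l / 2) * exp (- \<kappa> * (((1 + t) powr m - 1) / m)) < b 0"
      by auto
    with b_le[of t] mono[of t] show False by (simp add: e_def A)
  qed
  have "smooth_on {0..} b"
  proof -
    have sm: "smooth_on {0..} (\<lambda>t::real. (1 + t) powr r)" for r
    proof (rule smooth_on_compose[OF fat_atLeast fat_greaterThan[of 0] smooth_on_powr])
      show "smooth_on {0..} (\<lambda>t::real. 1 + t)"
        by (rule smooth_on_add[OF fat_atLeast smooth_on_const[OF fat_atLeast]
              smooth_on_bounded_linear[OF fat_atLeast bounded_linear_ident]])
    qed auto
    have smZ: "smooth_on {0..} Z"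
      unfolding Z_def[abs_def] by (intro smooth_on_mult fat_atLeast smooth_on_const sm)
    have "smooth_on {0..} (\<lambda>t. macdonald \<nu> 0 (Z t))"
      using Zpos by (intro smooth_on_compose[OF fat_atLeast fat_greaterThan smooth_on_macdonald smZ]) force
    then show ?thesis unfolding b_def[abs_def] K_def by (intro smooth_on_mult fat_atLeast sm)
  qed
  with \<kappa>0 Cpos show thesis
    by (rule that) (use Db Db1 bpos b1_neg b_le b1_le in
        \<open>auto simp: e_def intro: has_field_derivative_at_within\<close>)
qed

subsection \<open>Lebesgue integrals on space-time\<close>

text \<open>The complement is a union of balls on each of which \<open>h\<close> vanishes almost
  everywhere; by the Lindelof property countably many of them suffice.\<close>

lemma AE_not_in_ess_support: "AE x in lebesgue. x \<notin> ess_support h \<longrightarrow> h x = 0"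
proof -
  define \<F> where "\<F> = {ball x r | x r. r > 0 \<and> (AE y in lebesgue. y \<in> ball x r \<longrightarrow> h y = 0)}"
  have "\<And>S. S \<in> \<F> \<Longrightarrow> open S" by (auto simp: \<F>_def)
  from Lindelof[OF this] obtain \<F>' where \<F>': "\<F>' \<subseteq> \<F>" "countable \<F>'" "\<Union>\<F>' = \<Union>\<F>" by metis
  have "AE y in lebesgue. \<forall>S\<in>\<F>'. y \<in> S \<longrightarrow> h y = 0"
    using \<F>' by (subst AE_ball_countable) (auto simp: \<F>_def)
  then show ?thesis
  proof eventually_elim
    case (elim y)
    have "y \<in> \<Union>\<F>" if "y \<notin> ess_support h"
    proof -
      from that obtain r where r: "r > 0" "AE z in lebesgue. z \<in> ball y r \<longrightarrow> h z = 0"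
        by (auto simp: ess_support_def)
      then have "ball y r \<in> \<F>" unfolding \<F>_def by blast
      with r(1) show ?thesis by (meson UnionI centre_in_ball)
    qed
    with elim \<F>'(3) show ?case by (metis UnionE)
  qed
qed

text \<open>Fubini holds for the Borel product measure, whereas \<open>F\<close> is measurable only
  for its completion. So \<open>F\<close> is replaced by a Borel function off a Borel null set
  \<open>N\<close>, almost all of whose time slices are null.\<close>

lemma lebesgue_fubini:
  fixes F :: "'a::euclidean_space \<times> 'b::euclidean_space \<Rightarrow> real"
  assumes F: "integrable lebesgue F"
  shows "integrable lebesgue (\<lambda>t. LINT x|lebesgue. F (x, t))"
    and "(LINT t|lebesgue. LINT x|lebesgue. F (x, t)) = (LINT z|lebesgue. F z)"
proof -
  obtain F' where F'[measurable]: "F' \<in> borel_measurable lborel" and eq: "AE z in lborel. F z = F' z"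
    using completion_ex_borel_measurable_real[OF borel_measurable_integrable[OF F]] by blast
  have eq': "AE z in lebesgue. F z = F' z" by (rule AE_completion[OF eq])
  have F'm: "F' \<in> borel_measurable lebesgue" by (rule measurable_completion[OF F'])
  have "integrable lebesgue F'"
    using F eq' F'm by (subst integrable_cong_AE[symmetric]) auto
  then have int': "integrable (lborel \<Otimes>\<^sub>M lborel) F'"
    using F' by (simp add: integrable_completion lborel_prod)
  have "(LINT z|lebesgue. F z) = (LINT z|lebesgue. F' z)"
    using F eq' F'm by (intro integral_cong_AE) auto
  also have "\<dots> = (LINT z|(lborel \<Otimes>\<^sub>M lborel). F' z)"
    using F' by (simp add: integral_completion lborel_prod)
  also have "\<dots> = (LINT t|lborel. LINT x|lborel. F' (x, t))"
    using lborel_pair.integral_snd[of "\<lambda>x t. F' (x, t)"] int' by (simp add: case_prod_unfold)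
  finally have I: "(LINT z|lebesgue. F z) = (LINT t|lborel. LINT x|lborel. F' (x, t))" .
  obtain N where N: "N \<in> null_sets lborel" "{z. F z \<noteq> F' z} \<subseteq> N"
    using eq by (auto elim!: AE_E simp: null_sets_def)
  have "AE z in (lborel :: 'a measure) \<Otimes>\<^sub>M (lborel :: 'b measure). z \<notin> N"
    unfolding lborel_prod by (rule AE_not_in[OF N(1)])
  then have "AE x in (lborel :: 'a measure). AE t in (lborel :: 'b measure). (x, t) \<notin> N"
    by (rule lborel_pair.AE_pair)
  \<comment> \<open>Slicing gives the quantifiers in the order x, t; measurability of
    \<open>N\<close> allows them to be exchanged.\<close>
  moreover have "{z \<in> space ((lborel :: 'a measure) \<Otimes>\<^sub>M (lborel :: 'b measure)). (fst z, snd z) \<notin> N}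
      \<in> sets (lborel \<Otimes>\<^sub>M lborel)"
  proof -
    have "N \<in> sets (lborel :: ('a \<times> 'b) measure)" using N(1) by auto
    then have "space (lborel :: ('a \<times> 'b) measure) - N \<in> sets (lborel :: ('a \<times> 'b) measure)"
      by (rule sets.compl_sets)
    then show ?thesis unfolding lborel_prod by (simp add: set_diff_eq)
  qed
  ultimately have "AE t in (lborel :: 'b measure). AE x in (lborel :: 'a measure). (x, t) \<notin> N"
    using lborel_pair.AE_commute[of "\<lambda>x t. (x, t) \<notin> N"] by simp
  then have AE: "AE t in (lborel :: 'b measure). (LINT x|lebesgue. F (x, t)) = (LINT x|lborel. F' (x, t))"
  proof eventually_elim
    case (elim t)
    have m: "(\<lambda>x. F' (x, t)) \<in> borel_measurable lborel"
      using F' by (simp add: measurable_lborel2) measurable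
    have ae: "AE x in lebesgue. F (x, t) = F' (x, t)"
      using AE_completion[OF elim] by eventually_elim (use N(2) in auto)
    then have ae': "AE x in lebesgue. F' (x, t) = F (x, t)" by eventually_elim simp
    have m': "(\<lambda>x. F' (x, t)) \<in> borel_measurable lebesgue" by (rule measurable_completion[OF m])
    from integral_cong_AE[OF borel_measurable_AE[OF m' ae'] m' ae]
    have "(LINT x|lebesgue. F (x, t)) = (LINT x|lebesgue. F' (x, t))" .
    then show ?case using m by (simp add: integral_completion)
  qed
  have outer: "integrable lborel (\<lambda>t. LINT x|lborel. F' (x, t))"
    using lborel_pair.integrable_snd[of "\<lambda>x t. F' (x, t)"] int' by (simp add: case_prod_unfold)
  then have outer': "integrable lebesgue (\<lambda>t. LINT x|lborel. F' (x, t))"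
    by (subst integrable_completion) auto
  have AE': "AE t in lebesgue. (LINT x|lborel. F' (x, t)) = (LINT x|lebesgue. F (x, t))"
    using AE_completion[OF AE] by eventually_elim simp
  have m: "(\<lambda>t. LINT x|lebesgue. F (x, t)) \<in> borel_measurable lebesgue"
    by (rule borel_measurable_AE[OF borel_measurable_integrable[OF outer'] AE'])
  note om = borel_measurable_integrable[OF outer']
  show "integrable lebesgue (\<lambda>t. LINT x|lebesgue. F (x, t))"
    using integrable_cong_AE[OF om m AE'] outer' by blast
  have "(LINT t|lebesgue. LINT x|lebesgue. F (x, t)) = (LINT t|lebesgue. LINT x|lborel. F' (x, t))"
    using integral_cong_AE[OF om m AE'] by (rule sym)
  also have "\<dots> = (LINT t|lborel. LINT x|lborel. F' (x, t))"
    using outer by (intro integral_completion) auto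
  finally show "(LINT t|lebesgue. LINT x|lebesgue. F (x, t)) = (LINT z|lebesgue. F z)"
    using I by simp
qed

lemma L1_loc_measurable:
  assumes "L1_loc h"
  shows "h \<in> borel_measurable lebesgue"
proof (rule borel_measurable_LIMSEQ_real)
  show "(\<lambda>x. indicator (cball 0 (real k)) x *\<^sub>R h x) \<in> borel_measurable lebesgue" for k
    using assms by (intro borel_measurable_integrable) (auto simp: L1_loc_def set_integrable_def)
  show "(\<lambda>k. indicator (cball 0 (real k)) x *\<^sub>R h x) \<longlonglongrightarrow> h x" for x
  proof (rule tendsto_eventually)
    obtain N where "norm x \<le> real N" using real_arch_simple by blast
    then show "\<forall>\<^sub>F k in sequentially. indicator (cball 0 (real k)) x *\<^sub>R h x = h x"
      by (auto simp: eventually_sequentially intro!: exI[of _ N])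
  qed
qed

section \<open>Exponential weights on balls\<close>

lemma power_diff_le:
  fixes x y :: real
  assumes "0 \<le> y" "y \<le> x"
  shows "x ^ n - y ^ n \<le> real n * (x - y) * x ^ (n - 1)"
proof (cases n)
  case (Suc k)
  have "x ^ Suc k - y ^ Suc k = (x - y) * (\<Sum>i<Suc k. x ^ i * y ^ (k - i))"
    using power_diff_sumr2[of x "Suc k" y] by (simp add: mult.commute)
  also have "\<dots> \<le> (x - y) * (\<Sum>i<Suc k. x ^ k)"
  proof (intro mult_left_mono sum_mono)
    fix i assume "i \<in> {..<Suc k}"
    then have "x ^ i * y ^ (k - i) \<le> x ^ i * x ^ (k - i)"
      using assms by (intro mult_left_mono power_mono) auto
    also have "\<dots> = x ^ k" using \<open>i \<in> _\<close> by (simp add: power_add[symmetric])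
    finally show "x ^ i * y ^ (k - i) \<le> x ^ k" .
  qed (use assms in auto)
  finally show ?thesis by (simp add: Suc algebra_simps)
qed simp

text \<open>The weight decays exponentially away from the boundary sphere, so only a shell of bounded
  width counts.\<close>

lemma integral_exp_norm_ball:
  fixes b :: real
  assumes b: "b > 0"
  obtains C where "C > 0"
    "\<And>r. r \<ge> 0 \<Longrightarrow> (LINT x:ball (0::'a::euclidean_space) r|lebesgue. exp (- b * (r - norm x)))
      \<le> C * (1 + r) ^ (DIM('a) - 1)"
proof -
  define n where "n = DIM('a)"
  define V where "V = unit_ball_vol (real n)"
  have V: "V > 0" by (simp add: V_def unit_ball_vol_pos)
  have n: "n \<ge> 1" by (simp add: n_def Suc_leI)
  have eb: "0 < exp (- b)" "exp (- b) < 1" using b by auto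
  show thesis
  proof (rule that)
    show "V * real n / (1 - exp (- b)) > 0" using V n eb by simp
    fix r :: real assume r: "r \<ge> 0"
    define shell where "shell i = cball (0::'a) (r - real i) - cball 0 (r - real i - 1)" for i
    have shell_fm: "shell i \<in> lmeasurable" for i
      unfolding shell_def by (intro fmeasurable_Diff lmeasurable_cball) auto
    have shell_int: "integrable lebesgue (indicator (shell i) :: 'a \<Rightarrow> real)" for i
      using shell_fm[of i] by (simp only: lmeasurable_iff_integrable)
    have shell: "measure lebesgue (shell i) \<le> V * real n * (1 + r) ^ (n - 1)" for i
    proof (cases "r - real i \<ge> 0")
      case False
      then show ?thesis using V r by (simp add: shell_def)
    next
      case True
      define x where "x = r - real i"
      \<comment> \<open>A ball of negative radius is empty, while the volume formula would give a
        power of a negative number; hence the truncation at 0.\<close>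
      define y where "y = max 0 (x - 1)"
      have xy: "0 \<le> y" "y \<le> x" "x - y \<le> 1" "x \<le> 1 + r" using True by (auto simp: x_def y_def)
      have c: "measure lborel (cball (0::'a) s) = V * s ^ n" if "s \<ge> 0" for s
        using content_cball[OF that, of "0::'a"] by (simp add: V_def n_def)
      have "measure lebesgue (shell i) = measure lebesgue (cball (0::'a) x) - measure lebesgue (cball (0::'a) (x - 1))"
        unfolding shell_def x_def by (intro measurable_measure_Diff) auto
      also have "measure lebesgue (cball (0::'a) (x - 1)) = V * y ^ n"
        using c[of "x - 1"] n by (cases "x - 1 \<ge> 0") (auto simp: y_def max_def)
      also have "measure lebesgue (cball (0::'a) x) = V * x ^ n"
        using c[of x] True by (simp add: x_def)
      also have "V * x ^ n - V * y ^ n = V * (x ^ n - y ^ n)" by (simp add: algebra_simps)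
      also have "\<dots> \<le> V * (real n * 1 * (1 + r) ^ (n - 1))"
      proof (intro mult_left_mono)
        have "x ^ n - y ^ n \<le> real n * (x - y) * x ^ (n - 1)" by (rule power_diff_le[OF xy(1,2)])
        also have "\<dots> \<le> real n * 1 * (1 + r) ^ (n - 1)"
          using xy by (intro mult_mono power_mono) auto
        finally show "x ^ n - y ^ n \<le> real n * 1 * (1 + r) ^ (n - 1)" .
      qed (use V in auto)
      finally show ?thesis by simp
    qed
    obtain N :: nat where N: "r < real N" using reals_Archimedean2 by blast
    have "(LINT x:ball (0::'a) r|lebesgue. exp (- b * (r - norm x)))
        \<le> (LINT x|lebesgue. (\<Sum>i<N. exp (- b) ^ i * indicator (shell i) x))"
      unfolding set_lebesgue_integral_def
    proof (rule integral_mono')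
      show "integrable lebesgue (\<lambda>x. \<Sum>i<N. exp (- b) ^ i * indicator (shell i) x)"
        by (intro Bochner_Integration.integrable_sum integrable_mult_right shell_int)
      fix x :: 'a
      show "indicator (ball 0 r) x *\<^sub>R exp (- b * (r - norm x)) \<le> (\<Sum>i<N. exp (- b) ^ i * indicator (shell i) x)"
      proof (cases "x \<in> ball 0 r")
        case True
        define i where "i = nat \<lfloor>r - norm x\<rfloor>"
        have i: "real i \<le> r - norm x" "r - norm x < real i + 1"
          using True by (auto simp: i_def)
        then have "x \<in> shell i" by (auto simp: shell_def)
        have "real i < real N" using i(1) N norm_ge_zero[of x] by linarith
        then have "i < N" by simp
        have "exp (- b * (r - norm x)) \<le> exp (- b * real i)" using i b by simp
        also have "\<dots> = exp (- b) ^ i * indicator (shell i) x"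
          using \<open>x \<in> shell i\<close> by (simp add: exp_of_nat_mult[symmetric] mult.commute)
        also have "\<dots> \<le> (\<Sum>i<N. exp (- b) ^ i * indicator (shell i) x)"
          using \<open>i < N\<close> by (intro member_le_sum) auto
        finally show ?thesis using True by simp
      qed (auto intro!: sum_nonneg)
      show "0 \<le> (\<Sum>i<N. exp (- b) ^ i * indicator (shell i) x)" by (auto intro!: sum_nonneg)
    qed
    also have "\<dots> = (\<Sum>i<N. exp (- b) ^ i * measure lebesgue (shell i))"
      using shell_int by (subst Bochner_Integration.integral_sum) auto
    also have "\<dots> \<le> (\<Sum>i<N. exp (- b) ^ i * (V * real n * (1 + r) ^ (n - 1)))"
      by (intro sum_mono mult_left_mono shell) auto
    also have "\<dots> = (\<Sum>i<N. exp (- b) ^ i) * (V * real n * (1 + r) ^ (n - 1))"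
      by (simp add: sum_distrib_right)
    also have "\<dots> \<le> 1 / (1 - exp (- b)) * (V * real n * (1 + r) ^ (n - 1))"
    proof (intro mult_right_mono)
      show "(\<Sum>i<N. exp (- b) ^ i) \<le> 1 / (1 - exp (- b))"
        using eb sum_le_suminf[OF summable_geometric, of "exp (- b)" "{..<N}"] suminf_geometric[of "exp (- b)"]
        by simp
    qed (use V r in auto)
    finally show "(LINT x:ball (0::'a) r|lebesgue. exp (- b * (r - norm x)))
        \<le> V * real n / (1 - exp (- b)) * (1 + r) ^ (DIM('a) - 1)" by (simp add: n_def)
  qed
qed

text \<open>With y = 1 + r - |x|, replacing (1 + |x|)^gamma by (1 + r)^gamma costs at most
  y^|gamma|; for negative gamma this is 1 + r <= (1 + |x|) y. Half of the exponential rate absorbs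
  the power of y, and the other half still confines the integral to a shell near the
  boundary.\<close>

lemma integral_powr_exp_norm_ball:
  fixes a \<gamma> :: real
  assumes a: "a > 0"
  obtains C where "C > 0"
    "\<And>r. r \<ge> 0 \<Longrightarrow> (LINT x:ball (0::'a::euclidean_space) r|lebesgue. (1 + norm x) powr \<gamma> * exp (a * norm x))
      \<le> C * (1 + r) powr (\<gamma> + real DIM('a) - 1) * exp (a * r)"
proof -
  obtain C where C: "C > 0"
    "\<And>r. r \<ge> 0 \<Longrightarrow> (LINT x:ball (0::'a) r|lebesgue. exp (- (a/2) * (r - norm x))) \<le> C * (1 + r) ^ (DIM('a) - 1)"
    using integral_exp_norm_ball[of "a/2", where 'a='a] a by auto
  obtain k :: nat where k: "\<bar>\<gamma>\<bar> \<le> real k" using real_arch_simple by blast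
  define B where "B = fact k / (a/2) ^ k * exp (a/2)"
  have B: "B > 0" using a by (simp add: B_def)
  show thesis
  proof
    show "B * C > 0" using B C by simp
    fix r :: real assume r: "r \<ge> 0"
    have pt: "(1 + norm x) powr \<gamma> * exp (a * norm x)
        \<le> B * (1 + r) powr \<gamma> * exp (a * r) * exp (- (a/2) * (r - norm x))" if "norm x \<le> r" for x :: 'a
    proof -
      define y where "y = 1 + (r - norm x)"
      have y: "y \<ge> 1" using that by (simp add: y_def)
      have "(1 + norm x) powr \<gamma> \<le> (1 + r) powr \<gamma> * y powr \<bar>\<gamma>\<bar>"
      proof (cases "\<gamma> \<ge> 0")
        case True
        have "(1 + norm x) powr \<gamma> \<le> (1 + r) powr \<gamma> * 1"
          using True that by (simp add: powr_mono2)
        also have "\<dots> \<le> (1 + r) powr \<gamma> * y powr \<bar>\<gamma>\<bar>"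
          using y by (intro mult_left_mono ge_one_powr_ge_zero) auto
        finally show ?thesis .
      next
        case False
        have "1 + r \<le> (1 + norm x) * y" using that 
          using mult_nonneg_nonneg[of "norm x" "r - norm x"] by (simp add: y_def algebra_simps)
        then have "((1 + norm x) * y) powr \<gamma> \<le> (1 + r) powr \<gamma>"
          using False r by (intro powr_mono2') auto
        then have "(1 + norm x) powr \<gamma> * y powr \<gamma> * y powr \<bar>\<gamma>\<bar> \<le> (1 + r) powr \<gamma> * y powr \<bar>\<gamma>\<bar>"
          using y by (intro mult_right_mono) (auto simp: powr_mult)
        moreover have "y powr \<gamma> * y powr \<bar>\<gamma>\<bar> = 1"
          using False y by (simp add: powr_add[symmetric])
        ultimately show ?thesis by (simp add: mult.assoc)
      qed
      also have "y powr \<bar>\<gamma>\<bar> \<le> y powr real k" using y k by (intro powr_mono) auto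
      also have "y powr real k = y ^ k" using y by (simp add: powr_realpow)
      also have "y ^ k \<le> fact k / (a/2) ^ k * exp (a/2 * y)"
        using y a by (intro power_le_exp) auto
      also have "\<dots> = B * exp (a/2 * (r - norm x))"
        by (simp add: B_def y_def distrib_left mult_exp_exp)
      finally have "(1 + norm x) powr \<gamma> \<le> (1 + r) powr \<gamma> * (B * exp (a/2 * (r - norm x)))"
        by (simp add: mult_left_mono)
      then have "(1 + norm x) powr \<gamma> * exp (a * norm x)
          \<le> (1 + r) powr \<gamma> * (B * exp (a/2 * (r - norm x))) * exp (a * norm x)"
        by (intro mult_right_mono) auto
      also have "\<dots> = B * (1 + r) powr \<gamma> * (exp (a/2 * (r - norm x)) * exp (a * norm x))" by simp
      also have "exp (a/2 * (r - norm x)) * exp (a * norm x) = exp (a * r) * exp (- (a/2) * (r - norm x))"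
        by (simp add: mult_exp_exp field_simps)
      finally show ?thesis by (simp add: mult.assoc)
    qed
    have int: "set_integrable lebesgue (ball (0::'a) r) h" if "continuous_on UNIV h" for h :: "'a \<Rightarrow> real"
    proof -
      have "set_integrable lborel (cball (0::'a) r) h"
        unfolding set_integrable_def
        by (intro borel_integrable_compact continuous_on_subset[OF that] compact_cball) auto
      then have "set_integrable lborel (ball (0::'a) r) h" by (rule set_integrable_subset) auto
      then show ?thesis using integrable_completion unfolding set_integrable_def
        by (metis borel_measurable_integrable)
    qed
    have "(LINT x:ball (0::'a) r|lebesgue. (1 + norm x) powr \<gamma> * exp (a * norm x))
      \<le> (LINT x:ball (0::'a) r|lebesgue. B * (1 + r) powr \<gamma> * exp (a * r) * exp (- (a/2) * (r - norm x)))"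
      by (intro set_integral_mono int) (use pt in \<open>auto intro!: continuous_intros simp: add_nonneg_eq_0_iff\<close>)
    also have "\<dots> = B * (1 + r) powr \<gamma> * exp (a * r) * (LINT x:ball (0::'a) r|lebesgue. exp (- (a/2) * (r - norm x)))"
      by (rule set_integral_mult_right)
    also have "\<dots> \<le> B * (1 + r) powr \<gamma> * exp (a * r) * (C * (1 + r) ^ (DIM('a) - 1))"
      using B by (intro mult_left_mono C r) auto
    also have "\<dots> = B * C * ((1 + r) powr \<gamma> * (1 + r) powr (real DIM('a) - 1)) * exp (a * r)"
      using r by (simp add: powr_realpow[symmetric] of_nat_diff Suc_leI)
    also have "(1 + r) powr \<gamma> * (1 + r) powr (real DIM('a) - 1) = (1 + r) powr (\<gamma> + real DIM('a) - 1)"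
      by (simp add: powr_add[symmetric] add_diff_eq)
    finally show "(LINT x:ball (0::'a) r|lebesgue. (1 + norm x) powr \<gamma> * exp (a * norm x))
      \<le> B * C * (1 + r) powr (\<gamma> + real DIM('a) - 1) * exp (a * r)" .
  qed
qed

subsection \<open>The weak formulation with radial weights\<close>

definition light_cone :: "real \<Rightarrow> real \<Rightarrow> real \<Rightarrow> real \<Rightarrow> ((real ^ 'n) \<times> real) set" where
  "light_cone l R a b = {z. a \<le> snd z \<and> snd z \<le> b \<and> norm (fst z) < R + A_int l (snd z)}"

text \<open>A compact set containing the cone up to time \<open>T\<close>: integrability of u is
  available on compact sets.\<close>

definition cylinder :: "real \<Rightarrow> real \<Rightarrow> real \<Rightarrow> ((real ^ 'n) \<times> real) set" where
  "cylinder l R T = cball 0 (R + A_int l T) \<times> {0..T}"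

text \<open>The adjoint wave operator on \<open>radial \<alpha> \<psi>\<close>. The derivatives
  enter as parameters, and the hypotheses of later lemmas tie them to \<open>\<alpha>\<close> and
  \<open>\<psi>\<close>.\<close>

definition wave_adjoint ::
  "real \<Rightarrow> real \<Rightarrow> (real \<Rightarrow> real) \<Rightarrow> (real \<Rightarrow> real) \<Rightarrow> (real \<Rightarrow> real) \<Rightarrow> (real \<Rightarrow> real) \<Rightarrow> (real \<Rightarrow> real)
    \<Rightarrow> (real ^ 'n) \<times> real \<Rightarrow> real" where
  "wave_adjoint l \<mu> \<alpha> \<alpha>2 \<psi> \<psi>1 \<psi>2 z = radial \<alpha>2 \<psi> z
     - (1 + snd z) powr (2 * l) * radial \<alpha> (\<lambda>r. 4 * r * \<psi>2 r + 2 * real CARD('n) * \<psi>1 r) z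
     + \<mu>\<^sup>2 / (1 + snd z)\<^sup>2 * radial \<alpha> \<psi> z"

lemma A_int_mono: "-1 < l \<Longrightarrow> 0 \<le> s \<Longrightarrow> s \<le> t \<Longrightarrow> A_int l s \<le> A_int l t"
  by (simp add: A_int_eq divide_right_mono powr_mono2)

lemma cone_subset_cylinder:
  assumes "-1 < l" "0 \<le> a" "b \<le> T"
  shows "light_cone l R a b \<subseteq> cylinder l R T"
proof
  fix z :: "(real ^ 'n) \<times> real" assume z: "z \<in> light_cone l R a b"
  then have "A_int l (snd z) \<le> A_int l T" using assms by (intro A_int_mono) (auto simp: light_cone_def)
  with z show "z \<in> cylinder l R T" using assms by (auto simp: light_cone_def cylinder_def mem_Times_iff)
qed

lemma compact_cylinder: "compact (cylinder l R T)"
  by (simp add: cylinder_def compact_Times)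

lemma cone_borel:
  assumes "-1 < l" "0 \<le> a"
  shows "(light_cone l R a b :: ((real ^ 'n) \<times> real) set) \<in> sets borel"
proof -
  \<comment> \<open>The closed form of \<open>A_int\<close> makes measurability in time
    evident.\<close>
  have "(light_cone l R a b :: ((real ^ 'n) \<times> real) set) =
    {z. a \<le> snd z \<and> snd z \<le> b \<and> norm (fst z) < R + ((1 + snd z) powr (l + 1) - 1) / (l + 1)}"
    using assms by (auto simp: light_cone_def A_int_eq)
  also have "\<dots> = {z \<in> space borel. a \<le> snd z \<and> snd z \<le> b \<and> norm (fst z) < R + ((1 + snd z) powr (l + 1) - 1) / (l + 1)}"
    by simp
  also have "\<dots> \<in> sets borel"
  proof -
    have [measurable]: "(fst :: (real ^ 'n) \<times> real \<Rightarrow> _) \<in> borel_measurable borel"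
      "(snd :: (real ^ 'n) \<times> real \<Rightarrow> _) \<in> borel_measurable borel"
      by (auto intro!: borel_measurable_continuous_onI continuous_intros)
    show ?thesis by measurable
  qed
  finally show ?thesis .
qed

lemma set_integrable_mult_continuous:
  fixes v M :: "'a::euclidean_space \<Rightarrow> real"
  assumes v: "set_integrable lebesgue K v" and K: "compact K" and M: "continuous_on K M"
    and D: "D \<subseteq> K" "D \<in> sets borel"
  shows "set_integrable lebesgue D (\<lambda>z. v z * M z)"
proof -
  obtain B where B: "\<And>z. z \<in> K \<Longrightarrow> \<bar>M z\<bar> \<le> B"
    using compact_imp_bounded[OF compact_continuous_image[OF M K]] by (auto simp: bounded_iff)
  have Mm: "(\<lambda>z. indicator K z *\<^sub>R M z) \<in> borel_measurable lebesgue"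
    using borel_measurable_continuous_on_indicator[OF _ M] K
    by (intro measurable_completion) (auto intro: borel_closed compact_imp_closed)
  have vm: "(\<lambda>z. indicator K z *\<^sub>R v z) \<in> borel_measurable lebesgue"
    using v by (auto simp: set_integrable_def)
  have Dm: "D \<in> sets lebesgue" using D(2) by auto
  have eq: "indicator D z *\<^sub>R (v z * M z) = indicator D z * ((indicator K z *\<^sub>R v z) * (indicator K z *\<^sub>R M z))" for z
    using D(1) by (auto simp: indicator_def)
  show ?thesis
    unfolding set_integrable_def
  proof (rule Bochner_Integration.integrable_bound)
    show "integrable lebesgue (\<lambda>z. B * (indicator K z *\<^sub>R v z))"
      using v by (intro integrable_mult_right) (simp add: set_integrable_def)
    show "(\<lambda>z. indicator D z *\<^sub>R (v z * M z)) \<in> borel_measurable lebesgue"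
      unfolding eq using Mm vm Dm by measurable
    show "AE z in lebesgue. norm (indicator D z *\<^sub>R (v z * M z)) \<le> norm (B * (indicator K z *\<^sub>R v z))"
    proof (rule AE_I2)
      fix z
      show "norm (indicator D z *\<^sub>R (v z * M z)) \<le> norm (B * (indicator K z *\<^sub>R v z))"
      proof (cases "z \<in> D")
        case True
        then have z: "z \<in> K" using D by auto
        have "\<bar>v z\<bar> * \<bar>M z\<bar> \<le> \<bar>v z\<bar> * \<bar>B\<bar>" using B[OF z] by (intro mult_left_mono) auto
        then show ?thesis using True z by (simp add: abs_mult mult.commute)
      qed simp
    qed
  qed
qed

lemma integral_cong_AE_lebesgue:
  fixes h k :: "'a::euclidean_space \<Rightarrow> real"
  assumes "h \<in> borel_measurable lebesgue" "AE x in lebesgue. h x = k x"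
  shows "(LINT x|lebesgue. h x) = (LINT x|lebesgue. k x)"
  using integral_cong_AE[OF assms(1) borel_measurable_AE[OF assms] assms(2)] .

lemma deriv_eq_on_open:
  fixes F G :: "real \<Rightarrow> real"
  assumes "(F has_real_derivative F') (at x)" "(G has_real_derivative G') (at x)"
    and "open S" "x \<in> S" "\<And>y. y \<in> S \<Longrightarrow> F y = G y"
  shows "F' = G'"
  using DERIV_unique[OF has_field_derivative_transform_within_open[OF assms(1,3,4,5)] assms(2)] by blast

lemma smooth_on_UNIV_derivative:
  assumes "smooth_on UNIV (G :: real \<Rightarrow> real)"
  obtains G' where "\<And>x. (G has_real_derivative G' x) (at x)" "smooth_on UNIV G'"
proof -
  have "\<forall>x. \<exists>d. (G has_real_derivative d) (at x)"
    using smooth_on_imp_differentiable_on[OF assms]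
    by (auto simp: differentiable_on_def real_differentiable_def)
  then obtain G' where D: "\<And>x. (G has_real_derivative G' x) (at x)" by metis
  have "smooth_on UNIV G'"
    using smooth_on_derivative[OF fat_UNIV _ assms] D by blast
  with D show thesis by (rule that)
qed

lemma continuous_on_radial:
  fixes S :: "((real ^ 'n) \<times> real) set"
  assumes "continuous_on {0..} \<alpha>" "continuous_on UNIV \<psi>" "\<And>z. z \<in> S \<Longrightarrow> snd z \<ge> 0"
  shows "continuous_on S (radial \<alpha> \<psi>)"
  unfolding radial_def[abs_def]
  by (intro continuous_on_mult continuous_on_compose2[OF assms(1)] continuous_on_compose2[OF assms(2)]
      continuous_intros) (use assms(3) in force)+

lemma continuous_on_wave_adjoint:
  fixes S :: "((real ^ 'n) \<times> real) set"
  assumes "continuous_on {0..} \<alpha>" "continuous_on {0..} \<alpha>2"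
    and "continuous_on UNIV \<psi>" "continuous_on UNIV \<psi>1" "continuous_on UNIV \<psi>2"
    and S: "\<And>z. z \<in> S \<Longrightarrow> snd z \<ge> 0"
  shows "continuous_on S (wave_adjoint l \<mu> \<alpha> \<alpha>2 \<psi> \<psi>1 \<psi>2)"
proof -
  have "1 + snd z \<noteq> 0" if "z \<in> S" for z using S[OF that] by simp
  then show ?thesis
    unfolding wave_adjoint_def[abs_def]
    by (intro continuous_intros continuous_on_radial assms) auto
qed

lemma continuous_slice_measurable:
  fixes M :: "(real ^ 'n) \<times> real \<Rightarrow> real"
  assumes "continuous_on (UNIV \<times> {0..}) M" "t \<ge> 0"
  shows "(\<lambda>x. M (x, t)) \<in> borel_measurable lebesgue"
proof -
  have "continuous_on UNIV (\<lambda>x. M (x, t))"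
    by (rule continuous_on_compose2[OF assms(1)]) (use assms(2) in \<open>auto intro!: continuous_intros\<close>)
  then have "(\<lambda>x. M (x, t)) \<in> borel_measurable lborel"
    by (simp add: borel_measurable_continuous_onI)
  then show ?thesis by (rule measurable_completion)
qed

text \<open>The support condition holds for each time separately, up to null sets of x, so the
  restriction to the cone takes place in the inner integral and Fubini comes afterwards.
  \<open>M\<close> is an admissible integrand; \<open>N\<close> may be any continuous function that
  agrees with it on the cone, such as one without spatial cut-off.\<close>

lemma iterated_integral_cone:
  fixes v M N :: "(real ^ 'n) \<times> real \<Rightarrow> real"
  assumes l: "-1 < l" and T: "T \<ge> 0"
    and meas: "\<And>t. t \<ge> 0 \<Longrightarrow> (\<lambda>x. v (x, t)) \<in> borel_measurable lebesgue"
    and supp: "\<And>t. t \<ge> 0 \<Longrightarrow> AE x in lebesgue. norm x \<ge> R + A_int l t \<longrightarrow> v (x, t) = 0"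
    and int: "set_integrable lebesgue (cylinder l R T) v"
    and M: "continuous_on (UNIV \<times> {0..}) M" and N: "continuous_on (UNIV \<times> {0..}) N"
    and M0: "\<And>x t. t > T \<Longrightarrow> M (x, t) = 0"
    and MN: "\<And>z. z \<in> light_cone l R 0 T \<Longrightarrow> M z = N z"
  shows "(LINT t:{0..}|lebesgue. LINT x|lebesgue. v (x, t) * M (x, t))
    = (LINT z:light_cone l R 0 T|lebesgue. v z * N z)"
proof -
  define F where "F z = indicator (light_cone l R 0 T) z *\<^sub>R (v z * N z)" for z
  have "continuous_on (cylinder l R T) N"
    by (rule continuous_on_subset[OF N]) (auto simp: cylinder_def)
  from set_integrable_mult_continuous[OF int compact_cylinder this cone_subset_cylinder cone_borel] l
  have F: "integrable lebesgue F" unfolding F_def[abs_def] set_integrable_def by simp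
  have "indicator {0..} t *\<^sub>R (LINT x|lebesgue. v (x, t) * M (x, t)) = (LINT x|lebesgue. F (x, t))" for t
  proof (cases "t \<ge> 0")
    case True
    have "AE x in lebesgue. v (x, t) * M (x, t) = F (x, t)"
      using supp[OF True]
    proof eventually_elim
      case (elim x)
      show ?case
      proof (cases "(x, t) \<in> light_cone l R 0 T")
        case True
        then show ?thesis by (simp add: F_def MN)
      next
        case False
        with \<open>t \<ge> 0\<close> elim M0[of t x] show ?thesis
          by (cases "t > T") (auto simp: F_def light_cone_def)
      qed
    qed
    moreover have "(\<lambda>x. v (x, t) * M (x, t)) \<in> borel_measurable lebesgue"
      by (intro borel_measurable_times meas continuous_slice_measurable M True)
    ultimately show ?thesis using True by (simp add: integral_cong_AE_lebesgue)
  next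
    case False
    then have "F (x, t) = 0" for x by (simp add: F_def light_cone_def)
    with False show ?thesis by simp
  qed
  then have "(LINT t:{0..}|lebesgue. LINT x|lebesgue. v (x, t) * M (x, t))
      = (LINT t|lebesgue. LINT x|lebesgue. F (x, t))"
    by (simp only: set_lebesgue_integral_def)
  also have "\<dots> = (LINT z|lebesgue. F z)" by (rule lebesgue_fubini[OF F])
  finally show ?thesis by (simp only: F_def set_lebesgue_integral_def)
qed

text \<open>On a compact set |u| <= 1 + |u|^p suffices.\<close>

lemma Lp_loc_integrable:
  fixes u :: "'a::euclidean_space \<Rightarrow> real"
  assumes "Lp_loc_on p S u" "p > 1" "compact K" "K \<subseteq> S"
  shows "set_integrable lebesgue K u" "set_integrable lebesgue K (\<lambda>z. \<bar>u z\<bar> powr p)"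
proof -
  show P: "set_integrable lebesgue K (\<lambda>z. \<bar>u z\<bar> powr p)"
    using assms unfolding Lp_loc_on_def by blast
  have m: "set_borel_measurable lebesgue K u" using assms unfolding Lp_loc_on_def by blast
  have "set_integrable lebesgue K (\<lambda>_. 1)"
    using lmeasurable_compact[OF assms(3)] by (simp add: set_integrable_def lmeasurable_iff_integrable)
  from set_integral_add(1)[OF this P]
  have "integrable lebesgue (\<lambda>z. indicator K z *\<^sub>R (1 + \<bar>u z\<bar> powr p))"
    by (simp add: set_integrable_def)
  then show "set_integrable lebesgue K u"
    unfolding set_integrable_def
  proof (rule Bochner_Integration.integrable_bound)
    show "(\<lambda>z. indicator K z *\<^sub>R u z) \<in> borel_measurable lebesgue"
      using m by (simp add: set_borel_measurable_def)
    have "\<bar>u z\<bar> \<le> 1 + \<bar>u z\<bar> powr p" for z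
    proof (cases "\<bar>u z\<bar> \<le> 1")
      case False
      then have "\<bar>u z\<bar> powr 1 \<le> \<bar>u z\<bar> powr p" using assms(2) by (intro powr_mono) auto
      then show ?thesis using False by simp
    qed (auto intro: order_trans[of _ 1])
    then show "AE z in lebesgue. norm (indicator K z *\<^sub>R u z) \<le> norm (indicator K z *\<^sub>R (1 + \<bar>u z\<bar> powr p))"
      by (auto simp: indicator_def intro!: AE_I2 order_trans[OF _ abs_ge_self])
  qed
qed

lemma test_function_UNIV_bounded_support:
  assumes "test_function_on UNIV (f :: 'a::euclidean_space \<Rightarrow> real)"
  obtains r where "r > 0" "\<And>x. norm x \<ge> r \<Longrightarrow> f x = 0"
proof -
  obtain K where K: "compact K" "\<And>x. x \<notin> K \<Longrightarrow> f x = 0"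
    using assms by (auto simp: test_function_on_def)
  obtain r where "r > 0" "\<And>x. x \<in> K \<Longrightarrow> norm x < r"
    using compact_imp_bounded[OF K(1)] by (metis bounded_pos_less)
  with K(2) show thesis by (metis not_less that)
qed

text \<open>The weak formulation for the test functions \<open>\<alpha>(t) \<psi>(\<bar>x\<bar>\<^sup>2)\<close>, where \<open>\<psi>\<close> need not be compactly
  supported because \<open>u\<close> lives in the light cone.\<close>

definition radial_weak_form ::
  "real \<Rightarrow> real \<Rightarrow> real \<Rightarrow> real \<Rightarrow> real \<Rightarrow> (real ^ 'n \<Rightarrow> real) \<Rightarrow> (real ^ 'n \<Rightarrow> real)
    \<Rightarrow> ((real ^ 'n) \<times> real \<Rightarrow> real) \<Rightarrow> bool" where
  "radial_weak_form l \<mu> p \<epsilon> R f g u \<longleftrightarrow>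
    (\<forall>T \<alpha> \<alpha>1 \<alpha>2 \<psi> \<psi>1 \<psi>2. T \<ge> 0 \<and> smooth_on {0..} \<alpha> \<and> (\<forall>t\<ge>T. \<alpha> t = 0) \<and>
      (\<forall>t\<ge>0. (\<alpha> has_real_derivative \<alpha>1 t) (at t within {0..})) \<and>
      (\<forall>t\<ge>0. (\<alpha>1 has_real_derivative \<alpha>2 t) (at t within {0..})) \<and>
      smooth_on UNIV \<psi> \<and> (\<forall>r. (\<psi> has_real_derivative \<psi>1 r) (at r)) \<and>
      (\<forall>r. (\<psi>1 has_real_derivative \<psi>2 r) (at r)) \<longrightarrow>
      (LINT z:light_cone l R 0 T|lebesgue. u z * wave_adjoint l \<mu> \<alpha> \<alpha>2 \<psi> \<psi>1 \<psi>2 z)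
      = (LINT z:light_cone l R 0 T|lebesgue. \<bar>u z\<bar> powr p * radial \<alpha> \<psi> z)
        + \<epsilon> * (LINT x|lebesgue. (g x * \<alpha> 0 - f x * \<alpha>1 0) * \<psi> (x \<bullet> x)))"

lemma radial_weak_formD:
  assumes "radial_weak_form l \<mu> p \<epsilon> R f g u" "T \<ge> 0" "smooth_on {0..} \<alpha>" "\<And>t. t \<ge> T \<Longrightarrow> \<alpha> t = 0"
    and "\<And>t. t \<ge> 0 \<Longrightarrow> (\<alpha> has_real_derivative \<alpha>1 t) (at t within {0..})"
    and "\<And>t. t \<ge> 0 \<Longrightarrow> (\<alpha>1 has_real_derivative \<alpha>2 t) (at t within {0..})"
    and "smooth_on UNIV \<psi>" "\<And>r. (\<psi> has_real_derivative \<psi>1 r) (at r)"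
    and "\<And>r. (\<psi>1 has_real_derivative \<psi>2 r) (at r)"
  shows "(LINT z:light_cone l R 0 T|lebesgue. u z * wave_adjoint l \<mu> \<alpha> \<alpha>2 \<psi> \<psi>1 \<psi>2 z)
    = (LINT z:light_cone l R 0 T|lebesgue. \<bar>u z\<bar> powr p * radial \<alpha> \<psi> z)
      + \<epsilon> * (LINT x|lebesgue. (g x * \<alpha> 0 - f x * \<alpha>1 0) * \<psi> (x \<bullet> x))"
  by (rule assms(1)[unfolded radial_weak_form_def, THEN spec, THEN spec, THEN spec, THEN spec, THEN spec,
        THEN spec, THEN spec, THEN mp]) (use assms(2-) in simp)

text \<open>The profile \<open>\<psi>\<close> is cut off beyond a radius that the cone up to time
  \<open>T\<close> and the supports of the data never reach. The weak formulation applies to the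
  cut-off profile, and no integral notices the change.\<close>

lemma weak_solution_radial:
  fixes u :: "(real ^ 'n) \<times> real \<Rightarrow> real"
  assumes ws: "weak_solution l \<mu> p \<epsilon> f g \<infinity> u" and p: "p > 1" and l: "-1 < l"
    and f: "test_function_on UNIV f" and g: "test_function_on UNIV g"
  obtains R where "R > 0"
    "\<And>T. set_integrable lebesgue (cylinder l R T) u"
    "\<And>T. set_integrable lebesgue (cylinder l R T) (\<lambda>z. \<bar>u z\<bar> powr p)"
    "radial_weak_form l \<mu> p \<epsilon> R f g u"
proof -
  obtain ut R where C1: "C1_L1_loc (time_interval \<infinity>) u ut" and R: "R > 0"
    and supp: "\<And>t. t \<in> time_interval \<infinity> \<Longrightarrow>
      ess_support (\<lambda>x. u (x, t)) \<union> ess_support (\<lambda>x. ut (x, t)) \<subseteq> ball 0 (R + A_int l t)"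
    using ws unfolding weak_solution_def by blast
  have Lp: "Lp_loc_on p (slab \<infinity>) u" using ws unfolding weak_solution_def by blast
  have weak: "(LINT t:{0..}|lebesgue. LINT x|lebesgue.
           u (x, t) * (time_deriv \<infinity> (time_deriv \<infinity> \<phi>) (x, t)
             - (1 + t) powr (2 * l) * space_laplacian \<infinity> \<phi> (x, t)
             + \<mu>\<^sup>2 / (1 + t)\<^sup>2 * \<phi> (x, t)))
        = (LINT t:{0..}|lebesgue. LINT x|lebesgue. \<bar>u (x, t)\<bar> powr p * \<phi> (x, t))
          + \<epsilon> * (LINT x|lebesgue. g x * \<phi> (x, 0) - f x * time_deriv \<infinity> \<phi> (x, 0))"
    if "test_function_on (slab \<infinity>) \<phi>" for \<phi>
  proof -
    have ti: "time_interval \<infinity> = {0..}" by (auto simp: time_interval_def)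
    from ws[unfolded weak_solution_def, THEN conjunct2, THEN conjunct2, rule_format, OF that]
    show ?thesis unfolding ti .
  qed
  have meas: "(\<lambda>x. u (x, t)) \<in> borel_measurable lebesgue" if "t \<ge> 0" for t
    using C1 that unfolding C1_L1_loc_def by (intro L1_loc_measurable) (simp add: time_interval_def)
  have supp0: "AE x in lebesgue. norm x \<ge> R + A_int l t \<longrightarrow> u (x, t) = 0" if "t \<ge> 0" for t
  proof -
    have s: "ess_support (\<lambda>x. u (x, t)) \<subseteq> ball 0 (R + A_int l t)"
      using supp[of t] that by (simp add: time_interval_def)
    show ?thesis
      using AE_not_in_ess_support[of "\<lambda>x. u (x, t)"] by eventually_elim (use s in force)
  qed
  have cyl: "cylinder l R T \<subseteq> (slab \<infinity> :: ((real ^ 'n) \<times> real) set)" for T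
    by (auto simp: cylinder_def slab_infinity)
  note int = Lp_loc_integrable[OF Lp p compact_cylinder cyl]
  obtain rf where rf: "rf > 0" "\<And>x. norm x \<ge> rf \<Longrightarrow> f x = 0"
    using test_function_UNIV_bounded_support[OF f] by blast
  obtain rg where rg: "rg > 0" "\<And>x. norm x \<ge> rg \<Longrightarrow> g x = 0"
    using test_function_UNIV_bounded_support[OF g] by blast
  show thesis
  proof (rule that[OF R int])
    show "radial_weak_form l \<mu> p \<epsilon> R f g u"
      unfolding radial_weak_form_def
    proof (intro allI impI, elim conjE)
      fix T and \<alpha> \<alpha>1 \<alpha>2 \<psi> \<psi>1 \<psi>2 :: "real \<Rightarrow> real"
      assume T: "T \<ge> 0" and \<alpha>: "smooth_on {0..} \<alpha>" and h\<alpha>: "\<forall>t\<ge>T. \<alpha> t = 0"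
        and h\<alpha>1: "\<forall>t\<ge>0. (\<alpha> has_real_derivative \<alpha>1 t) (at t within {0..})"
        and h\<alpha>2: "\<forall>t\<ge>0. (\<alpha>1 has_real_derivative \<alpha>2 t) (at t within {0..})"
        and \<psi>: "smooth_on UNIV \<psi>" and h\<psi>1: "\<forall>r. (\<psi> has_real_derivative \<psi>1 r) (at r)"
        and h\<psi>2: "\<forall>r. (\<psi>1 has_real_derivative \<psi>2 r) (at r)"
      note \<alpha> = \<alpha> h\<alpha>[rule_format] and \<alpha>1 = h\<alpha>1[rule_format] and \<alpha>2 = h\<alpha>2[rule_format]
        and \<psi>1 = h\<psi>1[rule_format] and \<psi>2 = h\<psi>2[rule_format]
      have sm\<alpha>1: "smooth_on {0..} \<alpha>1" by (rule smooth_on_derivative[OF fat_atLeast _ \<alpha>(1)]) (simp add: \<alpha>1)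
      have sm\<alpha>2: "smooth_on {0..} \<alpha>2" by (rule smooth_on_derivative[OF fat_atLeast _ sm\<alpha>1]) (simp add: \<alpha>2)
      have sm\<psi>1: "smooth_on UNIV \<psi>1" by (rule smooth_on_derivative[OF fat_UNIV _ \<psi>]) (simp add: \<psi>1)
      have sm\<psi>2: "smooth_on UNIV \<psi>2" by (rule smooth_on_derivative[OF fat_UNIV _ sm\<psi>1]) (simp add: \<psi>2)
      \<comment> \<open>Beyond \<open>T\<close>, which is nonnegative, one-sided derivatives on [0,
        infinity) are two-sided, so vanishing passes from \<open>\<alpha>\<close> to its
        derivatives.\<close>
      have at: "(h has_real_derivative D) (at t)"
        if "(h has_real_derivative D) (at t within {0..})" "t > T" for h D t
      proof -
        have tI: "t \<in> interior {0..}" using that T by (intro interiorI[of "{T<..}"]) auto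
        from that(1) show ?thesis unfolding at_within_interior[OF tI] .
      qed
      have \<alpha>1_0: "\<alpha>1 t = 0" if "t > T" for t
        by (rule deriv_eq_on_open[OF at[OF \<alpha>1 that] DERIV_const[of 0] open_greaterThan[of T]])
          (use that T \<alpha>(2) in auto)
      have \<alpha>2_0: "\<alpha>2 t = 0" if "t > T" for t
        by (rule deriv_eq_on_open[OF at[OF \<alpha>2 that] DERIV_const[of 0] open_greaterThan[of T]])
          (use that T \<alpha>1_0 in auto)
      \<comment> \<open>Exceeds the radii of the cone at time \<open>T\<close> and of both initial
        data.\<close>
      define r0 where "r0 = Max {R + A_int l T, rf, rg}"
      have r0: "R + A_int l T \<le> r0" "rf \<le> r0" "rg \<le> r0" by (auto simp: r0_def)
        \<comment> \<open>As a function of |x|^2 this is 1 up to r0^2 and 0 from r0^2 + 1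
          on.\<close>
        define \<omega> where "\<omega> r = smooth_step (r0\<^sup>2 + 1 + (- 1) * r)" for r
      define \<xi> where "\<xi> r = \<psi> r * \<omega> r" for r
      have "smooth_on UNIV \<omega>"
        unfolding \<omega>_def[abs_def]
        by (intro smooth_on_compose[OF fat_UNIV fat_UNIV smooth_on_smooth_step] smooth_on_affine) auto
      then have \<xi>: "smooth_on UNIV \<xi>"
        unfolding \<xi>_def[abs_def] by (intro smooth_on_mult fat_UNIV \<psi>)
      have \<xi>_0: "\<xi> r = 0" if "r \<ge> r0\<^sup>2 + 1" for r
        using that by (simp add: \<xi>_def \<omega>_def smooth_step_eq_0)
      have \<xi>_eq: "\<xi> r = \<psi> r" if "r \<in> {..<r0\<^sup>2}" for r
        using that by (simp add: \<xi>_def \<omega>_def smooth_step_eq_1)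
      obtain \<xi>1 where \<xi>1: "\<And>r. (\<xi> has_real_derivative \<xi>1 r) (at r)" "smooth_on UNIV \<xi>1"
        using smooth_on_UNIV_derivative[OF \<xi>] by blast
      obtain \<xi>2 where \<xi>2: "\<And>r. (\<xi>1 has_real_derivative \<xi>2 r) (at r)" "smooth_on UNIV \<xi>2"
        using smooth_on_UNIV_derivative[OF \<xi>1(2)] by blast
      \<comment> \<open>Agreement on the open set r < r0^2 carries over to derivatives; the strict
        inequality in the cone keeps |x|^2 inside it.\<close>
      have \<xi>1_eq: "\<xi>1 r = \<psi>1 r" if "r \<in> {..<r0\<^sup>2}" for r
        by (rule deriv_eq_on_open[OF \<xi>1(1) \<psi>1 open_lessThan that \<xi>_eq])
      have \<xi>2_eq: "\<xi>2 r = \<psi>2 r" if "r \<in> {..<r0\<^sup>2}" for r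
        by (rule deriv_eq_on_open[OF \<xi>2(1) \<psi>2 open_lessThan that \<xi>1_eq])
      define \<phi> where "\<phi> = (radial \<alpha> \<xi> :: (real ^ 'n) \<times> real \<Rightarrow> real)"
      have test: "test_function_on (slab \<infinity>) \<phi>"
        unfolding \<phi>_def by (rule radial_test_function[OF \<alpha> \<xi> \<xi>_0])
      have td: "time_deriv \<infinity> \<phi> z = radial \<alpha>1 \<xi> z" if "z \<in> slab \<infinity>" for z
        unfolding \<phi>_def by (rule time_deriv_radial[OF \<alpha>1 \<xi>1(1) that])
      have tdd: "time_deriv \<infinity> (time_deriv \<infinity> \<phi>) z = radial \<alpha>2 \<xi> z" if "z \<in> slab \<infinity>" for z
      proof -
        have "time_deriv \<infinity> (time_deriv \<infinity> \<phi>) z = time_deriv \<infinity> (radial \<alpha>1 \<xi>) z"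
          unfolding time_deriv_def[of \<infinity> "time_deriv \<infinity> \<phi>"] time_deriv_def[of \<infinity> "radial \<alpha>1 \<xi>"]
          by (rule partial_within_cong[OF td that])
        also have "\<dots> = radial \<alpha>2 \<xi> z" by (rule time_deriv_radial[OF \<alpha>2 \<xi>1(1) that])
        finally show ?thesis .
      qed
      note sc = smooth_on_imp_continuous_on
      have cA: "continuous_on S (wave_adjoint l \<mu> \<alpha> \<alpha>2 \<psi> \<psi>1 \<psi>2)"
        "continuous_on S (wave_adjoint l \<mu> \<alpha> \<alpha>2 \<xi> \<xi>1 \<xi>2)"
        "continuous_on S (radial \<alpha> \<psi>)" "continuous_on S (radial \<alpha> \<xi>)"
        if "\<And>z. z \<in> S \<Longrightarrow> snd z \<ge> 0" for S :: "((real ^ 'n) \<times> real) set"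
        by (intro continuous_on_wave_adjoint continuous_on_radial sc \<alpha> sm\<alpha>2 \<psi> sm\<psi>1 sm\<psi>2 \<xi> \<xi>1 \<xi>2 that; assumption)+
      have inside: "fst z \<bullet> fst z \<in> {..<r0\<^sup>2}" if "z \<in> light_cone l R 0 T" for z :: "(real ^ 'n) \<times> real"
      proof -
        have "A_int l (snd z) \<le> A_int l T" using that l by (intro A_int_mono) (auto simp: light_cone_def)
        then have "norm (fst z) < r0" using that r0(1) by (auto simp: light_cone_def)
        then have "(norm (fst z))\<^sup>2 < r0\<^sup>2" by (intro power_strict_mono) auto
        then show ?thesis by (simp add: dot_square_norm)
      qed
      have L: "(LINT t:{0..}|lebesgue. LINT x|lebesgue.
             u (x, t) * (time_deriv \<infinity> (time_deriv \<infinity> \<phi>) (x, t)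
               - (1 + t) powr (2 * l) * space_laplacian \<infinity> \<phi> (x, t) + \<mu>\<^sup>2 / (1 + t)\<^sup>2 * \<phi> (x, t)))
          = (LINT z:light_cone l R 0 T|lebesgue. u z * wave_adjoint l \<mu> \<alpha> \<alpha>2 \<psi> \<psi>1 \<psi>2 z)"
      proof -
        have eq: "time_deriv \<infinity> (time_deriv \<infinity> \<phi>) (x, t)
               - (1 + t) powr (2 * l) * space_laplacian \<infinity> \<phi> (x, t) + \<mu>\<^sup>2 / (1 + t)\<^sup>2 * \<phi> (x, t)
            = wave_adjoint l \<mu> \<alpha> \<alpha>2 \<xi> \<xi>1 \<xi>2 (x, t)" if "t \<in> {0..}" for x t
        proof -
          have z: "(x, t) \<in> slab \<infinity>" using that by (simp add: slab_infinity)
          have lap: "space_laplacian \<infinity> \<phi> (x, t)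
              = radial \<alpha> (\<lambda>r. 4 * r * \<xi>2 r + 2 * real CARD('n) * \<xi>1 r) (x, t)"
            unfolding \<phi>_def by (rule space_laplacian_radial[OF \<alpha>1 \<xi>1(1) \<xi>2(1) z])
          show ?thesis unfolding tdd[OF z] lap wave_adjoint_def by (simp add: \<phi>_def)
        qed
        have "(LINT t:{0..}|lebesgue. LINT x|lebesgue.
             u (x, t) * (time_deriv \<infinity> (time_deriv \<infinity> \<phi>) (x, t)
               - (1 + t) powr (2 * l) * space_laplacian \<infinity> \<phi> (x, t) + \<mu>\<^sup>2 / (1 + t)\<^sup>2 * \<phi> (x, t)))
          = (LINT t:{0..}|lebesgue. LINT x|lebesgue. u (x, t) * wave_adjoint l \<mu> \<alpha> \<alpha>2 \<xi> \<xi>1 \<xi>2 (x, t))"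
          unfolding set_lebesgue_integral_def
        proof (rule Bochner_Integration.integral_cong[OF refl])
          fix t :: real
          show "indicator {0..} t *\<^sub>R (LINT x|lebesgue.
             u (x, t) * (time_deriv \<infinity> (time_deriv \<infinity> \<phi>) (x, t)
               - (1 + t) powr (2 * l) * space_laplacian \<infinity> \<phi> (x, t) + \<mu>\<^sup>2 / (1 + t)\<^sup>2 * \<phi> (x, t)))
            = indicator {0..} t *\<^sub>R (LINT x|lebesgue. u (x, t) * wave_adjoint l \<mu> \<alpha> \<alpha>2 \<xi> \<xi>1 \<xi>2 (x, t))"
          proof (cases "t \<in> {0..}")
            case True
            show ?thesis unfolding eq[OF True] ..
          qed simp
        qed
        also have "\<dots> = (LINT z:light_cone l R 0 T|lebesgue. u z * wave_adjoint l \<mu> \<alpha> \<alpha>2 \<psi> \<psi>1 \<psi>2 z)"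
        proof (rule iterated_integral_cone[OF l T meas supp0 int(1)])
          show "wave_adjoint l \<mu> \<alpha> \<alpha>2 \<xi> \<xi>1 \<xi>2 (x, t) = 0" if "t > T" for x :: "real ^ 'n" and t
            using that \<alpha>(2)[of t] \<alpha>2_0 by (simp add: wave_adjoint_def radial_def)
          show "wave_adjoint l \<mu> \<alpha> \<alpha>2 \<xi> \<xi>1 \<xi>2 z = wave_adjoint l \<mu> \<alpha> \<alpha>2 \<psi> \<psi>1 \<psi>2 z"
            if "z \<in> light_cone l R 0 T" for z :: "(real ^ 'n) \<times> real"
            using inside[OF that] by (simp add: wave_adjoint_def radial_def \<xi>_eq \<xi>1_eq \<xi>2_eq)
        qed (auto intro!: cA)
        finally show ?thesis .
      qed
      have P: "(LINT t:{0..}|lebesgue. LINT x|lebesgue. \<bar>u (x, t)\<bar> powr p * \<phi> (x, t))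
          = (LINT z:light_cone l R 0 T|lebesgue. \<bar>u z\<bar> powr p * radial \<alpha> \<psi> z)"
      proof (rule iterated_integral_cone[OF l T _ _ int(2)])
        show "(\<lambda>x. \<bar>u (x, t)\<bar> powr p) \<in> borel_measurable lebesgue" if "t \<ge> 0" for t
          using meas[OF that] by measurable
        show "AE x in lebesgue. norm x \<ge> R + A_int l t \<longrightarrow> \<bar>u (x, t)\<bar> powr p = 0" if "t \<ge> 0" for t
          using supp0[OF that] by eventually_elim simp
        show "\<phi> (x, t) = 0" if "t > T" for x :: "real ^ 'n" and t
          using that \<alpha>(2)[of t] by (simp add: \<phi>_def radial_def)
        show "\<phi> z = radial \<alpha> \<psi> z" if "z \<in> light_cone l R 0 T" for z :: "(real ^ 'n) \<times> real"
          using inside[OF that] by (simp add: \<phi>_def radial_def \<xi>_eq)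
      qed (auto intro!: cA simp: \<phi>_def)
      have I: "g x * \<phi> (x, 0) - f x * time_deriv \<infinity> \<phi> (x, 0) = (g x * \<alpha> 0 - f x * \<alpha>1 0) * \<psi> (x \<bullet> x)" for x
      proof (cases "norm x < r0")
        case True
        then have "(norm x)\<^sup>2 < r0\<^sup>2" by (intro power_strict_mono) auto
        then have "\<xi> (x \<bullet> x) = \<psi> (x \<bullet> x)" by (intro \<xi>_eq) (simp add: dot_square_norm)
        moreover have "time_deriv \<infinity> \<phi> (x, 0) = radial \<alpha>1 \<xi> (x, 0)"
          by (rule td) (simp add: slab_infinity)
        moreover have "\<phi> (x, 0) = radial \<alpha> \<xi> (x, 0)" by (simp add: \<phi>_def)
        ultimately show ?thesis by (simp add: radial_def algebra_simps)
      next
        case False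
        then have "f x = 0" "g x = 0" using rf(2) rg(2) r0 by auto
        then show ?thesis by simp
      qed
      show "(LINT z:light_cone l R 0 T|lebesgue. u z * wave_adjoint l \<mu> \<alpha> \<alpha>2 \<psi> \<psi>1 \<psi>2 z)
        = (LINT z:light_cone l R 0 T|lebesgue. \<bar>u z\<bar> powr p * radial \<alpha> \<psi> z)
          + \<epsilon> * (LINT x|lebesgue. (g x * \<alpha> 0 - f x * \<alpha>1 0) * \<psi> (x \<bullet> x))"
        using weak[OF test] unfolding L P I .
    qed
  qed
qed

subsection \<open>Cut-off functions in time\<close>

lemma smooth_bounded_Icc:
  assumes "smooth_on UNIV (h :: real \<Rightarrow> real)"
  obtains B where "B > 0" "\<And>x. x \<in> {a..b} \<Longrightarrow> \<bar>h x\<bar> \<le> B"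
proof -
  have "continuous_on {a..b} h"
    using smooth_on_imp_continuous_on[OF assms] continuous_on_subset by blast
  from compact_imp_bounded[OF compact_continuous_image[OF this compact_Icc]]
  obtain B where "B > 0" "\<And>x. x \<in> {a..b} \<Longrightarrow> \<bar>h x\<bar> \<le> B" by (auto simp: bounded_pos)
  then show thesis by (rule that)
qed

text \<open>\<open>H = h\<^sup>k\<close> with \<open>k\<close> large, so that \<open>H'' = O(h\<^sup>k\<^sup>-\<^sup>2)\<close> is controlled by \<open>H\<^sup>1\<^sup>/\<^sup>p\<close>.\<close>

lemma bump_power_exists:
  assumes p: "p > 1"
  obtains H C H1 H2 where "smooth_on UNIV H" "C > 0"
    "\<And>x. (H has_real_derivative H1 x) (at x)" "\<And>x. (H1 has_real_derivative H2 x) (at x)"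
    "\<And>x. H x \<ge> 0" "\<And>x. 1 \<le> x \<Longrightarrow> x \<le> 2 \<Longrightarrow> H x = 1"
    "\<And>x. x \<le> 1/2 \<or> x \<ge> 3 \<Longrightarrow> H x = 0" "H1 0 = 0"
    "\<And>x. \<bar>H2 x\<bar> \<le> C * H x powr (1/p)" "\<And>x. H x \<le> C * H x powr (1/p)"
proof -
  \<comment> \<open>Equal to 1 on [1, 2] and to 0 outside (1/2, 3).\<close>
  define h where "h x = smooth_step (-1 + 2 * x) * smooth_step (3 + (-1) * x)" for x
  have h: "smooth_on UNIV h"
    unfolding h_def[abs_def]
    by (intro smooth_on_mult fat_UNIV smooth_on_compose[OF fat_UNIV fat_UNIV smooth_on_smooth_step]
        smooth_on_affine) auto
  have h01: "0 \<le> h x" "h x \<le> 1" for x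
    by (auto simp: h_def smooth_step_nonneg smooth_step_le_1 mult_le_one)
  have h0: "h x = 0" if "x \<le> 1/2 \<or> x \<ge> 3" for x
    using that by (auto simp: h_def smooth_step_eq_0)
  have h1: "h x = 1" if "1 \<le> x" "x \<le> 2" for x
    using that by (simp add: h_def smooth_step_eq_1)
  obtain h' where h': "\<And>x. (h has_real_derivative h' x) (at x)" "smooth_on UNIV h'"
    using smooth_on_UNIV_derivative[OF h] by blast
  obtain h'' where h'': "\<And>x. (h' has_real_derivative h'' x) (at x)" "smooth_on UNIV h''"
    using smooth_on_UNIV_derivative[OF h'(2)] by blast
  obtain B1 where B1: "B1 > 0" "\<And>x. x \<in> {0..3} \<Longrightarrow> \<bar>h' x\<bar> \<le> B1"
    using smooth_bounded_Icc[OF h'(2)] by metis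
  obtain B2 where B2: "B2 > 0" "\<And>x. x \<in> {0..3} \<Longrightarrow> \<bar>h'' x\<bar> \<le> B2"
    using smooth_bounded_Icc[OF h''(2)] by metis
  define q where "q = p / (p - 1)"
  \<comment> \<open>With j >= 2 q the exponent k = j + 1 satisfies k/p <= k - 2, so h^(k-2) <=
    h^(k/p) = H^(1/p) because 0 <= h <= 1.\<close>
  obtain j :: nat where j: "2 * q \<le> real j" using real_arch_simple by blast
  define k where "k = j + 1"
  have kq: "real k / p \<le> real k - 1 - 1"
  proof -
    have "2 * p \<le> real j * (p - 1)" using j p by (simp add: q_def field_simps)
    also have "\<dots> \<le> real k * (p - 1)" using p by (intro mult_right_mono) (auto simp: k_def)
    finally show ?thesis using p by (simp add: field_simps)
  qed
  have k3: "k \<ge> 3"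
  proof -
    have "q > 1" using p by (simp add: q_def)
    then have "real j > 2" using j by linarith
    then show ?thesis by (simp add: k_def)
  qed
  define H where "H x = h x ^ k" for x
  define H1 where "H1 x = real k * (h x ^ (k - 1) * h' x)" for x
  define H2 where "H2 x = real k * (real (k - 1) * h x ^ (k - 2) * (h' x)\<^sup>2 + h x ^ (k - 1) * h'' x)" for x
  \<comment> \<open>The product bounds H''; the added 1 gives C >= 1, which is what the bound of H
    itself uses.\<close>
  define C where "C = real k * (real (k - 1) * B1\<^sup>2 + B2) + 1"
  have "real k * (real (k - 1) * B1\<^sup>2 + B2) \<ge> 0" using B1 B2 by (intro mult_nonneg_nonneg add_nonneg_nonneg) auto
  then have C: "C \<ge> 1" by (simp add: C_def)
  have small: "h x ^ (k - 2) \<le> H x powr (1/p)" for x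
  proof (cases "h x = 0")
    case True
    then show ?thesis using k3 by (simp add: H_def power_0_left)
  next
    case False
    then have pos: "h x > 0" using h01(1)[of x] by simp
    have "h x ^ (k - 2) = h x powr real (k - 2)" using pos by (simp add: powr_realpow)
    also have "\<dots> \<le> h x powr (real k / p)"
      using pos h01[of x] kq k3 by (intro powr_mono') (auto simp: of_nat_diff)
    also have "\<dots> = H x powr (1/p)"
      using pos by (simp add: H_def powr_realpow[symmetric] powr_powr)
    finally show ?thesis .
  qed
  have H2: "\<bar>H2 x\<bar> \<le> C * H x powr (1/p)" for x
  proof (cases "x \<in> {0..3}")
    case False
    then have "h x = 0" using h0 by auto
    then have "H2 x = 0" using k3 by (simp add: H2_def power_0_left)
    then show ?thesis using C by simp
  next
    case True
    have "h x ^ (k - 1) \<le> h x ^ (k - 2)" using h01 k3 by (intro power_decreasing) auto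
    then have "\<bar>h x ^ (k - 1) * h'' x\<bar> \<le> h x ^ (k - 2) * B2"
      unfolding abs_mult using h01 B2(2)[OF True] by (intro mult_mono) auto
    moreover have "\<bar>real (k - 1) * h x ^ (k - 2) * (h' x)\<^sup>2\<bar> \<le> real (k - 1) * h x ^ (k - 2) * B1\<^sup>2"
    proof -
      have "(h' x)\<^sup>2 \<le> B1\<^sup>2" using B1(2)[OF True] B1(1) by (simp add: abs_le_square_iff[symmetric])
      then have "real (k - 1) * h x ^ (k - 2) * (h' x)\<^sup>2 \<le> real (k - 1) * h x ^ (k - 2) * B1\<^sup>2"
        using h01 by (intro mult_left_mono) auto
      then show ?thesis using h01[of x] by simp
    qed
    ultimately have "\<bar>real (k - 1) * h x ^ (k - 2) * (h' x)\<^sup>2 + h x ^ (k - 1) * h'' x\<bar>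
        \<le> real (k - 1) * h x ^ (k - 2) * B1\<^sup>2 + h x ^ (k - 2) * B2"
      by (intro order_trans[OF abs_triangle_ineq] add_mono)
    also have "\<dots> = h x ^ (k - 2) * (real (k - 1) * B1\<^sup>2 + B2)"
      by (simp add: algebra_simps)
    finally have "\<bar>real (k - 1) * h x ^ (k - 2) * (h' x)\<^sup>2 + h x ^ (k - 1) * h'' x\<bar>
        \<le> h x ^ (k - 2) * (real (k - 1) * B1\<^sup>2 + B2)" .
    then have "\<bar>H2 x\<bar> \<le> real k * (h x ^ (k - 2) * (real (k - 1) * B1\<^sup>2 + B2))"
      unfolding H2_def abs_mult by (simp add: mult_left_mono)
    also have "\<dots> \<le> C * h x ^ (k - 2)" using h01[of x] by (simp add: C_def algebra_simps)
    also have "\<dots> \<le> C * H x powr (1/p)" using small C by (intro mult_left_mono) auto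
    finally show ?thesis .
  qed
  have Hle: "H x \<le> C * H x powr (1/p)" for x
  proof -
    have "H x \<le> h x ^ (k - 2)" unfolding H_def using h01 by (intro power_decreasing) auto
    also have "\<dots> \<le> 1 * H x powr (1/p)" using small by simp
    also have "\<dots> \<le> C * H x powr (1/p)" using C by (intro mult_right_mono) auto
    finally show ?thesis .
  qed
  have k1: "k - 1 - 1 = k - 2" by simp
  show thesis
  proof (rule that[of H C H1 H2])
    show "smooth_on UNIV H" unfolding H_def[abs_def] by (intro smooth_on_power fat_UNIV h)
    show "(H has_real_derivative H1 x) (at x)" for x
      unfolding H_def[abs_def] H1_def using h'(1)[of x]
      by (auto intro!: derivative_eq_intros)
    show "(H1 has_real_derivative H2 x) (at x)" for x
      unfolding H1_def[abs_def] H2_def k1[symmetric]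
      using h'(1)[of x] h''(1)[of x]
      by (auto intro!: derivative_eq_intros simp: power2_eq_square algebra_simps)
  qed (use C h01 h0 h1 k3 H2 Hle in \<open>auto simp: H_def H1_def\<close>)
qed

lemma cutoff_exists:
  obtains \<eta> C \<eta>1 \<eta>2 where "smooth_on UNIV \<eta>" "(C::real) > 0"
    "\<And>x. (\<eta> has_real_derivative \<eta>1 x) (at x)" "\<And>x. (\<eta>1 has_real_derivative \<eta>2 x) (at x)"
    "\<And>x. \<eta> x \<ge> 0" "\<And>x. x \<le> 1 \<Longrightarrow> \<eta> x = 1" "\<And>x. x \<ge> 2 \<Longrightarrow> \<eta> x = 0"
    "\<And>x. x < 1 \<Longrightarrow> \<eta>1 x = 0" "\<And>x. x < 1 \<Longrightarrow> \<eta>2 x = 0"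
    "\<And>x. x \<in> {1..2} \<Longrightarrow> \<bar>\<eta>1 x\<bar> \<le> C" "\<And>x. x \<in> {1..2} \<Longrightarrow> \<bar>\<eta>2 x\<bar> \<le> C"
proof -
  define \<eta> where "\<eta> x = smooth_step (2 + (-1) * x)" for x
  have \<eta>: "smooth_on UNIV \<eta>"
    unfolding \<eta>_def[abs_def]
    by (intro smooth_on_compose[OF fat_UNIV fat_UNIV smooth_on_smooth_step] smooth_on_affine) auto
  obtain \<eta>1 where \<eta>1: "\<And>x. (\<eta> has_real_derivative \<eta>1 x) (at x)" "smooth_on UNIV \<eta>1"
    using smooth_on_UNIV_derivative[OF \<eta>] by blast
  obtain \<eta>2 where \<eta>2: "\<And>x. (\<eta>1 has_real_derivative \<eta>2 x) (at x)" "smooth_on UNIV \<eta>2"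
    using smooth_on_UNIV_derivative[OF \<eta>1(2)] by blast
  obtain B1 where B1: "B1 > 0" "\<And>x. x \<in> {1..2} \<Longrightarrow> \<bar>\<eta>1 x\<bar> \<le> B1"
    using smooth_bounded_Icc[OF \<eta>1(2)] by metis
  obtain B2 where B2: "B2 > 0" "\<And>x. x \<in> {1..2} \<Longrightarrow> \<bar>\<eta>2 x\<bar> \<le> B2"
    using smooth_bounded_Icc[OF \<eta>2(2)] by metis
  have e1: "\<eta> x = 1" if "x \<le> 1" for x using that by (simp add: \<eta>_def smooth_step_eq_1)
  have z1: "\<eta>1 x = 0" if "x < 1" for x
    by (rule deriv_eq_on_open[OF \<eta>1(1) DERIV_const[of 1] open_lessThan[of 1]]) (use that e1 in auto)
  have z2: "\<eta>2 x = 0" if "x < 1" for x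
    by (rule deriv_eq_on_open[OF \<eta>2(1) DERIV_const[of 0] open_lessThan[of 1]]) (use that z1 in auto)
  show thesis
  proof (rule that[of \<eta> "max B1 B2" \<eta>1 \<eta>2])
    show "\<bar>\<eta>1 x\<bar> \<le> max B1 B2" if "x \<in> {1..2}" for x using B1(2)[OF that] by linarith
    show "\<bar>\<eta>2 x\<bar> \<le> max B1 B2" if "x \<in> {1..2}" for x using B2(2)[OF that] by linarith
  qed (use \<eta> \<eta>1 \<eta>2 B1 e1 z1 z2 in \<open>auto simp: \<eta>_def smooth_step_nonneg smooth_step_eq_0\<close>)
qed

subsection \<open>Blow-up\<close>

lemma young_scaled:
  fixes x y \<delta> p q :: real
  assumes "p > 1" "q = p / (p - 1)" "\<delta> > 0" "x \<ge> 0" "y \<ge> 0"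
  shows "x * y \<le> \<delta> powr p * x powr p + \<delta> powr (- q) * y powr q"
proof -
  have q: "q > 1" "1/p + 1/q = 1" unfolding assms(2) using assms(1) by (auto simp: field_simps)
  have "(\<delta> * x) * (y / \<delta>) \<le> (\<delta> * x) powr p / p + (y / \<delta>) powr q / q"
    using assms q by (intro Youngs_inequality) auto
  \<comment> \<open>Only powers matter later, so the denominators p and q are replaced by 1.\<close>
  also have "\<dots> \<le> (\<delta> * x) powr p / 1 + (y / \<delta>) powr q / 1"
    using assms(1) q(1) by (intro add_mono divide_left_mono) auto
  also have "\<dots> = \<delta> powr p * x powr p + \<delta> powr (- q) * y powr q"
    using assms(3-5) by (simp add: powr_mult powr_divide powr_minus_divide)
  finally show ?thesis using assms by simp
qed

lemma measure_cylinder: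
  assumes "R + A_int l T \<ge> 0" "T \<ge> 0"
  shows "(cylinder l R T :: ((real ^ 'n) \<times> real) set) \<in> lmeasurable"
    and "measure lebesgue (cylinder l R T :: ((real ^ 'n) \<times> real) set)
      = unit_ball_vol (real CARD('n)) * (R + A_int l T) ^ CARD('n) * T"
proof -
  show "(cylinder l R T :: ((real ^ 'n) \<times> real) set) \<in> lmeasurable"
    by (intro lmeasurable_compact compact_cylinder)
  have "emeasure lborel (cylinder l R T :: ((real ^ 'n) \<times> real) set)
      = emeasure lborel (cball (0::real ^ 'n) (R + A_int l T)) * emeasure lborel {0..T}"
    unfolding cylinder_def lborel_prod[symmetric]
    by (rule lborel.emeasure_pair_measure_Times) auto
  also have "\<dots> = ennreal (unit_ball_vol (real CARD('n)) * (R + A_int l T) ^ CARD('n) * T)"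
    using assms emeasure_cball[of "R + A_int l T" "0 :: real ^ 'n"]
    by (simp add: ennreal_mult')
  finally have em: "emeasure lborel (cylinder l R T :: ((real ^ 'n) \<times> real) set)
      = ennreal (unit_ball_vol (real CARD('n)) * (R + A_int l T) ^ CARD('n) * T)" .
  show "measure lebesgue (cylinder l R T :: ((real ^ 'n) \<times> real) set)
      = unit_ball_vol (real CARD('n)) * (R + A_int l T) ^ CARD('n) * T"
  proof -
    have "(cylinder l R T :: ((real ^ 'n) \<times> real) set) \<in> sets lborel"
      using borel_closed[OF compact_imp_closed[OF compact_cylinder]] by simp
    then have "measure lebesgue (cylinder l R T :: ((real ^ 'n) \<times> real) set)
        = measure lborel (cylinder l R T :: ((real ^ 'n) \<times> real) set)" by (rule measure_completion)
    then show ?thesis using assms em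
      by (simp add: measure_def unit_ball_vol_nonneg)
  qed
qed

text \<open>The range up to 3 T is the support of the scaled bump. There 1 + t <= 4 T, and 4^(l+1)
  <= 4 because l < 0.\<close>

lemma A_int_upper:
  assumes l: "-1 < l" "l < 0" and R: "R \<ge> 0" and t: "0 \<le> t" "t \<le> 3 * T" "T \<ge> 1"
  shows "1 + R + A_int l t \<le> (1 + R + 4 / (l + 1)) * T powr (l + 1)"
proof -
  have T1: "T powr (l + 1) \<ge> 1" using l t by (intro ge_one_powr_ge_zero) auto
  have "(1 + t) powr (l + 1) \<le> (4 * T) powr (l + 1)" using l t by (intro powr_mono2) auto
  also have "\<dots> = 4 powr (l + 1) * T powr (l + 1)" using t by (simp add: powr_mult)
  also have "\<dots> \<le> 4 powr 1 * T powr (l + 1)" using l by (intro mult_right_mono powr_mono) auto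
  finally have "(1 + t) powr (l + 1) \<le> 4 * T powr (l + 1)" by simp
  then have "A_int l t \<le> 4 * T powr (l + 1) / (l + 1)"
    using l t by (simp add: A_int_eq divide_right_mono)
  moreover have "(1 + R) * 1 \<le> (1 + R) * T powr (l + 1)" using R T1 by (intro mult_left_mono) auto
  ultimately show ?thesis by (simp add: algebra_simps)
qed

text \<open>The converse of \<open>A_int_upper\<close>: since 0 < l + 1 < 1, division by l + 1 only
  enlarges. Together they permit comparing powers of 1 + R + A(t) with powers of T^(l+1) for
  exponents of either sign.\<close>

lemma A_int_lower:
  assumes l: "-1 < l" "l < 0" and R: "R \<ge> 0" and t: "0 \<le> T" "T \<le> t"
  shows "T powr (l + 1) \<le> 1 + R + A_int l t"
proof -
  define x where "x = (1 + t) powr (l + 1)"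
  have x: "x \<ge> 1" unfolding x_def using l t by (intro ge_one_powr_ge_zero) auto
  have "T powr (l + 1) \<le> x" unfolding x_def using l t by (intro powr_mono2) auto
  also have "(x - 1) * (l + 1) \<le> (x - 1) * 1" using l x by (intro mult_left_mono) auto
  then have "x - 1 \<le> (x - 1) / (l + 1)" using l by (simp add: field_simps)
  then have "x \<le> 1 + R + A_int l t" using l t R by (simp add: A_int_eq x_def)
  finally show ?thesis .
qed

lemma cone_mono: "a' \<le> a \<Longrightarrow> b \<le> b' \<Longrightarrow> light_cone l R a b \<subseteq> light_cone l R a' b'"
  by (auto simp: light_cone_def)

text \<open>Multiplied by 2 (p - 1), the left-hand side becomes (l + 1) (a p^2 - b p - 2). If a <=
  0, which means l <= -1 + 1/n, this quadratic is negative for every positive p, as b > 0; if a > 0,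
  it is negative between 0 and its positive root.\<close>

lemma strauss_condition:
  fixes l p :: real and n :: nat
  assumes n: "n \<ge> 1" and l: "-1 < l" "l < 0" and p: "1 < p"
    and H: "(l \<le> -1 + 1 / real n) \<or> (-1 + 1 / real n < l \<and> p < p_Str n l)"
  defines "q \<equiv> p / (p - 1)"
  shows "(1 + q * (l/2 - 1) + (l + 1) * (real n - 1) * (1 - q/2)) * (p - 1)
    + (1 + real n * (l + 1) - 2 * q) < 0"
proof -
  define a where "a = real n - 1 + l / (1 + l)"
  define b where "b = real n + 1 - 3 * l / (1 + l)"
  have "3 * l / (1 + l) < 0" using l by (intro divide_neg_pos) auto
  then have b: "b > 0" by (simp add: b_def)
  have a_iff: "a > 0 \<longleftrightarrow> -1 + 1 / real n < l"
    using l n by (simp add: a_def field_simps)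
  have poly: "a * p\<^sup>2 - b * p - 2 < 0"
  proof (cases "a > 0")
    case False
    then have "a * p\<^sup>2 \<le> 0" by (simp add: mult_nonpos_nonneg)
    moreover have "b * p > 0" using b p by simp
    ultimately show ?thesis by linarith
  next
    case True
    define P where "P = p_Str n l"
    have "P > 0 \<and> a * P\<^sup>2 - b * P - 2 = 0"
      using theI'[OF p_Str_ex1[of n l]] True unfolding P_def p_Str_def a_def b_def by simp
    then have P: "P > 0" "a * P\<^sup>2 - b * P - 2 = 0" by auto
    have pP: "p < P" using H True a_iff by (auto simp: P_def)
    \<comment> \<open>Compares the values at p and at the root P without solving the quadratic; the
      factor a p P + 2 is positive, so the sign is that of p - P.\<close>
    have "P * (a * p\<^sup>2 - b * p - 2) = (p - P) * (a * p * P + 2) + p * (a * P\<^sup>2 - b * P - 2)"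
      by (simp add: algebra_simps power2_eq_square)
    also have "\<dots> < 0"
      unfolding P(2) using pP True p P(1) by (simp add: mult_neg_pos add_pos_pos)
    finally show ?thesis using P(1) by (simp add: mult_less_0_iff)
  qed
  define S where "S = (1 + q * (l/2 - 1) + (l + 1) * (real n - 1) * (1 - q/2)) * (p - 1)
    + (1 + real n * (l + 1) - 2 * q)"
  have q: "q * (p - 1) = p" using p by (simp add: q_def)
  have S: "S = (p - 1) + p * (l/2 - 1) + (l + 1) * (real n - 1) * ((p - 1) - p/2)
    + (1 + real n * (l + 1) - 2 * q)"
  proof -
    have "(1 + q * (l/2 - 1) + (l + 1) * (real n - 1) * (1 - q/2)) * (p - 1)
      = (p - 1) + (q * (p - 1)) * (l/2 - 1) + (l + 1) * (real n - 1) * ((p - 1) - (q * (p - 1))/2)"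
      by (simp add: algebra_simps add_divide_distrib diff_divide_distrib)
    then show ?thesis unfolding q S_def by simp
  qed
  have "2 * (p - 1) * S = 2 * (p - 1) * ((p - 1) + p * (l/2 - 1)
      + (l + 1) * (real n - 1) * ((p - 1) - p/2) + 1 + real n * (l + 1)) - 4 * (q * (p - 1))"
    unfolding S by (simp add: algebra_simps)
  also have "\<dots> = ((l + 1) * (real n - 1) + l) * p\<^sup>2 - ((l + 1) * (real n + 1) - 3 * l) * p - 2 * (l + 1)"
    unfolding q by (simp add: algebra_simps power2_eq_square add_divide_distrib diff_divide_distrib)
  also have "\<dots> = (l + 1) * (a * p\<^sup>2 - b * p - 2)"
  proof -
    have "(l + 1) * a = (l + 1) * (real n - 1) + l" "(l + 1) * b = (l + 1) * (real n + 1) - 3 * l"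
      using l by (simp_all add: a_def b_def field_simps)
    then show ?thesis by (simp add: right_diff_distrib mult.assoc[symmetric])
  qed
  also have "\<dots> < 0" using l poly by (simp add: mult_pos_neg)
  finally have "S < 0" using p by (simp add: mult_less_0_iff)
  then show ?thesis by (simp add: S_def)
qed

lemma powr_comparable:
  fixes s x c \<theta> :: real
  assumes "0 < s" "s \<le> x" "x \<le> c * s" "c \<ge> 1"
  shows "x powr \<theta> \<le> c powr \<bar>\<theta>\<bar> * s powr \<theta>"
proof (cases "\<theta> \<ge> 0")
  case True
  then have "x powr \<theta> \<le> (c * s) powr \<theta>" using assms by (intro powr_mono2) auto
  then show ?thesis using True assms by (simp add: powr_mult)
next
  case False
  then have "x powr \<theta> \<le> 1 * s powr \<theta>" using assms by (simp add: powr_mono2')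
  also have "\<dots> \<le> c powr \<bar>\<theta>\<bar> * s powr \<theta>"
    using assms by (intro mult_right_mono ge_one_powr_ge_zero) auto
  finally show ?thesis .
qed

lemma continuous_on_A_int:
  assumes "-1 < l" shows "continuous_on {0..} (A_int l)"
proof -
  have "continuous_on {0..} (\<lambda>t. ((1 + t) powr (l + 1) - 1) / (l + 1))"
    using assms by (intro continuous_intros) auto
  then show ?thesis by (rule continuous_on_eq) (simp add: A_int_eq assms)
qed

lemma integral_pos_of_continuous:
  fixes h :: "'a::euclidean_space \<Rightarrow> real"
  assumes h: "continuous_on UNIV h" "\<And>x. h x \<ge> 0" "h x0 > 0" and supp: "\<And>x. norm x \<ge> r \<Longrightarrow> h x = 0"
  shows "(LINT x|lebesgue. h x) > 0"
proof -
  have "isCont h x0" using h(1) by (simp add: continuous_on_eq_continuous_at)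
  then obtain d where d: "d > 0" "\<And>x. dist x x0 < d \<Longrightarrow> dist (h x) (h x0) < h x0 / 2"
    using h(3) unfolding continuous_at_eps_delta by (metis half_gt_zero)
  have hx: "h x \<ge> h x0 / 2" if "x \<in> ball x0 d" for x
    using d(2)[of x] that by (auto simp: dist_real_def dist_commute abs_if split: if_splits)
  have "integrable lborel (\<lambda>x. indicator (cball 0 r) x *\<^sub>R h x)"
    by (intro borel_integrable_compact continuous_on_subset[OF h(1)]) auto
  moreover have "(\<lambda>x. indicator (cball 0 r) x *\<^sub>R h x) = h"
    using supp by (auto simp: indicator_def fun_eq_iff)
  ultimately have "integrable lborel h" by (simp only:)
  then have int: "integrable lebesgue h" by (subst integrable_completion) auto
  have "0 < h x0 / 2 * measure lebesgue (ball x0 d)"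
    using h(3) d(1) content_ball_pos[of d x0] by simp
  also have "\<dots> = (LINT x|lebesgue. h x0 / 2 * indicator (ball x0 d) x)"
    by simp
  also have "\<dots> \<le> (LINT x|lebesgue. h x)"
    using int h(2,3) hx by (intro integral_mono') (auto simp: indicator_def)
  finally show ?thesis .
qed

text \<open>The sign of \<open>b1\<close> makes the contribution of f nonnegative, so either datum
  alone yields a positive integral.\<close>

lemma initial_data_integral_pos:
  fixes f g :: "'a::euclidean_space \<Rightarrow> real" and \<psi> :: "real \<Rightarrow> real"
  assumes f: "test_function_on UNIV f" "\<And>x. f x \<ge> 0" and g: "test_function_on UNIV g" "\<And>x. g x \<ge> 0"
    and nz: "\<not> ((\<forall>x. f x = 0) \<and> (\<forall>x. g x = 0))"
    and b: "b0 > 0" "b1 < 0"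
    and \<psi>: "continuous_on UNIV \<psi>" "\<And>r. r \<ge> 0 \<Longrightarrow> \<psi> r > 0"
  shows "(LINT x|lebesgue. (g x * b0 - f x * b1) * \<psi> (x \<bullet> x)) > 0"
proof -
  obtain rf where rf: "\<And>x. norm x \<ge> rf \<Longrightarrow> f x = 0"
    by (rule test_function_UNIV_bounded_support[OF f(1)]) (rule that)
  obtain rg where rg: "\<And>x. norm x \<ge> rg \<Longrightarrow> g x = 0"
    by (rule test_function_UNIV_bounded_support[OF g(1)]) (rule that)
  obtain x0 where x0: "f x0 > 0 \<or> g x0 > 0" using nz f(2) g(2) by (metis less_eq_real_def)
  have fb: "f x * b1 \<le> 0" for x using f(2)[of x] b(2) by (intro mult_nonneg_nonpos) auto
  have gb: "g x * b0 \<ge> 0" for x using g(2)[of x] b(1) by simp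
  have cont: "continuous_on UNIV f" "continuous_on UNIV g"
    using f(1) g(1) by (auto simp: test_function_on_def intro: smooth_on_imp_continuous_on)
  have c\<psi>: "continuous_on UNIV (\<lambda>x::'a. \<psi> (x \<bullet> x))"
    by (rule continuous_on_compose2[OF \<psi>(1)]) (auto intro!: continuous_intros)
  show ?thesis
  proof (rule integral_pos_of_continuous)
    show "continuous_on UNIV (\<lambda>x. (g x * b0 - f x * b1) * \<psi> (x \<bullet> x))"
      by (intro continuous_intros cont c\<psi>)
    show "(g x * b0 - f x * b1) * \<psi> (x \<bullet> x) \<ge> 0" for x
      using fb[of x] gb[of x] \<psi>(2)[of "x \<bullet> x"] by (intro mult_nonneg_nonneg) auto
    have "g x0 * b0 - f x0 * b1 > 0"
    proof (cases "f x0 > 0")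
      case True
      then have "f x0 * b1 < 0" using b(2) by (rule mult_pos_neg)
      then show ?thesis using gb[of x0] by linarith
    next
      case False
      then have "g x0 * b0 > 0" using x0 b(1) by simp
      then show ?thesis using fb[of x0] by linarith
    qed
    then show "(g x0 * b0 - f x0 * b1) * \<psi> (x0 \<bullet> x0) > 0"
      using \<psi>(2)[of "x0 \<bullet> x0"] by (intro mult_pos_pos) auto
    show "(g x * b0 - f x * b1) * \<psi> (x \<bullet> x) = 0" if "norm x \<ge> max rf rg" for x
      using that rf rg by simp
  qed
qed

section \<open>The two competing bounds for the integral of |u|^p over the cone between T and
  2T\<close>

context
  fixes l \<mu> p \<epsilon> R :: real and f g :: "real ^ 'n \<Rightarrow> real" and u :: "(real ^ 'n) \<times> real \<Rightarrow> real"
  assumes l: "-1 < l" "l < 0" and p: "p > 1" and R: "R > 0"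
    and int_u: "\<And>T. set_integrable lebesgue (cylinder l R T) u"
    and int_p: "\<And>T. set_integrable lebesgue (cylinder l R T) (\<lambda>z. \<bar>u z\<bar> powr p)"
    and weak: "radial_weak_form l \<mu> p \<epsilon> R f g u"
begin

lemma cone_integrable:
  assumes "0 \<le> a" "b \<le> T" "continuous_on (cylinder l R T) M"
  shows "set_integrable lebesgue (light_cone l R a b) (\<lambda>z. u z * M z)"
    and "set_integrable lebesgue (light_cone l R a b) (\<lambda>z. \<bar>u z\<bar> powr p * M z)"
    and "set_integrable lebesgue (light_cone l R a b :: ((real ^ 'n) \<times> real) set) M"
proof -
  note c = compact_cylinder assms(3) cone_subset_cylinder[OF l(1) assms(1,2)] cone_borel[OF l(1) assms(1)]
  show "set_integrable lebesgue (light_cone l R a b) (\<lambda>z. u z * M z)"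
    by (rule set_integrable_mult_continuous[OF int_u c])
  show "set_integrable lebesgue (light_cone l R a b) (\<lambda>z. \<bar>u z\<bar> powr p * M z)"
    by (rule set_integrable_mult_continuous[OF int_p c])
  have "set_integrable lebesgue (cylinder l R T :: ((real ^ 'n) \<times> real) set) (\<lambda>_. 1 :: real)"
    using lmeasurable_compact[OF compact_cylinder]
    by (simp add: set_integrable_def lmeasurable_iff_integrable)
  from set_integrable_mult_continuous[OF this c]
  show "set_integrable lebesgue (light_cone l R a b :: ((real ^ 'n) \<times> real) set) M" by simp
qed

text \<open>The test function is H(t/T) with the constant profile 1, so the Laplacian drops out; H
  vanishes near 0, so the data drop out too. Young's inequality absorbs half of the weighted
  integral of |u|^p. What remains is T^(-2q) times the volume of the cone up to 3T, which is of
  order T^(1 + n(l+1)).\<close>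

lemma cone_power_upper_bound:
  obtains C where "C > 0"
    "\<And>T. T \<ge> 1 \<Longrightarrow> (LINT z:light_cone l R T (2 * T)|lebesgue. \<bar>u z\<bar> powr p)
      \<le> C * T powr (1 + real CARD('n) * (l + 1) - 2 * (p / (p - 1)))"
proof -
  define q where "q = p / (p - 1)"
  obtain H C H1 H2 where H: "smooth_on UNIV H" "C > 0"
    "\<And>x. (H has_real_derivative H1 x) (at x)" "\<And>x. (H1 has_real_derivative H2 x) (at x)"
    "\<And>x. H x \<ge> 0" "\<And>x. 1 \<le> x \<Longrightarrow> x \<le> 2 \<Longrightarrow> H x = 1"
    "\<And>x. x \<le> 1/2 \<or> x \<ge> 3 \<Longrightarrow> H x = 0" "H1 0 = 0"
    "\<And>x. \<bar>H2 x\<bar> \<le> C * H x powr (1/p)" "\<And>x. H x \<le> C * H x powr (1/p)"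
    by (rule bump_power_exists[OF p]) (rule that)
  \<comment> \<open>Recovers smoothness of H'' from that of H by uniqueness of derivatives;
    continuity of the time factor rests on it.\<close>
  obtain H2' where H2': "\<And>x. (H1 has_real_derivative H2' x) (at x)" "smooth_on UNIV H2'"
  proof -
    obtain h where h: "\<And>x. (H has_real_derivative h x) (at x)" "smooth_on UNIV h"
      using smooth_on_UNIV_derivative[OF H(1)] by blast
    have "h = H1" using DERIV_unique[OF h(1) H(3)] by blast
    with h(2) that show thesis using smooth_on_UNIV_derivative by blast
  qed
  have "H2' = H2" using DERIV_unique[OF H2'(1) H(4)] by blast
  then have H2sm: "smooth_on UNIV H2" using H2'(2) by simp
  \<comment> \<open>The summand 4 mu^2 comes from the mass: where H does not vanish, t >= T/2 and
    hence mu^2/(1 + t)^2 <= 4 mu^2/T^2.\<close>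
  define C3 where "C3 = C * (1 + 4 * \<mu>\<^sup>2)"
  have C3: "C3 > 0" using H(2) by (simp add: C3_def add_pos_nonneg)
  \<comment> \<open>Chosen with delta^p = 1/2, so that half of the integral can be moved to the
    left.\<close>
  define \<delta> where "\<delta> = (1/2 :: real) powr (1/p)"
  have \<delta>: "\<delta> > 0" "\<delta> powr p = 1/2" using p by (auto simp: \<delta>_def powr_powr)
  define K where "K = \<delta> powr (- q) * C3 powr q"
  have K: "K > 0" using \<delta>(1) C3 by (simp add: K_def)
  define n where "n = CARD('n)"
  define V where "V = unit_ball_vol (real n)"
  have V: "V > 0" by (simp add: V_def)
  define C4 where "C4 = 1 + R + 4 / (l + 1)"
  have C4: "C4 > 0" using R l by (simp add: C4_def add_pos_pos)
  \<comment> \<open>The 2 undoes the absorbed half, and the 3 is the duration 3T of the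
    cylinder.\<close>
  define C5 where "C5 = 2 * K * (V * C4 ^ n * 3)"
  have C5: "C5 > 0" using K V C4 by (simp add: C5_def)
  show thesis
  proof (rule that[OF C5])
    fix T :: real assume T: "T \<ge> 1"
    define \<alpha> where "\<alpha> t = H (t / T)" for t
    define \<alpha>1 where "\<alpha>1 t = H1 (t / T) / T" for t
    define \<alpha>2 where "\<alpha>2 t = H2 (t / T) / T\<^sup>2" for t
    define W where "W = (wave_adjoint l \<mu> \<alpha> \<alpha>2 (\<lambda>_. 1) (\<lambda>_. 0) (\<lambda>_. 0) :: (real ^ 'n) \<times> real \<Rightarrow> real)"
    define D where "D = (light_cone l R 0 (3 * T) :: ((real ^ 'n) \<times> real) set)"
    have div: "smooth_on {0..} (\<lambda>t. t / T)"
      by (rule smooth_on_bounded_linear[OF fat_atLeast bounded_linear_divide])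
    have smlin: "smooth_on {0..} (\<lambda>t. h (t / T))" if "smooth_on UNIV h" for h
      by (rule smooth_on_compose[OF fat_atLeast fat_UNIV that div]) simp
    have sm\<alpha>: "smooth_on {0..} \<alpha>" unfolding \<alpha>_def[abs_def] by (rule smlin[OF H(1)])
    have c\<alpha>: "continuous_on {0..} \<alpha>" by (rule smooth_on_imp_continuous_on[OF sm\<alpha>])
    have c\<alpha>2: "continuous_on {0..} \<alpha>2"
      unfolding \<alpha>2_def[abs_def]
      by (intro continuous_on_divide smooth_on_imp_continuous_on[OF smlin[OF H2sm]]) (use T in auto)
    have "(LINT z:D|lebesgue. u z * W z) = (LINT z:D|lebesgue. \<bar>u z\<bar> powr p * radial \<alpha> (\<lambda>_. 1) z)
        + \<epsilon> * (LINT x|lebesgue. (g x * \<alpha> 0 - f x * \<alpha>1 0) * 1)"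
      unfolding D_def W_def
    proof (rule radial_weak_formD[OF weak _ sm\<alpha>])
      show "\<alpha> t = 0" if "t \<ge> 3 * T" for t
        unfolding \<alpha>_def using that T by (intro H(7)) (simp add: field_simps)
      have div: "((\<lambda>t. t / T) has_real_derivative 1 / T) (at t)" for t
        using T by (auto intro!: derivative_eq_intros)
      show "(\<alpha> has_real_derivative \<alpha>1 t) (at t within {0..})" for t
      proof -
        have "((\<lambda>t. H (t / T)) has_real_derivative H1 (t / T) * (1 / T)) (at t)"
          by (rule DERIV_chain2[OF H(3) div])
        then show ?thesis
          unfolding \<alpha>_def[abs_def] \<alpha>1_def by (simp add: has_field_derivative_at_within)
      qed
      show "(\<alpha>1 has_real_derivative \<alpha>2 t) (at t within {0..})" for t
      proof -
        have "((\<lambda>t. H1 (t / T)) has_real_derivative H2 (t / T) * (1 / T)) (at t)"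
          by (rule DERIV_chain2[OF H(4) div])
        from DERIV_cdivide[OF this, of T] show ?thesis
          unfolding \<alpha>1_def[abs_def] \<alpha>2_def
          by (simp add: has_field_derivative_at_within power2_eq_square)
      qed
    qed (use T in \<open>auto intro!: smooth_on_const fat_UNIV\<close>)
    also have "(LINT x|lebesgue. (g x * \<alpha> 0 - f x * \<alpha>1 0) * 1) = 0"
      by (simp add: \<alpha>_def \<alpha>1_def H(7,8))
    finally have id: "(LINT z:D|lebesgue. u z * W z) = (LINT z:D|lebesgue. \<bar>u z\<bar> powr p * radial \<alpha> (\<lambda>_. 1) z)"
      by simp
    have pt: "u z * W z \<le> 1/2 * (\<bar>u z\<bar> powr p * radial \<alpha> (\<lambda>_. 1) z) + K * T powr (- 2 * q)" if "z \<in> D" for z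
    proof -
      define t where "t = snd z"
      have t: "t \<ge> 0" using that by (simp add: D_def light_cone_def t_def)
      define h where "h = H (t / T) powr (1/p)"
      have W: "W z = H2 (t / T) / T\<^sup>2 + \<mu>\<^sup>2 / (1 + t)\<^sup>2 * H (t / T)"
        by (simp add: W_def wave_adjoint_def radial_def \<alpha>_def \<alpha>2_def t_def)
      have "\<mu>\<^sup>2 / (1 + t)\<^sup>2 * H (t / T) \<le> 4 * \<mu>\<^sup>2 / T\<^sup>2 * H (t / T)"
      proof (cases "t / T \<le> 1/2")
        case False
        then have "T / 2 \<le> 1 + t" using T by (simp add: field_simps)
        then have "(T / 2)\<^sup>2 \<le> (1 + t)\<^sup>2" using T by (intro power_mono) auto
        then have "\<mu>\<^sup>2 / (1 + t)\<^sup>2 \<le> \<mu>\<^sup>2 / (T / 2)\<^sup>2"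
          using T t by (intro divide_left_mono) auto
        then show ?thesis by (intro mult_right_mono H(5)) (simp add: power_divide mult.commute)
      qed (simp add: H(7))
      also have "\<dots> \<le> 4 * \<mu>\<^sup>2 / T\<^sup>2 * (C * h)"
        unfolding h_def by (intro mult_left_mono H(10)) auto
      finally have w2: "\<bar>\<mu>\<^sup>2 / (1 + t)\<^sup>2 * H (t / T)\<bar> \<le> 4 * \<mu>\<^sup>2 / T\<^sup>2 * (C * h)"
        using H(5)[of "t / T"] by simp
      have "\<bar>H2 (t / T) / T\<^sup>2\<bar> \<le> C * h / T\<^sup>2"
        using H(9)[of "t / T"] by (simp add: h_def divide_right_mono)
      with w2 have "\<bar>W z\<bar> \<le> C * h / T\<^sup>2 + 4 * \<mu>\<^sup>2 / T\<^sup>2 * (C * h)"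
        unfolding W by (intro order_trans[OF abs_triangle_ineq] add_mono)
      also have "\<dots> = h * (C3 / T\<^sup>2)" by (simp add: C3_def algebra_simps add_divide_distrib)
      finally have "\<bar>W z\<bar> \<le> h * (C3 / T\<^sup>2)" .
      then have "\<bar>u z\<bar> * \<bar>W z\<bar> \<le> \<bar>u z\<bar> * (h * (C3 / T\<^sup>2))" by (intro mult_left_mono) auto
      moreover have "u z * W z \<le> \<bar>u z\<bar> * \<bar>W z\<bar>" by (metis abs_ge_self abs_mult)
      ultimately have "u z * W z \<le> (\<bar>u z\<bar> * h) * (C3 / T\<^sup>2)" by (simp only: mult.assoc)
      also have "\<dots> \<le> \<delta> powr p * (\<bar>u z\<bar> * h) powr p + \<delta> powr (- q) * (C3 / T\<^sup>2) powr q"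
        using C3 T \<delta> by (intro young_scaled[OF p q_def]) (auto simp: h_def)
      also have "(\<bar>u z\<bar> * h) powr p = \<bar>u z\<bar> powr p * H (t / T)"
        using H(5)[of "t / T"] p by (simp add: h_def powr_mult powr_powr)
      also have "(C3 / T\<^sup>2) powr q = C3 powr q * T powr (- 2 * q)"
      proof -
        have "T\<^sup>2 = T powr 2" using T by (simp add: powr_numeral)
        then have "C3 / T\<^sup>2 = C3 * T powr (- 2)" using T by (simp add: powr_minus divide_inverse)
        then show ?thesis using C3 T by (simp add: powr_mult powr_powr)
      qed
      finally show ?thesis
        unfolding \<delta>(2) K_def by (simp add: radial_def \<alpha>_def t_def mult.assoc)
    qed
    have pos: "snd z \<ge> 0" if "z \<in> cylinder l R (3 * T)" for z :: "(real ^ 'n) \<times> real"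
      using that by (auto simp: cylinder_def)
    have iW: "set_integrable lebesgue D (\<lambda>z. u z * W z)"
      unfolding D_def W_def
      by (intro cone_integrable(1)[of 0 "3 * T" "3 * T"] continuous_on_wave_adjoint c\<alpha> c\<alpha>2
          continuous_on_const pos) auto
    have iP: "set_integrable lebesgue D (\<lambda>z. \<bar>u z\<bar> powr p * radial \<alpha> (\<lambda>_. 1) z)"
      unfolding D_def
      by (intro cone_integrable(2)[of 0 "3 * T" "3 * T"] continuous_on_radial c\<alpha> continuous_on_const pos) auto
    have iK: "set_integrable lebesgue D (\<lambda>_. K * T powr (- 2 * q))"
      unfolding D_def by (intro cone_integrable(3)[of 0 "3 * T" "3 * T"]) auto
    define X where "X = (LINT z:D|lebesgue. \<bar>u z\<bar> powr p * radial \<alpha> (\<lambda>_. 1) z)"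
    have "X \<le> (LINT z:D|lebesgue. 1/2 * (\<bar>u z\<bar> powr p * radial \<alpha> (\<lambda>_. 1) z) + K * T powr (- 2 * q))"
      unfolding X_def id[symmetric]
      by (intro set_integral_mono iW set_integral_add(1) iK set_integrable_mult_right iP pt) 
    also have "\<dots> = 1/2 * X + (LINT z:D|lebesgue. K * T powr (- 2 * q))"
      unfolding X_def using iP iK by (subst set_integral_add(2)) auto
    also have "(LINT z:D|lebesgue. K * T powr (- 2 * q)) = K * T powr (- 2 * q) * measure lebesgue D"
      by (simp add: set_lebesgue_integral_def)
    finally have X: "X \<le> 2 * K * T powr (- 2 * q) * measure lebesgue D" by simp
    have "measure lebesgue D \<le> measure lebesgue (cylinder l R (3 * T) :: ((real ^ 'n) \<times> real) set)"
      unfolding D_def using l cone_borel[OF l(1), of 0 R "3 * T"] lmeasurable_compact[OF compact_cylinder]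
      by (intro measure_mono_fmeasurable cone_subset_cylinder) auto
    also have "\<dots> = V * (R + A_int l (3 * T)) ^ n * (3 * T)"
      unfolding V_def n_def using T R A_int_nonneg[OF l(1), of "3 * T"] by (intro measure_cylinder) auto
    also have "\<dots> \<le> V * (C4 * T powr (l + 1)) ^ n * (3 * T)"
    proof (intro mult_right_mono mult_left_mono power_mono)
      show "R + A_int l (3 * T) \<le> C4 * T powr (l + 1)"
        using A_int_upper[OF l, of R "3 * T" T] R T by (simp add: C4_def)
    qed (use V T R A_int_nonneg[OF l(1), of "3 * T"] in auto)
    also have "\<dots> = V * C4 ^ n * 3 * (T powr (real n * (l + 1)) * T powr 1)"
      using T by (simp add: power_mult_distrib powr_power mult.commute)
    also have "T powr (real n * (l + 1)) * T powr 1 = T powr (1 + real n * (l + 1))"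
      by (simp only: powr_add mult.commute)
    finally have mD: "measure lebesgue D \<le> V * C4 ^ n * 3 * T powr (1 + real n * (l + 1))" .
    have "(LINT z:light_cone l R T (2 * T)|lebesgue. \<bar>u z\<bar> powr p) \<le> X"
      unfolding X_def set_lebesgue_integral_def
    proof (rule integral_mono')
      show "integrable lebesgue (\<lambda>z. indicator D z *\<^sub>R (\<bar>u z\<bar> powr p * radial \<alpha> (\<lambda>_. 1) z))"
        using iP by (simp add: set_integrable_def)
      fix z :: "(real ^ 'n) \<times> real"
      show "0 \<le> indicator D z *\<^sub>R (\<bar>u z\<bar> powr p * radial \<alpha> (\<lambda>_. 1) z)"
        by (simp add: radial_def \<alpha>_def H(5))
      show "indicator (light_cone l R T (2 * T)) z *\<^sub>R \<bar>u z\<bar> powr p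
          \<le> indicator D z *\<^sub>R (\<bar>u z\<bar> powr p * radial \<alpha> (\<lambda>_. 1) z)"
      proof (cases "z \<in> light_cone l R T (2 * T)")
        case True
        then have "z \<in> D" using T cone_mono[of 0 T "2 * T" "3 * T" l R] by (auto simp: D_def)
        moreover have "\<alpha> (snd z) = 1"
          unfolding \<alpha>_def using True T by (intro H(6)) (auto simp: light_cone_def field_simps)
        ultimately show ?thesis using True by (simp add: radial_def)
      qed (simp add: radial_def \<alpha>_def H(5))
    qed
    also note X
    also have "2 * K * T powr (- 2 * q) * measure lebesgue D
        \<le> 2 * K * T powr (- 2 * q) * (V * C4 ^ n * 3 * T powr (1 + real n * (l + 1)))"
      using K by (intro mult_left_mono mD) auto
    also have "\<dots> = C5 * (T powr (1 + real n * (l + 1)) * T powr (- 2 * q))" by (simp add: C5_def)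
    also have "T powr (1 + real n * (l + 1)) * T powr (- 2 * q) = T powr (1 + real n * (l + 1) - 2 * q)"
      by (simp add: powr_add[symmetric])
    finally show "(LINT z:light_cone l R T (2 * T)|lebesgue. \<bar>u z\<bar> powr p)
      \<le> C5 * T powr (1 + real CARD('n) * (l + 1) - 2 * (p / (p - 1)))"
      by (simp only: n_def q_def)
  qed
qed

text \<open>Until time T the test function solves the adjoint equation exactly, so the data term is
  paid for by the window from T to 2T. There the commutator with the cut-off has size T^(l/2 - 1)
  times the decaying exponential, and Young's inequality with free weight \<open>\<delta>\<close>
  separates it from u.\<close>

lemma cone_power_lower_bound:
  assumes \<mu>: "\<mu>\<^sup>2 > 1/4" and \<epsilon>: "\<epsilon> > 0"
    and f: "test_function_on UNIV f" "\<And>x. f x \<ge> 0" and g: "test_function_on UNIV g" "\<And>x. g x \<ge> 0"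
    and nz: "\<not> ((\<forall>x. f x = 0) \<and> (\<forall>x. g x = 0))"
  defines "q \<equiv> p / (p - 1)"
  obtains c C where "c > 0" "C > 0"
    "\<And>T \<delta>. T \<ge> 1 \<Longrightarrow> \<delta> > 0 \<Longrightarrow> c \<le> \<delta> powr p * (LINT z:light_cone l R T (2 * T)|lebesgue. \<bar>u z\<bar> powr p)
      + \<delta> powr (- q) * (C * T powr (1 + q * (l/2 - 1) + (l + 1) * (real CARD('n) - 1) * (1 - q/2)))"
proof -
  define n where "n = CARD('n)"
  have n: "n \<ge> 1" by (simp add: n_def Suc_leI)
  have q: "q > 1" using p by (simp add: q_def)
  obtain \<kappa> Cb b b1 where b: "\<kappa> > 0" "Cb > 0" "smooth_on {0..} b"
    "\<And>t. t \<ge> 0 \<Longrightarrow> (b has_real_derivative b1 t) (at t within {0..})"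
    "\<And>t. t \<ge> 0 \<Longrightarrow>
      (b1 has_real_derivative (\<kappa>\<^sup>2 * (1 + t) powr (2 * l) - \<mu>\<^sup>2 / (1 + t)\<^sup>2) * b t) (at t within {0..})"
    "\<And>t. t \<ge> 0 \<Longrightarrow> b t > 0" "b1 0 < 0"
    "\<And>t. t \<ge> 0 \<Longrightarrow> b t \<le> Cb * (1 + t) powr (- l / 2) * exp (- \<kappa> * A_int l t)"
    "\<And>t. t \<ge> 0 \<Longrightarrow> \<bar>b1 t\<bar> \<le> Cb * (1 + t) powr (l / 2) * exp (- \<kappa> * A_int l t)"
    by (rule time_factor_exists[OF \<mu> l]) (rule that)
  obtain \<eta> C\<eta> \<eta>1 \<eta>2 where \<eta>: "smooth_on UNIV \<eta>" "(C\<eta>::real) > 0"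
    "\<And>x. (\<eta> has_real_derivative \<eta>1 x) (at x)" "\<And>x. (\<eta>1 has_real_derivative \<eta>2 x) (at x)"
    "\<And>x. \<eta> x \<ge> 0" "\<And>x. x \<le> 1 \<Longrightarrow> \<eta> x = 1" "\<And>x. x \<ge> 2 \<Longrightarrow> \<eta> x = 0"
    "\<And>x. x < 1 \<Longrightarrow> \<eta>1 x = 0" "\<And>x. x < 1 \<Longrightarrow> \<eta>2 x = 0"
    "\<And>x. x \<in> {1..2} \<Longrightarrow> \<bar>\<eta>1 x\<bar> \<le> C\<eta>" "\<And>x. x \<in> {1..2} \<Longrightarrow> \<bar>\<eta>2 x\<bar> \<le> C\<eta>"
    by (rule cutoff_exists) (rule that)
  define \<psi> where "\<psi> j = eig n \<kappa> j" for j
  obtain Ce where Ce: "Ce > 0"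
    "\<And>r. r \<ge> 0 \<Longrightarrow> eig n \<kappa> 0 (r\<^sup>2) \<le> Ce * (1 + r) powr (- (real n - 1) / 2) * exp (\<kappa> * r)"
    by (rule eig_growth[OF n b(1)]) (rule that)
  define a where "a = \<kappa> * q"
  define \<gamma> where "\<gamma> = (- (real n - 1) / 2) * q"
  have a: "a > 0" using b(1) q by (simp add: a_def)
  obtain Cr where Cr: "Cr > 0"
    "\<And>r. r \<ge> 0 \<Longrightarrow> (LINT x:ball (0::real^'n) r|lebesgue. (1 + norm x) powr \<gamma> * exp (a * norm x))
      \<le> Cr * (1 + r) powr (\<gamma> + real DIM(real^'n) - 1) * exp (a * r)"
    by (rule integral_powr_exp_norm_ball[OF a, where 'a="real^'n" and \<gamma>=\<gamma>]) (rule that)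
  \<comment> \<open>Equals (n - 1) (1 - q/2): the decay of v raised to the power q against the
    surface measure of a sphere.\<close>
  define \<theta> where "\<theta> = \<gamma> + real n - 1"
  define C4 where "C4 = 1 + R + 4 / (l + 1)"
  have C4: "C4 \<ge> 1" using R l by (simp add: C4_def)
  \<comment> \<open>The factor exp(a R) is what remains when exp(a (R + A(t))) meets exp(-a
    A(t)).\<close>
  define C5 where "C5 = Cr * exp (a * R) * C4 powr \<bar>\<theta>\<bar>"
  \<comment> \<open>The 9 is 3 (2 + 1): 3 from (1 + t)^s <= 3 T^s on the window for |s| <= 1, then 2
    for the term 2 b' eta' and 1 for b eta''.\<close>
  define B where "B = Ce * (9 * Cb * C\<eta>)"
  have B: "B > 0" using Ce b \<eta> by (simp add: B_def)
  define I0 where "I0 = (LINT x|lebesgue. (g x * b 0 - f x * b1 0) * \<psi> 0 (x \<bullet> x))"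
  have I0: "I0 > 0"
    unfolding I0_def
    by (rule initial_data_integral_pos[OF f g nz b(6,7)])
      (auto simp: \<psi>_def intro: smooth_on_imp_continuous_on smooth_on_eig n less_le_trans[OF zero_less_one eig_0_ge_1])
  show thesis
  proof (rule that[of "\<epsilon> * I0" "B powr q * C5"])
    show "\<epsilon> * I0 > 0" using \<epsilon> I0 by simp
    show "B powr q * C5 > 0" using B Cr C4 by (simp add: C5_def)
    fix T \<delta> :: real assume T: "T \<ge> 1" and \<delta>: "\<delta> > 0"
    \<comment> \<open>The terms of (b eta(t/T))'' in which at least one derivative falls on the
      cut-off.\<close>
    define G where "G t = 2 * b1 t * (\<eta>1 (t / T) / T) + b t * (\<eta>2 (t / T) / T\<^sup>2)" for t
    define \<alpha> where "\<alpha> t = b t * \<eta> (t / T)" for t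
    define \<alpha>1 where "\<alpha>1 t = b1 t * \<eta> (t / T) + \<eta>1 (t / T) / T * b t" for t
    define \<alpha>2 where "\<alpha>2 t = (\<kappa>\<^sup>2 * (1 + t) powr (2 * l) - \<mu>\<^sup>2 / (1 + t)\<^sup>2) * b t * \<eta> (t / T) + G t" for t
    define D where "D = (light_cone l R 0 (2 * T) :: ((real ^ 'n) \<times> real) set)"
    define E where "E = (light_cone l R T (2 * T) :: ((real ^ 'n) \<times> real) set)"
    define W where "W = (wave_adjoint l \<mu> \<alpha> \<alpha>2 (\<psi> 0) (\<psi> 1) (\<psi> 2) :: (real ^ 'n) \<times> real \<Rightarrow> real)"
    have D\<psi>: "(\<psi> 0 has_real_derivative \<psi> 1 r) (at r)" "(\<psi> 1 has_real_derivative \<psi> 2 r) (at r)" for r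
      unfolding \<psi>_def using eig_has_derivative[OF n, of \<kappa> 0 r] eig_has_derivative[OF n, of \<kappa> 1 r]
      by (simp_all add: numeral_2_eq_2)
    have sm\<psi>: "smooth_on UNIV (\<psi> j)" for j unfolding \<psi>_def by (rule smooth_on_eig[OF n])
    have div: "smooth_on {0..} (\<lambda>t. t / T)"
      by (rule smooth_on_bounded_linear[OF fat_atLeast bounded_linear_divide])
    have "smooth_on {0..} (\<lambda>t. \<eta> (t / T))"
      by (rule smooth_on_compose[OF fat_atLeast fat_UNIV \<eta>(1) div]) simp
    from smooth_on_mult[OF fat_atLeast b(3) this]
    have sm\<alpha>: "smooth_on {0..} \<alpha>" unfolding \<alpha>_def[abs_def] .
    have div': "((\<lambda>t. t / T) has_real_derivative 1 / T) (at t within {0..})" for t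
      using T by (auto intro!: derivative_eq_intros)
    have D\<eta>: "((\<lambda>t. \<eta> (t / T)) has_real_derivative \<eta>1 (t / T) / T) (at t within {0..})"
      "((\<lambda>t. \<eta>1 (t / T)) has_real_derivative \<eta>2 (t / T) / T) (at t within {0..})" for t
      using DERIV_chain2[OF \<eta>(3)[of "t / T"] div'[of t]] DERIV_chain2[OF \<eta>(4)[of "t / T"] div'[of t]]
      by simp_all
    have D\<alpha>: "(\<alpha> has_real_derivative \<alpha>1 t) (at t within {0..})" if "t \<ge> 0" for t
      unfolding \<alpha>_def[abs_def] \<alpha>1_def by (rule DERIV_mult[OF b(4)[OF that] D\<eta>(1)])
    have D\<alpha>1: "(\<alpha>1 has_real_derivative \<alpha>2 t) (at t within {0..})" if "t \<ge> 0" for t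
      unfolding \<alpha>1_def[abs_def]
      by (rule DERIV_cong[OF DERIV_add[OF DERIV_mult[OF b(5)[OF that] D\<eta>(1)]
              DERIV_mult[OF DERIV_cdivide[OF D\<eta>(2)] b(4)[OF that]]]])
        (simp add: \<alpha>2_def G_def power2_eq_square mult_ac)
    have sm\<alpha>1: "smooth_on {0..} \<alpha>1" by (rule smooth_on_derivative[OF fat_atLeast _ sm\<alpha>]) (simp add: D\<alpha>)
    have sm\<alpha>2: "smooth_on {0..} \<alpha>2" by (rule smooth_on_derivative[OF fat_atLeast _ sm\<alpha>1]) (simp add: D\<alpha>1)
    have "(LINT z:D|lebesgue. u z * W z) = (LINT z:D|lebesgue. \<bar>u z\<bar> powr p * radial \<alpha> (\<psi> 0) z)
        + \<epsilon> * (LINT x|lebesgue. (g x * \<alpha> 0 - f x * \<alpha>1 0) * \<psi> 0 (x \<bullet> x))"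
      unfolding D_def W_def
    proof (rule radial_weak_formD[OF weak _ sm\<alpha> _ D\<alpha> D\<alpha>1 sm\<psi> D\<psi>])
      show "\<alpha> t = 0" if "t \<ge> 2 * T" for t
        using \<eta>(7)[of "t / T"] that T by (simp add: \<alpha>_def field_simps)
    qed (use T in auto)
    also have "(LINT x|lebesgue. (g x * \<alpha> 0 - f x * \<alpha>1 0) * \<psi> 0 (x \<bullet> x)) = I0"
      by (simp add: I0_def \<alpha>_def \<alpha>1_def \<eta>(6,8))
    finally have id: "(LINT z:D|lebesgue. u z * W z)
        = (LINT z:D|lebesgue. \<bar>u z\<bar> powr p * radial \<alpha> (\<psi> 0) z) + \<epsilon> * I0" .
    have "(LINT z:D|lebesgue. \<bar>u z\<bar> powr p * radial \<alpha> (\<psi> 0) z) \<ge> 0"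
      unfolding set_lebesgue_integral_def
    proof (rule Bochner_Integration.integral_nonneg)
      fix z :: "(real ^ 'n) \<times> real"
      have "0 \<le> radial \<alpha> (\<psi> 0) z" if "z \<in> D"
      proof -
        have "b (snd z) > 0" using that by (intro b(6)) (simp add: D_def light_cone_def)
        moreover have "\<psi> 0 (fst z \<bullet> fst z) \<ge> 0" unfolding \<psi>_def by (rule eig_nonneg[OF n]) simp
        ultimately show ?thesis using \<eta>(5) by (simp add: radial_def \<alpha>_def)
      qed
      then show "0 \<le> indicator D z *\<^sub>R (\<bar>u z\<bar> powr p * radial \<alpha> (\<psi> 0) z)" by (auto simp: indicator_def)
    qed
    with id have le1: "\<epsilon> * I0 \<le> (LINT z:D|lebesgue. u z * W z)" by simp
    \<comment> \<open>The eigenvalue equation of the profile cancels the part of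
      \<open>\<alpha>2\<close> where the cut-off is not differentiated, mass included.\<close>
    have W: "W z = \<psi> 0 (fst z \<bullet> fst z) * G (snd z)" for z
    proof -
      define r where "r = fst z \<bullet> fst z"
      have ode: "4 * r * \<psi> 2 r + 2 * real CARD('n) * \<psi> 1 r = \<kappa>\<^sup>2 * \<psi> 0 r"
        unfolding \<psi>_def using eig_ode[OF n, of r \<kappa>] by (simp add: n_def)
      show ?thesis
        unfolding W_def wave_adjoint_def radial_def r_def[symmetric] ode
        by (simp add: \<alpha>_def \<alpha>2_def algebra_simps)
    qed
    define M where "M z = (1 + norm (fst z)) powr \<gamma> * exp (a * norm (fst z)) * exp (- a * A_int l (snd z))"
      for z :: "(real ^ 'n) \<times> real"
    have Gbound: "\<bar>G t\<bar> \<le> 9 * Cb * C\<eta> * T powr (l/2 - 1) * exp (- \<kappa> * A_int l t)" if t: "T \<le> t" "t \<le> 2 * T" for t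
    proof -
      define e where "e = exp (- \<kappa> * A_int l t)"
      have e0: "e > 0" by (simp add: e_def)
      have tT: "t / T \<in> {1..2}" using t T by (simp add: field_simps)
      have three: "3 powr \<bar>s\<bar> \<le> (3::real)" if "\<bar>s\<bar> \<le> 1" for s :: real
        using powr_mono[of "\<bar>s\<bar>" 1 "3::real"] that by simp
      have pw: "(1 + t) powr s \<le> 3 * T powr s" if "\<bar>s\<bar> \<le> 1" for s
      proof -
        have "(1 + t) powr s \<le> 3 powr \<bar>s\<bar> * T powr s" using t T by (intro powr_comparable) auto
        also have "\<dots> \<le> 3 * T powr s" using three[OF that] by (intro mult_right_mono) auto
        finally show ?thesis .
      qed
      have "\<bar>b1 t\<bar> \<le> Cb * (1 + t) powr (l/2) * e" unfolding e_def using t T by (intro b(9)) auto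
      also have "\<dots> \<le> Cb * (3 * T powr (l/2)) * e"
        using b(2) e0 l by (intro mult_right_mono mult_left_mono pw) auto
      finally have b1: "\<bar>b1 t\<bar> \<le> Cb * (3 * T powr (l/2)) * e" .
      have "b t \<le> Cb * (1 + t) powr (- l/2) * e" unfolding e_def using t T by (intro b(8)) auto
      also have "\<dots> \<le> Cb * (3 * T powr (- l/2)) * e"
        using b(2) e0 l by (intro mult_right_mono mult_left_mono pw) auto
      finally have bb: "\<bar>b t\<bar> \<le> Cb * (3 * T powr (- l/2)) * e" using b(6)[of t] t T by simp
      have h1: "\<bar>\<eta>1 (t / T) / T\<bar> \<le> C\<eta> / T" "\<bar>\<eta>2 (t / T) / T\<^sup>2\<bar> \<le> C\<eta> / T\<^sup>2"
        using \<eta>(10)[OF tT] \<eta>(11)[OF tT] T by (auto simp: divide_right_mono)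
      have "\<bar>2 * b1 t * (\<eta>1 (t / T) / T)\<bar> \<le> 2 * (Cb * (3 * T powr (l/2)) * e) * (C\<eta> / T)"
        unfolding abs_mult using b1 h1 b(2) e0 by (intro mult_mono) auto
      also have "\<dots> = 6 * Cb * C\<eta> * (T powr (l/2) / T) * e" by simp
      also have "T powr (l/2) / T = T powr (l/2 - 1)" using T by (simp add: powr_diff)
      finally have t1: "\<bar>2 * b1 t * (\<eta>1 (t / T) / T)\<bar> \<le> 6 * Cb * C\<eta> * T powr (l/2 - 1) * e" .
      have "\<bar>b t * (\<eta>2 (t / T) / T\<^sup>2)\<bar> \<le> (Cb * (3 * T powr (- l/2)) * e) * (C\<eta> / T\<^sup>2)"
        unfolding abs_mult using bb h1 b(2) e0 by (intro mult_mono) auto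
      also have "\<dots> = 3 * Cb * C\<eta> * (T powr (- l/2) / T\<^sup>2) * e" by simp
      also have "T powr (- l/2) / T\<^sup>2 = T powr (- l/2 - 2)" using T by (simp add: powr_diff)
      \<comment> \<open>Here l > -1 enters: -l/2 - 2 <= l/2 - 1, so the term with eta'' is the
        smaller one.\<close>
      also have "3 * Cb * C\<eta> * T powr (- l/2 - 2) * e \<le> 3 * Cb * C\<eta> * T powr (l/2 - 1) * e"
        using l T b(2) \<eta>(2) e0 by (intro mult_right_mono mult_left_mono powr_mono) auto
      finally have t2: "\<bar>b t * (\<eta>2 (t / T) / T\<^sup>2)\<bar> \<le> 3 * Cb * C\<eta> * T powr (l/2 - 1) * e" .
      have "\<bar>G t\<bar> \<le> 6 * Cb * C\<eta> * T powr (l/2 - 1) * e + 3 * Cb * C\<eta> * T powr (l/2 - 1) * e"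
        unfolding G_def using t1 t2 by (intro order_trans[OF abs_triangle_ineq] add_mono)
      also have "\<dots> = 9 * Cb * C\<eta> * T powr (l/2 - 1) * e" by simp
      finally show ?thesis unfolding e_def .
    qed
    define \<Lambda> where "\<Lambda> = B * T powr (l/2 - 1)"
    have \<Lambda>: "\<Lambda> > 0" using B T by (simp add: \<Lambda>_def)
    have pt: "u z * W z \<le> \<delta> powr p * \<bar>u z\<bar> powr p + \<delta> powr (- q) * (\<Lambda> powr q * M z)" if z: "z \<in> E" for z
    proof -
      define \<rho> where "\<rho> = norm (fst z)"
      define t where "t = snd z"
      have t: "T \<le> t" "t \<le> 2 * T" using z by (auto simp: E_def light_cone_def t_def)
      define y where "y = \<Lambda> * ((1 + \<rho>) powr (- (real n - 1) / 2) * exp (\<kappa> * \<rho>) * exp (- \<kappa> * A_int l t))"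
      have \<rho>: "\<rho> \<ge> 0" by (simp add: \<rho>_def)
      have "\<psi> 0 (fst z \<bullet> fst z) = \<psi> 0 (\<rho>\<^sup>2)" by (simp add: \<rho>_def dot_square_norm)
      moreover have "\<psi> 0 (\<rho>\<^sup>2) \<ge> 0" unfolding \<psi>_def by (rule eig_nonneg[OF n]) simp
      ultimately have "\<bar>W z\<bar> = \<psi> 0 (\<rho>\<^sup>2) * \<bar>G t\<bar>" by (simp add: W abs_mult t_def)
      also have "\<dots> \<le> (Ce * (1 + \<rho>) powr (- (real n - 1) / 2) * exp (\<kappa> * \<rho>))
          * (9 * Cb * C\<eta> * T powr (l/2 - 1) * exp (- \<kappa> * A_int l t))"
        using Ce(1) by (intro mult_mono Ce(2)[OF \<rho>, folded \<psi>_def] Gbound t) auto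
      also have "\<dots> = y" by (simp add: y_def \<Lambda>_def B_def)
      finally have "\<bar>W z\<bar> \<le> y" .
      then have "\<bar>u z\<bar> * \<bar>W z\<bar> \<le> \<bar>u z\<bar> * y" by (intro mult_left_mono) auto
      moreover have "u z * W z \<le> \<bar>u z\<bar> * \<bar>W z\<bar>" by (metis abs_ge_self abs_mult)
      ultimately have "u z * W z \<le> \<bar>u z\<bar> * y" by simp
      also have "\<dots> \<le> \<delta> powr p * \<bar>u z\<bar> powr p + \<delta> powr (- q) * y powr q"
        using \<Lambda> \<delta> by (intro young_scaled[OF p q_def[THEN meta_eq_to_obj_eq]]) (auto simp: y_def)
      also have "y powr q = \<Lambda> powr q * M z"
      proof -
        have ex: "exp s powr q = exp (q * s)" for s by (simp add: powr_def)
        show ?thesis using \<Lambda> \<rho>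
          unfolding y_def M_def \<rho>_def[symmetric] t_def[symmetric]
          by (simp add: powr_mult powr_powr ex \<gamma>_def a_def mult_ac)
      qed
      finally show ?thesis .
    qed
    \<comment> \<open>Before time T both derivatives of the cut-off vanish, so the integral over the
      whole cone reduces to the window.\<close>
    have W0: "W z = 0" if "z \<in> D - E" for z
    proof -
      have "snd z / T < 1" using that T by (auto simp: D_def E_def light_cone_def)
      then show ?thesis unfolding W G_def by (simp add: \<eta>(8,9))
    qed
    have pos: "snd z \<ge> 0" if "z \<in> cylinder l R (2 * T)" for z :: "(real ^ 'n) \<times> real"
      using that by (auto simp: cylinder_def)
    have cM: "continuous_on (cylinder l R (2 * T)) M"
      unfolding M_def[abs_def]
      by (intro continuous_intros continuous_on_compose2[OF continuous_on_A_int[OF l(1)]])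
        (auto simp: cylinder_def add_nonneg_eq_0_iff)
    have iW: "set_integrable lebesgue D (\<lambda>z. u z * W z)"
      unfolding D_def W_def
      by (intro cone_integrable(1)[of 0 "2 * T" "2 * T"] continuous_on_wave_adjoint
          smooth_on_imp_continuous_on sm\<alpha> sm\<alpha>2 sm\<psi> pos) auto
    have iM: "set_integrable lebesgue E M"
      unfolding E_def using T by (intro cone_integrable(3)[of T "2 * T" "2 * T"] cM) auto
    have iP: "set_integrable lebesgue E (\<lambda>z. \<bar>u z\<bar> powr p)"
      unfolding E_def using T cone_integrable(2)[of T "2 * T" "2 * T" "\<lambda>_. 1"] by simp
    have iR: "set_integrable lebesgue E (\<lambda>z. \<delta> powr p * \<bar>u z\<bar> powr p + \<delta> powr (- q) * (\<Lambda> powr q * M z))"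
      by (intro set_integral_add(1) set_integrable_mult_right iP iM)
    have "(LINT z:D|lebesgue. u z * W z)
        \<le> (LINT z:E|lebesgue. \<delta> powr p * \<bar>u z\<bar> powr p + \<delta> powr (- q) * (\<Lambda> powr q * M z))"
      unfolding set_lebesgue_integral_def
    proof (rule integral_mono)
      show "integrable lebesgue (\<lambda>z. indicator D z *\<^sub>R (u z * W z))"
        using iW by (simp add: set_integrable_def)
      show "integrable lebesgue (\<lambda>z. indicator E z *\<^sub>R (\<delta> powr p * \<bar>u z\<bar> powr p + \<delta> powr (- q) * (\<Lambda> powr q * M z)))"
        using iR by (simp add: set_integrable_def)
      fix z :: "(real ^ 'n) \<times> real"
      have "E \<subseteq> D" unfolding D_def E_def using T by (intro cone_mono) auto
      then show "indicator D z *\<^sub>R (u z * W z)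
          \<le> indicator E z *\<^sub>R (\<delta> powr p * \<bar>u z\<bar> powr p + \<delta> powr (- q) * (\<Lambda> powr q * M z))"
        using W0[of z] pt[of z] by (auto simp: indicator_def)
    qed
    also have "\<dots> = \<delta> powr p * (LINT z:E|lebesgue. \<bar>u z\<bar> powr p)
        + \<delta> powr (- q) * (\<Lambda> powr q * (LINT z:E|lebesgue. M z))"
      using iP iM by (subst set_integral_add(2)) auto
    finally have le2: "\<epsilon> * I0 \<le> \<delta> powr p * (LINT z:E|lebesgue. \<bar>u z\<bar> powr p)
        + \<delta> powr (- q) * (\<Lambda> powr q * (LINT z:E|lebesgue. M z))" using le1 by simp
    have intM: "(LINT z:E|lebesgue. M z) \<le> C5 * T powr ((l + 1) * \<theta>) * T"
    proof -
      define F where "F z = indicator E z *\<^sub>R M z" for z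
      have F: "integrable lebesgue F" using iM by (simp add: F_def[abs_def] set_integrable_def)
      define K where "K = C5 * T powr ((l + 1) * \<theta>)"
      have K: "K \<ge> 0" using Cr C4 by (simp add: K_def C5_def)
      have inner: "(LINT x|lebesgue. F (x, t)) \<le> indicator {T..2 * T} t * K" for t
      proof (cases "t \<in> {T..2 * T}")
        case False
        then have "F (x, t) = 0" for x by (auto simp: F_def E_def light_cone_def)
        with False show ?thesis by simp
      next
        case True
        define r where "r = R + A_int l t"
        have A0: "A_int l t \<ge> 0" using True T by (intro A_int_nonneg l) auto
        have r: "r \<ge> 0" using R A0 by (simp add: r_def)
        have "F (x, t) = exp (- a * A_int l t) * (indicator (ball 0 r) x *\<^sub>R ((1 + norm x) powr \<gamma> * exp (a * norm x)))" for x
          using True by (auto simp: F_def E_def light_cone_def M_def r_def indicator_def)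
        then have "(LINT x|lebesgue. F (x, t))
            = exp (- a * A_int l t) * (LINT x:ball (0::real^'n) r|lebesgue. (1 + norm x) powr \<gamma> * exp (a * norm x))"
          by (simp only: set_lebesgue_integral_def Bochner_Integration.integral_mult_right_zero)
        also have "\<dots> \<le> exp (- a * A_int l t) * (Cr * (1 + r) powr (\<gamma> + real DIM(real^'n) - 1) * exp (a * r))"
          by (intro mult_left_mono Cr(2) r) auto
        also have "\<dots> = Cr * (1 + r) powr \<theta> * (exp (- a * A_int l t) * exp (a * r))"
          by (simp add: \<theta>_def n_def)
        \<comment> \<open>The growth of v at the edge of the cone and the decay of b cancel, leaving
          a constant.\<close>
        also have "exp (- a * A_int l t) * exp (a * r) = exp (a * R)"
          by (simp add: mult_exp_exp r_def algebra_simps)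
        also have "Cr * (1 + r) powr \<theta> * exp (a * R) \<le> Cr * (C4 powr \<bar>\<theta>\<bar> * (T powr (l + 1)) powr \<theta>) * exp (a * R)"
        proof (intro mult_right_mono mult_left_mono powr_comparable)
          show "T powr (l + 1) \<le> 1 + r"
            using A_int_lower[OF l, of R T t] R T True by (simp add: r_def)
          show "1 + r \<le> C4 * T powr (l + 1)"
            using A_int_upper[OF l, of R t T] R T True by (simp add: r_def C4_def)
        qed (use T C4 Cr in auto)
        also have "\<dots> = K" by (simp add: K_def C5_def powr_powr)
        finally show ?thesis using True by simp
      qed
      have "(LINT z:E|lebesgue. M z) = (LINT t|lebesgue. LINT x|lebesgue. F (x, t))"
        using lebesgue_fubini(2)[OF F] by (simp add: F_def set_lebesgue_integral_def)
      also have "\<dots> \<le> (LINT t|lebesgue. indicator {T..2 * T} t * K)"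
        using lmeasurable_compact[OF compact_Icc, of T "2 * T"]
        by (intro integral_mono lebesgue_fubini(1)[OF F] inner integrable_mult_left)
          (simp only: lmeasurable_iff_integrable)
      also have "\<dots> = T * K" using T by simp
      finally show ?thesis by (simp add: K_def mult.commute)
    qed
    have "\<Lambda> powr q * (LINT z:E|lebesgue. M z) \<le> \<Lambda> powr q * (C5 * T powr ((l + 1) * \<theta>) * T)"
      by (intro mult_left_mono intM) auto
    also have "\<dots> = B powr q * C5 * (T powr (q * (l/2 - 1)) * T powr ((l + 1) * \<theta>) * T powr 1)"
      using T B by (simp add: \<Lambda>_def powr_mult powr_powr mult_ac)
    also have "T powr (q * (l/2 - 1)) * T powr ((l + 1) * \<theta>) * T powr 1
        = T powr (q * (l/2 - 1) + (l + 1) * \<theta> + 1)"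
      by (simp only: powr_add)
    also have "q * (l/2 - 1) + (l + 1) * \<theta> + 1
        = 1 + q * (l/2 - 1) + (l + 1) * (real CARD('n) - 1) * (1 - q/2)"
      by (simp add: \<theta>_def \<gamma>_def n_def algebra_simps add_divide_distrib diff_divide_distrib)
    finally have "\<delta> powr (- q) * (\<Lambda> powr q * (LINT z:E|lebesgue. M z))
      \<le> \<delta> powr (- q) * (B powr q * C5 * T powr (1 + q * (l/2 - 1) + (l + 1) * (real CARD('n) - 1) * (1 - q/2)))"
      by (intro mult_left_mono) auto
    with le2 show "\<epsilon> * I0 \<le> \<delta> powr p * (LINT z:light_cone l R T (2 * T)|lebesgue. \<bar>u z\<bar> powr p)
      + \<delta> powr (- q) * (B powr q * C5 * T powr (1 + q * (l/2 - 1) + (l + 1) * (real CARD('n) - 1) * (1 - q/2)))"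
      unfolding E_def by linarith
  qed
qed

end

section \<open>Contradiction between the two bounds for large T\<close>

theorem corollary4:
  fixes \<mu> l p \<epsilon> :: real and f g :: "real ^ 'n \<Rightarrow> real"
  assumes "\<mu>\<^sup>2 > 1 / 4"
    and "-1 < l" and "l < 0"
    and "(l \<le> -1 + 1 / real CARD('n) \<and> p > 1) \<or>
         (-1 + 1 / real CARD('n) < l \<and> 1 < p \<and> p < p_Str CARD('n) l)"
    and "test_function_on UNIV f" and "test_function_on UNIV g"
    and "\<forall>x. f x \<ge> 0" and "\<forall>x. g x \<ge> 0"
    and "\<not> ((\<forall>x. f x = 0) \<and> (\<forall>x. g x = 0))"
    and "\<epsilon> > 0"
  shows "\<not> (\<exists>u. weak_solution l \<mu> p \<epsilon> f g \<infinity> u)"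
proof
  assume "\<exists>u. weak_solution l \<mu> p \<epsilon> f g \<infinity> u"
  then obtain u where ws: "weak_solution l \<mu> p \<epsilon> f g \<infinity> u" by blast
  have p: "p > 1" using assms(4) by blast
  have fpos: "f x \<ge> 0" and gpos: "g x \<ge> 0" for x using assms(7,8) by auto
  obtain R where R: "R > 0"
    and int: "\<And>T. set_integrable lebesgue (cylinder l R T) u"
      "\<And>T. set_integrable lebesgue (cylinder l R T) (\<lambda>z. \<bar>u z\<bar> powr p)"
    and weak: "radial_weak_form l \<mu> p \<epsilon> R f g u"
    by (rule weak_solution_radial[OF ws p assms(2,5,6)]) (rule that)
  define q where "q = p / (p - 1)"
  define y where "y = 1 + real CARD('n) * (l + 1) - 2 * q"
  define \<omega> where "\<omega> = 1 + q * (l/2 - 1) + (l + 1) * (real CARD('n) - 1) * (1 - q/2)"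
  define Y where "Y T = (LINT z:light_cone l R T (2 * T)|lebesgue. \<bar>u z\<bar> powr p)" for T
  obtain C1 where C1: "C1 > 0"
    "\<And>T. T \<ge> 1 \<Longrightarrow> (LINT z:light_cone l R T (2 * T)|lebesgue. \<bar>u z\<bar> powr p)
      \<le> C1 * T powr (1 + real CARD('n) * (l + 1) - 2 * (p / (p - 1)))"
    by (rule cone_power_upper_bound[OF assms(2,3) p R int weak]) (rule that)
  note C1 = C1[folded q_def, folded Y_def y_def]
  obtain c C2 where c: "c > 0" and C2: "C2 > 0"
    "\<And>T \<delta>. T \<ge> 1 \<Longrightarrow> \<delta> > 0 \<Longrightarrow> c \<le> \<delta> powr p * (LINT z:light_cone l R T (2 * T)|lebesgue. \<bar>u z\<bar> powr p)
      + \<delta> powr (- (p / (p - 1))) * (C2 * T powr (1 + p / (p - 1) * (l/2 - 1)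
        + (l + 1) * (real CARD('n) - 1) * (1 - p / (p - 1) / 2)))"
    by (rule cone_power_lower_bound[OF assms(2,3) p R int weak assms(1,10,5) fpos assms(6) gpos assms(9)])
      (rule that)
  note C2 = C2[folded q_def, folded Y_def \<omega>_def]
  have "\<omega> * (p - 1) + y < 0"
    unfolding \<omega>_def y_def q_def using assms(2,3,4) p
    by (intro strauss_condition) (auto simp: Suc_leI)
  \<comment> \<open>The weight will be delta = T^s. The term from the upper bound decays if s p + y
    < 0, the remainder if omega - s q < 0; since q = p/(p - 1), such an s exists exactly when this
    inequality holds.\<close>
  then have "\<omega> * (p - 1) / p < - y / p" using p by (intro divide_strict_right_mono) auto
  then obtain s where s: "\<omega> * (p - 1) / p < s" "s < - y / p" using dense by blast
  have "s * p + y < 0" using s(2) p by (simp add: field_simps)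
  moreover have "\<omega> - s * q < 0"
    using s(1) p by (simp add: q_def field_simps)
  ultimately have "((\<lambda>T. C1 * T powr (s * p + y) + C2 * T powr (\<omega> - s * q)) \<longlongrightarrow> C1 * 0 + C2 * 0) at_top"
    by (intro tendsto_intros tendsto_neg_powr filterlim_ident)
  then have "\<forall>\<^sub>F T in at_top. C1 * T powr (s * p + y) + C2 * T powr (\<omega> - s * q) < c"
    using c by (intro order_tendstoD(2)) auto
  from eventually_happens'[OF _ eventually_conj[OF this eventually_ge_at_top[of 1]]]
  obtain T where T: "C1 * T powr (s * p + y) + C2 * T powr (\<omega> - s * q) < c" "T \<ge> 1" by auto
  have "c \<le> (T powr s) powr p * Y T + (T powr s) powr (- q) * (C2 * T powr \<omega>)"
    using T(2) by (intro C2) auto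
  also have "\<dots> \<le> (T powr s) powr p * (C1 * T powr y) + (T powr s) powr (- q) * (C2 * T powr \<omega>)"
    using C1(2)[OF T(2)] by (intro add_right_mono mult_left_mono) auto
  also have "\<dots> = C1 * T powr (s * p + y) + C2 * T powr (\<omega> - s * q)"
    by (simp add: powr_powr powr_add[symmetric] algebra_simps)
  finally show False using T(1) by simp
qed

end
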